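(* Let $\mathfrak{g}$ be a Tate Lie algebra over $\mathbb{C}$, let $\mathfrak{b}\subset\mathfrak{g}$ be a Lie subalgebra that is a c-lattice, let $\mathfrak{c}=\mathfrak{g}/\mathfrak{b}$, and fix a section of the projection $\mathfrak{g}\to\mathfrak{c}$, so that $\mathfrak{g}=\mathfrak{b}\oplus\mathfrak{c}$ as vector spaces. Let $R=\Lambda^\bullet(\mathfrak{c}^* )$, $A=\mathfrak{b}\otimes\Lambda^\bullet(\mathfrak{c}^* )$ (both completed), the derivations $d_R$ of $R$ and $d_A$ of $A$, and the element $h\in A_2$ be as constructed in the context from the components of the bracket of $\mathfrak{g}$. Then $(A,R,d_A,d_R,h)$ is a CDG Lie algebroid.
   Context: A Tate space is a complete topological vector space with a base of neighbourhoods of $0$ consisting of mutually commensurable subspaces ($\dim U_1/(U_1\cap U_2)<\infty$ for any two of them). A c-lattice is an open bounded (linearly compact) subspace; the quotient by a c-lattice is discrete. A Tate Lie algebra is a Tate space with a continuous Lie bracket. $V^*$ is the topological dual. CDG Lie algebroid. All gradings are $\mathbb{Z}$-gradings, parity is degree mod 2. A graded super Lie algebroid over a graded supercommutative algebra $R$ is a graded $R$-module $A$ with a graded Lie superalgebra structure and an action of it on $R$ by superderivations with $(ra)(r')=r\,a(r')$ and $[a,rb]=a(r)b+(-1)^{|a||r|}r[a,b]$. A CDG Lie algebroid $(A,R,d_A,d_R,h)$ consists of such $A,R$, a degree 1 superderivation $d_R$ of $R$, a degree 1 superderivation $d_A$ of the Lie superalgebra $A$ with $d_A(ra)=d_R(r)a+(-1)^{|r|}r\,d_A(a)$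 and $d_R(a(r))=(d_Aa)(r)+(-1)^{|a|}a(d_Rr)$, and an element $h\in A_2$ with $d_A^2(a)=[h,a]$, $d_R^2(r)=h(r)$ and $d_A(h)=0$. The algebroid $(A,R)$. $R=\Lambda^\bullet(\mathfrak{c}^* )$ is the completed exterior algebra (Tate dual of the discrete coalgebra $\Lambda^\bullet(\mathfrak{c})$), with $\mathfrak{c}^*$ in degree 1. $A=\mathfrak{b}\otimes\Lambda^\bullet(\mathfrak{c}^* )$ is the completed tensor product (Tate dual to $\mathfrak{b}^*\otimes\Lambda^\bullet(\mathfrak{c})$), with $\mathfrak{b}$ in degree 0; its elements are written as completed sums of $r\otimes b$. $\mathfrak{b}$ acts on $\mathfrak{c}^*=(\mathfrak{g}/\mathfrak{b})^*$ by the coadjoint action and on $R$ by derivations $r\mapsto b(r)$, and (extended by continuity) $$[r\otimes b,r'\otimes b']=rr'\otimes[b,b']+r\,b(r')\otimes b'-(-1)^{|r||r'|}r'\,b'(r)\otimes b,\qquad (r\otimes b)(r')=r\,b(r').$$ Derivations and curvature. For $z\in\mathfrak{g}$ write $z=z_{\mathfrak{b}}+z_{\mathfrak{c}}$ for its components. Let $\{e_j\}$ be a basis of the discrete space $\mathfrak{c}\subset\mathfrak{g}$ and $\{\varepsilon^j\}$ the dual topological basis of $\mathfrak{c}^*$. The components of the bracket $\mathfrak{c}\wedge\mathfrak{c}\to\mathfrak{c}$, $\mathfrak{b}\otimes\mathfrak{c}\to\mathfrak{b}$, $\mathfrak{c}\wedge\mathfrak{c}\to\mathfrak{b}$ give respectively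 (all sums converge in the completions): - $d_R$, the continuous degree 1 superderivation of $R$ with $d_R(\xi)=-\tfrac12\sum_{i,j}\xi([e_i,e_j]_{\mathfrak{c}})\,\varepsilon^i\varepsilon^j$ for $\xi\in\mathfrak{c}^*$; - $d_A$, the continuous map with $d_A(b)=\sum_j\varepsilon^j\otimes[e_j,b]_{\mathfrak{b}}$ for $b\in\mathfrak{b}$, extended by $d_A(r\otimes b)=d_R(r)\otimes b+(-1)^{|r|}r\,d_A(b)$; - $h=\tfrac12\sum_{i,j}\varepsilon^i\varepsilon^j\otimes[e_i,e_j]_{\mathfrak{b}}\in A_2$. *)

theory Defs
  imports "HOL-Analysis.Analysis" "HOL-Library.Function_Algebras"
begin

section \<open>CDG Lie algebroids\<close>

definition ksign :: "int \<Rightarrow> int \<Rightarrow> complex"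
  where "ksign m n = (-1) powi (m * n)"

text \<open>A graded vector space is given by its homogeneous components inside an ambient vector
  space; the graded space itself is their internal direct sum \<open>total\<close>.\<close>

definition total :: "(complex \<Rightarrow> 'v \<Rightarrow> 'v) \<Rightarrow> (int \<Rightarrow> 'v::ab_group_add set) \<Rightarrow> 'v set"
  where "total sV V = module.span sV (\<Union>n. V n)"

locale graded_space = vector_space sV
  for sV :: "complex \<Rightarrow> 'v::ab_group_add \<Rightarrow> 'v" +
  fixes V :: "int \<Rightarrow> 'v set"
  assumes subspace_component: "subspace (V n)"
    and components_independent:
      "\<lbrakk>finite I; \<And>i. i \<in> I \<Longrightarrow> x i \<in> V i; (\<Sum>i\<in>I. x i) = 0; i \<in> I\<rbrakk> \<Longrightarrow> x i = 0"

definition linear_betw ::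
  "(complex \<Rightarrow> 'v \<Rightarrow> 'v) \<Rightarrow> 'v::ab_group_add set \<Rightarrow> (complex \<Rightarrow> 'w \<Rightarrow> 'w) \<Rightarrow> ('v \<Rightarrow> 'w::ab_group_add) \<Rightarrow> bool"
  where "linear_betw sV S sW f \<longleftrightarrow>
    (\<forall>x\<in>S. \<forall>y\<in>S. f (x + y) = f x + f y) \<and> (\<forall>a. \<forall>x\<in>S. f (sV a x) = sW a (f x))"

definition graded_linear ::
  "(complex \<Rightarrow> 'v \<Rightarrow> 'v) \<Rightarrow> (int \<Rightarrow> 'v::ab_group_add set) \<Rightarrow>
   (complex \<Rightarrow> 'w \<Rightarrow> 'w) \<Rightarrow> (int \<Rightarrow> 'w::ab_group_add set) \<Rightarrow> int \<Rightarrow> ('v \<Rightarrow> 'w) \<Rightarrow> bool"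
  where "graded_linear sV V sW W k f \<longleftrightarrow>
    linear_betw sV (total sV V) sW f \<and> (\<forall>n. f ` V n \<subseteq> W (n + k))"

definition graded_bilinear ::
  "(complex \<Rightarrow> 'u \<Rightarrow> 'u) \<Rightarrow> (int \<Rightarrow> 'u::ab_group_add set) \<Rightarrow>
   (complex \<Rightarrow> 'v \<Rightarrow> 'v) \<Rightarrow> (int \<Rightarrow> 'v::ab_group_add set) \<Rightarrow>
   (complex \<Rightarrow> 'w \<Rightarrow> 'w) \<Rightarrow> (int \<Rightarrow> 'w::ab_group_add set) \<Rightarrow> ('u \<Rightarrow> 'v \<Rightarrow> 'w) \<Rightarrow> bool"
  where "graded_bilinear sU U sV V sW W f \<longleftrightarrow>
    (\<forall>x\<in>total sU U. linear_betw sV (total sV V) sW (f x)) \<and>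
    (\<forall>y\<in>total sV V. linear_betw sU (total sU U) sW (\<lambda>x. f x y)) \<and>
    (\<forall>m n. \<forall>x\<in>U m. \<forall>y\<in>V n. f x y \<in> W (m + n))"

definition superderivation ::
  "(complex \<Rightarrow> 'r \<Rightarrow> 'r) \<Rightarrow> (int \<Rightarrow> 'r::ab_group_add set) \<Rightarrow> ('r \<Rightarrow> 'r \<Rightarrow> 'r) \<Rightarrow> int \<Rightarrow> ('r \<Rightarrow> 'r) \<Rightarrow> bool"
  where "superderivation sR R mul k D \<longleftrightarrow>
    graded_linear sR R sR R k D \<and>
    (\<forall>m n. \<forall>x\<in>R m. \<forall>y\<in>R n. D (mul x y) = mul (D x) y + sR (ksign k m) (mul x (D y)))"

locale graded_supercomm_algebra = graded_space sR R
  for sR :: "complex \<Rightarrow> 'r::ab_group_add \<Rightarrow> 'r" and R :: "int \<Rightarrow> 'r set" +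
  fixes mul :: "'r \<Rightarrow> 'r \<Rightarrow> 'r" and one :: 'r
  assumes mul_bilinear: "graded_bilinear sR R sR R sR R mul"
    and one_degree: "one \<in> R 0"
    and mul_one: "x \<in> R m \<Longrightarrow> mul one x = x"
    and mul_assoc: "\<lbrakk>x \<in> R m; y \<in> R n; z \<in> R k\<rbrakk> \<Longrightarrow> mul (mul x y) z = mul x (mul y z)"
    and mul_supercomm: "\<lbrakk>x \<in> R m; y \<in> R n\<rbrakk> \<Longrightarrow> mul x y = sR (ksign m n) (mul y x)"

locale graded_lie_superalgebra = graded_space sA A
  for sA :: "complex \<Rightarrow> 'a::ab_group_add \<Rightarrow> 'a" and A :: "int \<Rightarrow> 'a set" +
  fixes br :: "'a \<Rightarrow> 'a \<Rightarrow> 'a"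
  assumes br_bilinear: "graded_bilinear sA A sA A sA A br"
    and br_antisym: "\<lbrakk>a \<in> A m; b \<in> A n\<rbrakk> \<Longrightarrow> br a b = - sA (ksign m n) (br b a)"
    and br_jacobi: "\<lbrakk>a \<in> A m; b \<in> A n; c \<in> A k\<rbrakk> \<Longrightarrow>
      br a (br b c) = br (br a b) c + sA (ksign m n) (br b (br a c))"

locale graded_super_lie_algebroid =
  R: graded_supercomm_algebra sR R mul one + A: graded_lie_superalgebra sA A br
  for sR :: "complex \<Rightarrow> 'r::ab_group_add \<Rightarrow> 'r" and R mul one
    and sA :: "complex \<Rightarrow> 'a::ab_group_add \<Rightarrow> 'a" and A br +
  fixes smul :: "'r \<Rightarrow> 'a \<Rightarrow> 'a" and act :: "'a \<Rightarrow> 'r \<Rightarrow> 'r"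
  assumes smul_bilinear: "graded_bilinear sR R sA A sA A smul"
    and smul_one: "a \<in> A m \<Longrightarrow> smul one a = a"
    and smul_assoc: "\<lbrakk>r \<in> R m; r' \<in> R n; a \<in> A k\<rbrakk> \<Longrightarrow> smul (mul r r') a = smul r (smul r' a)"
    and act_bilinear: "graded_bilinear sA A sR R sR R act"
    and act_superderivation: "a \<in> A m \<Longrightarrow> superderivation sR R mul m (act a)"
    and act_br: "\<lbrakk>a \<in> A m; b \<in> A n; r \<in> R k\<rbrakk> \<Longrightarrow>
      act (br a b) r = act a (act b r) - sR (ksign m n) (act b (act a r))"
    and act_smul: "\<lbrakk>r \<in> R m; a \<in> A n; r' \<in> R k\<rbrakk> \<Longrightarrow> act (smul r a) r' = mul r (act a r')"
    and br_smul: "\<lbrakk>a \<in> A m; r \<in> R n; b \<in> A k\<rbrakk> \<Longrightarrow>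
      br a (smul r b) = smul (act a r) b + sA (ksign m n) (smul r (br a b))"

locale cdg_lie_algebroid = graded_super_lie_algebroid sR R mul one sA A br smul act
  for sR :: "complex \<Rightarrow> 'r::ab_group_add \<Rightarrow> 'r" and R mul one
    and sA :: "complex \<Rightarrow> 'a::ab_group_add \<Rightarrow> 'a" and A br smul act +
  fixes dA :: "'a \<Rightarrow> 'a" and dR :: "'r \<Rightarrow> 'r" and h :: 'a
  assumes dR_superderivation: "superderivation sR R mul 1 dR"
    and dA_superderivation: "superderivation sA A br 1 dA"
    and dA_smul: "\<lbrakk>r \<in> R m; a \<in> A n\<rbrakk> \<Longrightarrow>
      dA (smul r a) = smul (dR r) a + sA (ksign 1 m) (smul r (dA a))"
    and dR_act: "\<lbrakk>a \<in> A m; r \<in> R n\<rbrakk> \<Longrightarrow>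
      dR (act a r) = act (dA a) r + sR (ksign 1 m) (act a (dR r))"
    and h_degree: "h \<in> A 2"
    and dA_dA: "a \<in> A m \<Longrightarrow> dA (dA a) = br h a"
    and dR_dR: "r \<in> R m \<Longrightarrow> dR (dR r) = act h r"
    and dA_h: "dA h = 0"


section \<open>Tate Lie algebras\<close>

text \<open>The field of complex numbers carries the discrete topology throughout, so scalars are
  kept separate from the real and complex vector space classes of the library.\<close>

definition finite_quotient ::
  "(complex \<Rightarrow> 'g \<Rightarrow> 'g) \<Rightarrow> 'g::ab_group_add set \<Rightarrow> 'g set \<Rightarrow> bool"
  \<comment> \<open>\<open>U / (U \<inter> W)\<close> is finite-dimensional\<close>
  where "finite_quotient sc U W \<longleftrightarrow>
    (\<exists>F. finite F \<and> F \<subseteq> U \<and> U \<subseteq> module.span sc (F \<union> (U \<inter> W)))"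

definition tate_space ::
  "(complex \<Rightarrow> 'g \<Rightarrow> 'g::{ab_group_add,uniform_topological_group_add,t2_space}) \<Rightarrow> bool"
  where "tate_space sc \<longleftrightarrow>
    vector_space sc \<and> (\<forall>a. continuous_on UNIV (sc a)) \<and>
    complete (UNIV :: 'g set) \<and>
    (\<exists>\<U>. (\<forall>U\<in>\<U>. module.subspace sc U \<and> open U) \<and>
         (\<forall>N. open N \<and> 0 \<in> N \<longrightarrow> (\<exists>U\<in>\<U>. U \<subseteq> N)) \<and>
         (\<forall>U1\<in>\<U>. \<forall>U2\<in>\<U>. finite_quotient sc U1 U2))"

text \<open>An open subgroup is closed, hence complete here; so the bounded open subspaces are
  automatically linearly compact.\<close>

definition c_lattice ::
  "(complex \<Rightarrow> 'g \<Rightarrow> 'g::{ab_group_add,topological_space}) \<Rightarrow> 'g set \<Rightarrow> bool"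
  where "c_lattice sc B \<longleftrightarrow>
    module.subspace sc B \<and> open B \<and>
    (\<forall>U. module.subspace sc U \<and> open U \<longrightarrow> finite_quotient sc B U)"

definition lie_bracket :: "(complex \<Rightarrow> 'g \<Rightarrow> 'g) \<Rightarrow> ('g \<Rightarrow> 'g \<Rightarrow> 'g::ab_group_add) \<Rightarrow> bool"
  where "lie_bracket sc lie \<longleftrightarrow>
    (\<forall>x. Vector_Spaces.linear sc sc (lie x)) \<and>
    (\<forall>y. Vector_Spaces.linear sc sc (\<lambda>x. lie x y)) \<and>
    (\<forall>x. lie x x = 0) \<and>
    (\<forall>x y z. lie x (lie y z) + lie y (lie z x) + lie z (lie x y) = 0)"

definition tate_lie_algebra ::
  "(complex \<Rightarrow> 'g \<Rightarrow> 'g) \<Rightarrow> ('g \<Rightarrow> 'g \<Rightarrow> 'g::{ab_group_add,uniform_topological_group_add,t2_space}) \<Rightarrow> bool"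
  where "tate_lie_algebra sc lie \<longleftrightarrow>
    tate_space sc \<and> lie_bracket sc lie \<and> continuous_on UNIV (\<lambda>(x, y). lie x y)"

definition lie_subalgebra ::
  "(complex \<Rightarrow> 'g \<Rightarrow> 'g) \<Rightarrow> ('g \<Rightarrow> 'g \<Rightarrow> 'g::ab_group_add) \<Rightarrow> 'g set \<Rightarrow> bool"
  where "lie_subalgebra sc lie B \<longleftrightarrow>
    module.subspace sc B \<and> (\<forall>x\<in>B. \<forall>y\<in>B. lie x y \<in> B)"

text \<open>A linear section of \<open>g \<rightarrow> g/B\<close>, encoded by its composite \<open>s\<close> with the projection: \<open>s\<close> is
  constant on cosets of \<open>B\<close>, and \<open>s x\<close> lies in the coset of \<open>x\<close>. Then \<open>c = g/B\<close> is identified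
  with \<open>range s\<close>, and the components of \<open>z\<close> are \<open>s z\<close> in \<open>c\<close> and \<open>z - s z\<close> in \<open>B\<close>.\<close>

definition linear_section ::
  "(complex \<Rightarrow> 'g \<Rightarrow> 'g) \<Rightarrow> 'g::ab_group_add set \<Rightarrow> ('g \<Rightarrow> 'g) \<Rightarrow> bool"
  where "linear_section sc B s \<longleftrightarrow>
    Vector_Spaces.linear sc sc s \<and> (\<forall>x\<in>B. s x = 0) \<and> (\<forall>x. x - s x \<in> B)"

definition basis_of ::
  "(complex \<Rightarrow> 'g \<Rightarrow> 'g) \<Rightarrow> 'g::ab_group_add set \<Rightarrow> 'g set \<Rightarrow> bool"
  where "basis_of sc C E \<longleftrightarrow> \<not> module.dependent sc E \<and> module.span sc E = C"


section \<open>The completed exterior algebra and tensor product\<close>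

definition fscale :: "complex \<Rightarrow> ('x \<Rightarrow> complex) \<Rightarrow> 'x \<Rightarrow> complex"
  where "fscale a f = (\<lambda>x. a * f x)"

definition pointwise_topology :: "('x \<Rightarrow> complex) set \<Rightarrow> ('x \<Rightarrow> complex) topology"
  where "pointwise_topology S =
    subtopology (product_topology (\<lambda>_. discrete_topology UNIV) UNIV) S"

text \<open>Linear forms on a subspace are extended by zero to the whole space.\<close>

definition tate_dual ::
  "(complex \<Rightarrow> 'g \<Rightarrow> 'g) \<Rightarrow> 'g::{ab_group_add,topological_space} set \<Rightarrow> ('g \<Rightarrow> complex) set"
  where "tate_dual sc B = {\<phi>. linear_betw sc B (*) \<phi> \<and> (\<forall>x. x \<notin> B \<longrightarrow> \<phi> x = 0) \<and>
    continuous_map (top_of_set B) (discrete_topology UNIV) \<phi>}"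

text \<open>The degree \<open>n\<close> part of the completed exterior algebra of \<open>C\<^sup>*\<close> is the full dual of
  \<open>\<Lambda>\<^sup>n(C)\<close> with its linearly compact topology: alternating \<open>n\<close>-linear forms on the discrete space
  \<open>C\<close> with pointwise convergence. A form takes the list of its arguments, extended by zero.\<close>

definition ext_dual ::
  "(complex \<Rightarrow> 'g \<Rightarrow> 'g) \<Rightarrow> 'g::ab_group_add set \<Rightarrow> int \<Rightarrow> ('g list \<Rightarrow> complex) set"
  where "ext_dual sc C n = {r.
    (\<forall>xs. r xs \<noteq> 0 \<longrightarrow> int (length xs) = n \<and> set xs \<subseteq> C) \<and>
    (\<forall>xs ys. set xs \<subseteq> C \<and> set ys \<subseteq> C \<longrightarrow> linear_betw sc C (*) (\<lambda>x. r (xs @ x # ys))) \<and>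
    (\<forall>xs ys zs x. r (xs @ x # ys @ x # zs) = 0)}"

definition ext_one :: "'g list \<Rightarrow> complex"
  where "ext_one xs = (if xs = [] then 1 else 0)"

text \<open>The product is dual to the coproduct of the exterior coalgebra: the sum over all
  unshuffles, a subset \<open>I\<close> of the positions going to the left factor.\<close>

definition unshuffle_sign :: "nat \<Rightarrow> nat set \<Rightarrow> complex"
  where "unshuffle_sign n I = (-1) ^ card {(i, j). i \<in> I \<and> j < n \<and> j \<notin> I \<and> j < i}"

definition wedge :: "('g list \<Rightarrow> complex) \<Rightarrow> ('g list \<Rightarrow> complex) \<Rightarrow> 'g list \<Rightarrow> complex"
  where "wedge r r' xs =
    (\<Sum>I\<in>Pow {..<length xs}. unshuffle_sign (length xs) I * r (nths xs I) * r' (nths xs (- I)))"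

text \<open>The degree \<open>n\<close> part of the completed tensor product of \<open>B\<close> with the exterior algebra of
  \<open>C\<^sup>*\<close>, as the full dual of \<open>B\<^sup>* \<otimes> \<Lambda>\<^sup>n(C)\<close>.\<close>

definition compl_tensor ::
  "(complex \<Rightarrow> 'g \<Rightarrow> 'g) \<Rightarrow> 'g::{ab_group_add,topological_space} set \<Rightarrow> 'g set \<Rightarrow> int
   \<Rightarrow> (('g \<Rightarrow> complex) \<times> 'g list \<Rightarrow> complex) set"
  where "compl_tensor sc B C n = {f.
    (\<forall>\<phi> xs. \<phi> \<notin> tate_dual sc B \<longrightarrow> f (\<phi>, xs) = 0) \<and>
    (\<forall>xs. linear_betw fscale (tate_dual sc B) (*) (\<lambda>\<phi>. f (\<phi>, xs))) \<and>
    (\<forall>\<phi>\<in>tate_dual sc B. (\<lambda>xs. f (\<phi>, xs)) \<in> ext_dual sc C n)}"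

definition tens ::
  "(complex \<Rightarrow> 'g \<Rightarrow> 'g) \<Rightarrow> 'g::{ab_group_add,topological_space} set \<Rightarrow> ('g list \<Rightarrow> complex) \<Rightarrow> 'g
   \<Rightarrow> ('g \<Rightarrow> complex) \<times> 'g list \<Rightarrow> complex"
  where "tens sc B r b = (\<lambda>(\<phi>, xs). if \<phi> \<in> tate_dual sc B then r xs * \<phi> b else 0)"

definition tens_smul ::
  "('g list \<Rightarrow> complex) \<Rightarrow> (('g \<Rightarrow> complex) \<times> 'g list \<Rightarrow> complex)
   \<Rightarrow> ('g \<Rightarrow> complex) \<times> 'g list \<Rightarrow> complex"
  where "tens_smul r f = (\<lambda>(\<phi>, xs). wedge r (\<lambda>ys. f (\<phi>, ys)) xs)"

definition dual_basis_form ::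
  "(complex \<Rightarrow> 'g \<Rightarrow> 'g) \<Rightarrow> 'g::ab_group_add set \<Rightarrow> 'g \<Rightarrow> 'g list \<Rightarrow> complex"
  where "dual_basis_form sc E e xs =
    (case xs of [x] \<Rightarrow> module.representation sc E x e | _ \<Rightarrow> 0)"


section \<open>The algebroid attached to a c-lattice with a section\<close>

text \<open>Each operation is specified as in the construction: by its values on generators or on
  pure tensors, together with the continuity that extends it to the completion. This determines the
  operations on \<open>R\<close> and \<open>A\<close>; that they exist is not assumed. The map \<open>\<rho>\<close> is
  the action of \<open>B\<close> on \<open>R\<close>.\<close>

locale c_lattice_algebroid =
  fixes sc :: "complex \<Rightarrow> 'g \<Rightarrow> 'g::{ab_group_add,topological_space}"
    and lie :: "'g \<Rightarrow> 'g \<Rightarrow> 'g" and B :: "'g set" and s :: "'g \<Rightarrow> 'g"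
    and R :: "int \<Rightarrow> ('g list \<Rightarrow> complex) set"
    and A :: "int \<Rightarrow> (('g \<Rightarrow> complex) \<times> 'g list \<Rightarrow> complex) set"
    and \<rho> :: "'g \<Rightarrow> ('g list \<Rightarrow> complex) \<Rightarrow> 'g list \<Rightarrow> complex"
    and act :: "(('g \<Rightarrow> complex) \<times> 'g list \<Rightarrow> complex) \<Rightarrow> ('g list \<Rightarrow> complex) \<Rightarrow> 'g list \<Rightarrow> complex"
    and br :: "(('g \<Rightarrow> complex) \<times> 'g list \<Rightarrow> complex) \<Rightarrow> (('g \<Rightarrow> complex) \<times> 'g list \<Rightarrow> complex)
      \<Rightarrow> ('g \<Rightarrow> complex) \<times> 'g list \<Rightarrow> complex"
  assumes R_eq: "R = ext_dual sc (range s)"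
    and A_eq: "A = compl_tensor sc B (range s)"
    and \<rho>_derivation: "b \<in> B \<Longrightarrow> superderivation fscale R wedge 0 (\<rho> b)"
    and \<rho>_continuous: "b \<in> B \<Longrightarrow>
      continuous_map (pointwise_topology (R n)) (pointwise_topology (R n)) (\<rho> b)"
    and \<rho>_coadjoint: "\<lbrakk>b \<in> B; \<xi> \<in> R 1; x \<in> range s\<rbrakk> \<Longrightarrow> \<rho> b \<xi> [x] = - \<xi> [s (lie b x)]"
    and act_bilinear: "graded_bilinear fscale A fscale R fscale R act"
    and act_continuous:
      "continuous_map (prod_topology (pointwise_topology (A m)) (pointwise_topology (R n)))
         (pointwise_topology (R (m + n))) (\<lambda>(a, r). act a r)"
    and act_tens: "\<lbrakk>r \<in> R m; b \<in> B; r' \<in> R n\<rbrakk> \<Longrightarrow> act (tens sc B r b) r' = wedge r (\<rho> b r')"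
    and br_bilinear: "graded_bilinear fscale A fscale A fscale A br"
    and br_continuous:
      "continuous_map (prod_topology (pointwise_topology (A m)) (pointwise_topology (A n)))
         (pointwise_topology (A (m + n))) (\<lambda>(a, a'). br a a')"
    and br_tens: "\<lbrakk>r \<in> R m; b \<in> B; r' \<in> R n; b' \<in> B\<rbrakk> \<Longrightarrow>
      br (tens sc B r b) (tens sc B r' b') =
        tens sc B (wedge r r') (lie b b') + tens sc B (wedge r (\<rho> b r')) b'
        - fscale (ksign m n) (tens sc B (wedge r' (\<rho> b' r)) b)"

locale c_lattice_cdg_data = c_lattice_algebroid sc lie B s R A \<rho> act br
  for sc :: "complex \<Rightarrow> 'g \<Rightarrow> 'g::{ab_group_add,topological_space}"
    and lie B s R A \<rho> act br +
  fixes E :: "'g set"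
    and dA :: "(('g \<Rightarrow> complex) \<times> 'g list \<Rightarrow> complex) \<Rightarrow> ('g \<Rightarrow> complex) \<times> 'g list \<Rightarrow> complex"
    and dR :: "('g list \<Rightarrow> complex) \<Rightarrow> 'g list \<Rightarrow> complex"
    and h :: "('g \<Rightarrow> complex) \<times> 'g list \<Rightarrow> complex"
  assumes dR_derivation: "superderivation fscale R wedge 1 dR"
    and dR_continuous:
      "continuous_map (pointwise_topology (R n)) (pointwise_topology (R (n + 1))) dR"
    and dR_generators: "\<xi> \<in> R 1 \<Longrightarrow>
      limitin (pointwise_topology (R 2))
        (\<lambda>F. \<Sum>(i, j)\<in>F. fscale (- 1 / 2 * \<xi> [s (lie i j)])
           (wedge (dual_basis_form sc E i) (dual_basis_form sc E j)))
        (dR \<xi>) (finite_subsets_at_top (E \<times> E))"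
    and dA_linear: "graded_linear fscale A fscale A 1 dA"
    and dA_continuous:
      "continuous_map (pointwise_topology (A n)) (pointwise_topology (A (n + 1))) dA"
    and dA_generators: "b \<in> B \<Longrightarrow>
      limitin (pointwise_topology (A 1))
        (\<lambda>F. \<Sum>j\<in>F. tens sc B (dual_basis_form sc E j) (lie j b - s (lie j b)))
        (dA (tens sc B ext_one b)) (finite_subsets_at_top E)"
    and dA_tens: "\<lbrakk>r \<in> R m; b \<in> B\<rbrakk> \<Longrightarrow>
      dA (tens sc B r b) =
        tens sc B (dR r) b + fscale (ksign 1 m) (tens_smul r (dA (tens sc B ext_one b)))"
    and h_limit:
      "limitin (pointwise_topology (A 2))
        (\<lambda>F. \<Sum>(i, j)\<in>F. fscale (1 / 2) (tens sc B
           (wedge (dual_basis_form sc E i) (dual_basis_form sc E j))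
           (lie i j - s (lie i j))))
        h (finite_subsets_at_top (E \<times> E))"

end

theory Submission
  imports Defs
begin

text \<open>
  Both halves of the statement rest on a description of the completed exterior algebra by
  contractions. Opening a multilinear function at its first argument is a superderivation of the
  shuffle product (\<open>wedge_Cons\<close>), and a function is determined by its contractions. Hence
  associativity, supercommutativity and the closure of the alternating forms under the product all
  follow by induction on the list of arguments, with no combinatorics of permutations.

  For the existence of the operations, superderivations of \<open>R\<close> are written as locally finite sums
  \<open>r \<mapsto> \<Sum>\<^sub>i w\<^sub>i \<and> \<iota>(e\<^sub>i) r\<close>; the Leibniz rule is then inherited from the contractions
  (\<open>derivation_sum_superderivation\<close>). For \<open>d\<^sub>R\<close> the coefficients are the two-forms
  \<open>d \<epsilon>\<^sup>j\<close>. An element \<open>a\<close> of the completed tensor product, seen as a function of a functional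
  \<open>\<phi>\<close> on \<open>B\<close> with values in forms, acts with the coefficients \<open>- a(\<phi>\<^sub>k\<^sub>j) \<and> \<epsilon>\<^sup>k\<close>, where
  \<open>\<phi>\<^sub>k\<^sub>j(b) = \<epsilon>\<^sup>j([b, e\<^sub>k])\<close> are the matrix coefficients of the coadjoint action. For the bracket one
  must make sense of \<open>\<phi>([b, b'])\<close> on the completion, and this is possible because a continuous
  bilinear functional on the linearly compact space \<open>B\<close> has finite rank
  (\<open>bracket_finite_rank\<close>). In both cases the coefficients are functionals on \<open>B\<close>, and finite in
  number, because the bracket of \<open>g\<close> is continuous and the c-lattice is open and bounded. Every
  operation so obtained depends, at each argument, on finitely many values of its inputs, which is
  the required continuity.

  The axioms are verified for arbitrary data satisfying the specification. All identities are
  between continuous multilinear maps, so they may be tested on pure tensors, which are dense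
  (\<open>A_eq_on_tens\<close>), and identities between superderivations of \<open>R\<close> may be tested on one-forms,
  because Euler's identity makes these topological generators (\<open>leibniz_eqI\<close>). The Jacobi identity
  and the Leibniz rule for \<open>d\<^sub>A\<close> are moreover linear over \<open>R\<close> in each argument, which reduces them to
  elements \<open>1 \<otimes> b\<close>. What is left, besides the Jacobi identity of \<open>B\<close>, are identities between forms of
  degree at most three. Evaluated at vectors of \<open>c\<close> they are the two components of the Jacobi
  identity of \<open>g\<close>: for \<open>b, b', x\<close> (the action is a representation, \<open>d\<^sub>A\<close> is a derivation), for
  \<open>b, x, y\<close> (compatibility of \<open>d\<^sub>R\<close> with the action, \<open>d\<^sub>A\<^sup>2 = [h, -]\<close>), and for \<open>x, y, z\<close>
  (\<open>d\<^sub>R\<^sup>2 = h\<close> and \<open>d\<^sub>A h = 0\<close>), with \<open>b, b'\<close> in \<open>B\<close> and \<open>x, y, z\<close> in \<open>c\<close>.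
\<close>

section \<open>The shuffle product of multilinear functions\<close>

lemma sum_apply: "(\<Sum>i\<in>K. f i) x = (\<Sum>i\<in>K. (f i x :: 'b::comm_monoid_add))"
  by (induction K rule: infinite_finite_induct) auto

lemma fscale_apply [simp]: "fscale c f x = c * f x"
  by (simp add: fscale_def)

lemma fscale_one [simp]: "fscale 1 f = f" and fscale_minus_one [simp]: "fscale (-1) f = - f"
  and fscale_zero [simp]: "fscale 0 f = 0" and fscale_zero_right [simp]: "fscale c 0 = 0"
  by (auto simp: fun_eq_iff)

text \<open>The interior product with the vector \<open>x\<close>.\<close>

definition contract :: "'g \<Rightarrow> ('g list \<Rightarrow> complex) \<Rightarrow> 'g list \<Rightarrow> complex"
  where "contract x r = (\<lambda>xs. r (x # xs))"

text \<open>The parity involution, multiplication by \<open>(-1)\<^sup>n\<close> in degree \<open>n\<close>. With it the product rule for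
  contractions holds for all functions on lists, so that inductions over the argument list need not
  carry degrees along.\<close>

definition grade_inv :: "('g list \<Rightarrow> complex) \<Rightarrow> 'g list \<Rightarrow> complex"
  where "grade_inv r = (\<lambda>xs. (-1) ^ length xs * r xs)"

lemma contract_simps [simp]:
  "contract x (r + r') = contract x r + contract x r'"
  "contract x (r - r') = contract x r - contract x r'"
  "contract x (- r) = - contract x r"
  "contract x (fscale c r) = fscale c (contract x r)"
  "contract x 0 = 0"
  "contract x (\<Sum>i\<in>K. f i) = (\<Sum>i\<in>K. contract x (f i))"
  by (auto simp: contract_def fun_eq_iff sum_apply)

lemma Pow_lessThan_Suc_shift:
  "Pow {..<Suc n} = (\<lambda>I. insert 0 (Suc ` I)) ` Pow {..<n} \<union> (\<lambda>I. Suc ` I) ` Pow {..<n}"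
proof (intro equalityI subsetI)
  fix I assume I: "I \<in> Pow {..<Suc n}"
  define I' where "I' = {i. Suc i \<in> I}"
  have 1: "I' \<in> Pow {..<n}" using I by (auto simp: I'_def)
  have "i \<in> I \<longleftrightarrow> i \<in> (if 0 \<in> I then insert 0 (Suc ` I') else Suc ` I')" for i
    by (cases i) (auto simp: I'_def)
  then have "I = (if 0 \<in> I then insert 0 (Suc ` I') else Suc ` I')" by blast
  then show "I \<in> (\<lambda>I. insert 0 (Suc ` I)) ` Pow {..<n} \<union> (\<lambda>I. Suc ` I) ` Pow {..<n}"
    using 1 by (metis UnI1 UnI2 imageI)
qed auto

lemma unshuffle_sign_insert_0: "unshuffle_sign (Suc n) (insert 0 (Suc ` I)) = unshuffle_sign n I"
proof -
  have "{(i, j). i \<in> insert 0 (Suc ` I) \<and> j < Suc n \<and> j \<notin> insert 0 (Suc ` I) \<and> j < i}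
    = map_prod Suc Suc ` {(i, j). i \<in> I \<and> j < n \<and> j \<notin> I \<and> j < i}" (is "?L = ?R")
  proof (intro equalityI subsetI)
    fix p assume "p \<in> ?L"
    then obtain i j where p: "p = (i, j)" "i \<in> insert 0 (Suc ` I)" "j < Suc n" "j \<notin> insert 0 (Suc ` I)" "j < i"
      by auto
    then obtain i' j' where "i = Suc i'" "j = Suc j'" by (metis insertI1 not0_implies_Suc not_less_zero)
    then show "p \<in> ?R" using p by (auto simp: image_iff)
  qed auto
  moreover have "card (map_prod Suc Suc ` {(i, j). i \<in> I \<and> j < n \<and> j \<notin> I \<and> j < i})
    = card {(i, j). i \<in> I \<and> j < n \<and> j \<notin> I \<and> j < i}"
    by (rule card_image) (auto simp: inj_on_def)
  ultimately show ?thesis unfolding unshuffle_sign_def by simp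
qed

lemma unshuffle_sign_shift:
  assumes "I \<subseteq> {..<n}"
  shows "unshuffle_sign (Suc n) (Suc ` I) = (-1) ^ card I * unshuffle_sign n I"
proof -
  have fin: "finite I" using assms finite_subset by blast
  have "{(i, j). i \<in> Suc ` I \<and> j < Suc n \<and> j \<notin> Suc ` I \<and> j < i}
    = (\<lambda>i. (Suc i, 0)) ` I \<union> map_prod Suc Suc ` {(i, j). i \<in> I \<and> j < n \<and> j \<notin> I \<and> j < i}" (is "?L = ?M \<union> ?R")
  proof (intro equalityI subsetI)
    fix p assume "p \<in> ?L"
    then obtain i j where p: "p = (i, j)" "i \<in> Suc ` I" "j < Suc n" "j \<notin> Suc ` I" "j < i"
      by auto
    then show "p \<in> ?M \<union> ?R" by (cases j) (auto simp: image_iff)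
  qed auto
  moreover have "finite {(i, j). i \<in> I \<and> j < n \<and> j \<notin> I \<and> j < i}"
    by (rule finite_subset[of _ "I \<times> {..<n}"]) (use fin in auto)
  moreover have "?M \<inter> ?R = {}" by auto
  ultimately have "card ?L = card ?M + card ?R"
    using fin by (simp add: card_Un_disjoint)
  also have "card ?M = card I" by (simp add: card_image inj_on_def)
  also have "card ?R = card {(i, j). i \<in> I \<and> j < n \<and> j \<notin> I \<and> j < i}"
    by (rule card_image) (auto simp: inj_on_def)
  finally show ?thesis unfolding unshuffle_sign_def by (simp add: power_add)
qed

lemma wedge_Nil [simp]: "wedge r r' [] = r [] * r' []"
  by (simp add: wedge_def unshuffle_sign_def)

text \<open>The subsets of positions are split according to the factor that receives the head of the list. A
  head going to the left factor creates no inversion; one going to the right factor is jumped over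
  by every position of the left factor, which produces the parity involution.\<close>

lemma wedge_Cons:
  "wedge r r' (x # xs) = wedge (contract x r) r' xs + wedge (grade_inv r) (contract x r') xs"
proof -
  let ?n = "length xs"
  have inj1: "inj_on (\<lambda>I. insert 0 (Suc ` I)) (Pow {..<?n})"
  proof (rule inj_onI)
    fix I J assume "insert 0 (Suc ` I) = insert 0 (Suc ` J)"
    then have "{i. Suc i \<in> insert 0 (Suc ` I)} = {i. Suc i \<in> insert 0 (Suc ` J)}" by simp
    then show "I = J" by auto
  qed
  have inj2: "inj_on (\<lambda>I. Suc ` I) (Pow {..<?n})" by (rule inj_onI) (simp add: inj_image_eq_iff)
  have pre: "{j. Suc j \<in> Suc ` I} = I" "{j. j \<in> I} = I" "{j. j \<notin> I} = - I" for I by auto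
  have len: "length (nths xs I) = card I" if "I \<subseteq> {..<?n}" for I
  proof -
    have "{i. i < ?n \<and> i \<in> I} = I" using that by auto
    then show ?thesis by (simp add: length_nths)
  qed
  have "wedge r r' (x # xs) =
     (\<Sum>I\<in>(\<lambda>I. insert 0 (Suc ` I)) ` Pow {..<?n}. unshuffle_sign (Suc ?n) I * r (nths (x # xs) I) * r' (nths (x # xs) (- I)))
   + (\<Sum>I\<in>(\<lambda>I. Suc ` I) ` Pow {..<?n}. unshuffle_sign (Suc ?n) I * r (nths (x # xs) I) * r' (nths (x # xs) (- I)))"
    unfolding wedge_def length_Cons Pow_lessThan_Suc_shift by (rule sum.union_disjoint) auto
  also have "(\<Sum>I\<in>(\<lambda>I. insert 0 (Suc ` I)) ` Pow {..<?n}. unshuffle_sign (Suc ?n) I * r (nths (x # xs) I) * r' (nths (x # xs) (- I)))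
    = wedge (contract x r) r' xs"
    unfolding wedge_def contract_def sum.reindex[OF inj1]
    by (rule sum.cong) (auto simp: unshuffle_sign_insert_0 nths_Cons pre image_iff)
  also have "(\<Sum>I\<in>(\<lambda>I. Suc ` I) ` Pow {..<?n}. unshuffle_sign (Suc ?n) I * r (nths (x # xs) I) * r' (nths (x # xs) (- I)))
    = wedge (grade_inv r) (contract x r') xs"
    unfolding wedge_def contract_def grade_inv_def sum.reindex[OF inj2]
    by (rule sum.cong) (auto simp: unshuffle_sign_shift nths_Cons pre len image_iff)
  finally show ?thesis .
qed

lemma contract_wedge:
  "contract x (wedge r r') = wedge (contract x r) r' + wedge (grade_inv r) (contract x r')"
  by (auto simp: contract_def fun_eq_iff wedge_Cons)

lemma wedge_cong:
  assumes "\<And>ys. set ys \<subseteq> set xs \<Longrightarrow> length ys \<le> length xs \<Longrightarrow> r ys = r1 ys"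
    and "\<And>ys. set ys \<subseteq> set xs \<Longrightarrow> length ys \<le> length xs \<Longrightarrow> r' ys = r1' ys"
  shows "wedge r r' xs = wedge r1 r1' xs"
proof -
  have "length (nths xs I) \<le> length xs" for I
    unfolding length_nths by (rule order_trans[OF card_mono[of "{..<length xs}"]]) auto
  then have "r (nths xs I) = r1 (nths xs I)" "r' (nths xs I) = r1' (nths xs I)" for I
    by (simp_all add: assms set_nths_subset)
  then show ?thesis unfolding wedge_def by simp
qed

lemma wedge_add_left: "wedge (r + r1) r' = wedge r r' + wedge r1 r'"
  and wedge_add_right: "wedge r (r' + r1) = wedge r r' + wedge r r1"
  and wedge_diff_left: "wedge (r - r1) r' = wedge r r' - wedge r1 r'"
  and wedge_diff_right: "wedge r (r' - r1) = wedge r r' - wedge r r1"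
  and wedge_minus_left: "wedge (- r) r' = - wedge r r'"
  and wedge_minus_right: "wedge r (- r') = - wedge r r'"
  and wedge_zero_left: "wedge 0 r' = 0"
  and wedge_zero_right: "wedge r 0 = 0"
  and wedge_scale_left: "wedge (fscale c r) r' = fscale c (wedge r r')"
  and wedge_scale_right: "wedge r (fscale c r') = fscale c (wedge r r')"
  by (simp_all add: fun_eq_iff wedge_def sum.distrib sum_subtractf sum_negf sum_distrib_left
      algebra_simps)

lemma wedge_sum_left: "wedge (\<Sum>i\<in>K. f i) r = (\<Sum>i\<in>K. wedge (f i) r)"
  by (rule ext, simp add: wedge_def sum_apply sum_distrib_left sum_distrib_right, rule sum.swap)

lemma wedge_sum_right: "wedge r (\<Sum>i\<in>K. f i) = (\<Sum>i\<in>K. wedge r (f i))"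
  by (rule ext, simp add: wedge_def sum_apply sum_distrib_left sum_distrib_right, rule sum.swap)

lemmas wedge_linear = wedge_add_left wedge_add_right wedge_diff_left wedge_diff_right
  wedge_minus_left wedge_minus_right wedge_zero_left wedge_zero_right wedge_scale_left
  wedge_scale_right wedge_sum_left wedge_sum_right

lemma contract_grade_inv: "contract x (grade_inv r) = - grade_inv (contract x r)"
  by (auto simp: contract_def grade_inv_def fun_eq_iff)

lemma grade_inv_wedge: "grade_inv (wedge r r') = wedge (grade_inv r) (grade_inv r')"
proof -
  have "grade_inv (wedge r r') xs = wedge (grade_inv r) (grade_inv r') xs" for xs
  proof (induction xs arbitrary: r r')
    case Nil then show ?case by (simp add: grade_inv_def)
  next
    case (Cons x xs)
    have "grade_inv (wedge r r') (x # xs) = - grade_inv (wedge (contract x r) r') xs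
       - grade_inv (wedge (grade_inv r) (contract x r')) xs"
      by (simp add: grade_inv_def wedge_Cons algebra_simps)
    then show ?case unfolding Cons.IH wedge_Cons contract_grade_inv by (simp add: wedge_linear)
  qed
  then show ?thesis by blast
qed

text \<open>Contraction acts on both sides by the same three terms, so induction on the argument list applies.\<close>

lemma wedge_assoc: "wedge (wedge r r') r'' = wedge r (wedge r' r'')"
proof -
  have "wedge (wedge r r') r'' xs = wedge r (wedge r' r'') xs" for xs
  proof (induction xs arbitrary: r r' r'')
    case Nil then show ?case by simp
  next
    case (Cons x xs)
    then show ?case by (simp add: wedge_Cons contract_wedge grade_inv_wedge wedge_linear)
  qed
  then show ?thesis by blast
qed

lemma wedge_one_left [simp]: "wedge ext_one r = r"
proof -
  have c: "contract x ext_one = 0" for x :: 'a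
    by (auto simp: contract_def ext_one_def fun_eq_iff)
  have g: "grade_inv ext_one = ext_one" by (auto simp: grade_inv_def ext_one_def fun_eq_iff)
  have "wedge ext_one r xs = r xs" for xs
    by (induction xs arbitrary: r) (simp_all add: wedge_Cons wedge_linear c g, simp_all add: ext_one_def contract_def)
  then show ?thesis by blast
qed

lemma wedge_one_right [simp]: "wedge r ext_one = r"
proof -
  have c: "contract x ext_one = 0" for x :: 'a
    by (auto simp: contract_def ext_one_def fun_eq_iff)
  have "wedge r ext_one xs = r xs" for xs
    by (induction xs arbitrary: r) (simp_all add: wedge_Cons wedge_linear c, simp_all add: ext_one_def contract_def)
  then show ?thesis by blast
qed

lemma ksign_eq: "ksign m n = (if odd m \<and> odd n then -1 else 1)"
  by (simp add: ksign_def power_int_minus_one_minus power_int_minus_left)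

definition homogeneous :: "int \<Rightarrow> ('g list \<Rightarrow> complex) \<Rightarrow> bool"
  where "homogeneous n r \<longleftrightarrow> (\<forall>xs. r xs \<noteq> 0 \<longrightarrow> int (length xs) = n)"

lemma homogeneous_contract: "homogeneous n r \<Longrightarrow> homogeneous (n - 1) (contract x r)"
  unfolding homogeneous_def contract_def by force

lemma grade_inv_homogeneous:
  assumes "homogeneous n r"
  shows "grade_inv r = fscale (ksign 1 n) r"
proof
  fix xs
  show "grade_inv r xs = fscale (ksign 1 n) r xs"
  proof (cases "r xs = 0")
    case False
    then have "n = int (length xs)" using assms by (simp add: homogeneous_def)
    then show ?thesis by (simp add: grade_inv_def ksign_eq)
  qed (simp add: grade_inv_def)
qed

text \<open>The product rule has one term for each factor, and exchanging the factors exchanges these two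
  terms; the sign of the parity involution makes up for the change of degree by one.\<close>

lemma wedge_supercomm:
  assumes "homogeneous m r" "homogeneous n r'"
  shows "wedge r r' = fscale (ksign m n) (wedge r' r)"
proof -
  have "wedge r r' xs = ksign m n * wedge r' r xs" for xs
    using assms
  proof (induction xs arbitrary: r r' m n)
    case Nil
    then show ?case by (auto simp: ksign_eq homogeneous_def)
  next
    case (Cons x xs)
    have 1: "wedge (contract x r) r' xs = ksign (m - 1) n * wedge r' (contract x r) xs"
      by (rule Cons.IH) (use Cons.prems homogeneous_contract in auto)
    have 2: "wedge r (contract x r') xs = ksign m (n - 1) * wedge (contract x r') r xs"
      by (rule Cons.IH) (use Cons.prems homogeneous_contract in auto)
    show ?case
      unfolding wedge_Cons grade_inv_homogeneous[OF Cons.prems(1)] grade_inv_homogeneous[OF Cons.prems(2)]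
      by (simp add: wedge_linear 1 2 ksign_eq)
  qed
  then show ?thesis by (auto simp: fun_eq_iff)
qed

section \<open>Alternating forms and their superderivations\<close>

lemma vector_space_fscale: "vector_space (fscale :: complex \<Rightarrow> ('x \<Rightarrow> complex) \<Rightarrow> _)"
  by unfold_locales (auto simp: fun_eq_iff algebra_simps)

interpretation form: vector_space "fscale :: complex \<Rightarrow> ('x \<Rightarrow> complex) \<Rightarrow> _"
  by (rule vector_space_fscale)

lemma linear_betwD:
  assumes "linear_betw sV S sW f"
  shows "x \<in> S \<Longrightarrow> y \<in> S \<Longrightarrow> f (x + y) = f x + f y" and "x \<in> S \<Longrightarrow> f (sV c x) = sW c (f x)"
  using assms by (auto simp: linear_betw_def)

lemma linear_betwI:
  assumes "\<And>x y. x \<in> S \<Longrightarrow> y \<in> S \<Longrightarrow> f (x + y) = f x + f y" "\<And>c x. x \<in> S \<Longrightarrow> f (sV c x) = sW c (f x)"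
  shows "linear_betw sV S sW f"
  using assms by (auto simp: linear_betw_def)

lemma linear_betw_sum:
  assumes "linear_betw sV S (*) f" "module sV" "module.subspace sV S" "\<And>i. i \<in> K \<Longrightarrow> v i \<in> S"
  shows "f (\<Sum>i\<in>K. sV (c i) (v i)) = (\<Sum>i\<in>K. c i * f (v i))"
  using assms(4)
proof (induction K rule: infinite_finite_induct)
  case (insert x F)
  have "(\<Sum>i\<in>F. sV (c i) (v i)) \<in> S"
    by (rule module.subspace_sum[OF assms(2,3)]) (use insert.prems assms(2,3) in \<open>auto intro: module.subspace_scale\<close>)
  moreover have "sV (c x) (v x) \<in> S" using insert.prems assms(2,3) by (auto intro: module.subspace_scale)
  ultimately show ?case using insert linear_betwD[OF assms(1)] by auto
next
  case empty
  have "f (sV 0 0) = 0 * f 0" using linear_betwD(2)[OF assms(1)] module.subspace_0[OF assms(2,3)] by blast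
  then show ?case using module.scale_zero_right[OF assms(2)] by simp
next
  case (infinite K)
  have "f (sV 0 0) = 0 * f 0" using linear_betwD(2)[OF assms(1)] module.subspace_0[OF assms(2,3)] by blast
  then show ?case using module.scale_zero_right[OF assms(2)] infinite by simp
qed

text \<open>Meant for families in which infinitely many functions may be nonzero, but only finitely many of them
  at any given argument.\<close>

definition local_sum :: "'i set \<Rightarrow> ('i \<Rightarrow> 'x \<Rightarrow> complex) \<Rightarrow> 'x \<Rightarrow> complex"
  where "local_sum J g x = (\<Sum>i\<in>{i\<in>J. g i x \<noteq> 0}. g i x)"

lemma local_sum_eq:
  assumes "finite K" "K \<subseteq> J" "\<And>i. i \<in> J \<Longrightarrow> i \<notin> K \<Longrightarrow> g i x = 0"
  shows "local_sum J g x = (\<Sum>i\<in>K. g i) x"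
  unfolding local_sum_def sum_apply by (rule sum.mono_neutral_left) (use assms in auto)

text \<open>Finiteness is asked for all lists over a finite set of vectors at once: evaluating a product with
  \<open>w i\<close> at a list involves the values of \<open>w i\<close> at all its sublists, and one finite set of indices has
  to serve for all of these.\<close>

definition locally_finite :: "'i set \<Rightarrow> ('i \<Rightarrow> 'g list \<Rightarrow> complex) \<Rightarrow> bool"
  where "locally_finite J w \<longleftrightarrow> (\<forall>X. finite X \<longrightarrow> finite {i\<in>J. \<exists>ys. set ys \<subseteq> X \<and> w i ys \<noteq> 0})"

lemma wedge_eq_0_left:
  assumes "\<And>ys. set ys \<subseteq> set xs \<Longrightarrow> r ys = 0"
  shows "wedge r r' xs = 0"
proof -
  have "wedge r r' xs = wedge 0 r' xs" by (rule wedge_cong) (use assms in auto)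
  then show ?thesis by (simp add: wedge_linear)
qed

lemma locally_finite_wedge:
  fixes w :: "'i \<Rightarrow> 'g list \<Rightarrow> complex"
  shows "locally_finite J w \<Longrightarrow> locally_finite J (\<lambda>i. wedge (w i) (u i))"
  unfolding locally_finite_def
proof (intro allI impI)
  fix X :: "'g set" assume lf: "\<forall>X. finite X \<longrightarrow> finite {i\<in>J. \<exists>ys. set ys \<subseteq> X \<and> w i ys \<noteq> 0}" and X: "finite X"
  have "{i\<in>J. \<exists>ys. set ys \<subseteq> X \<and> wedge (w i) (u i) ys \<noteq> 0} \<subseteq> {i\<in>J. \<exists>ys. set ys \<subseteq> X \<and> w i ys \<noteq> 0}"
  proof safe
    fix i ys assume *: "set ys \<subseteq> X" "wedge (w i) (u i) ys \<noteq> 0"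
    then obtain zs where "set zs \<subseteq> set ys" "w i zs \<noteq> 0" using wedge_eq_0_left[of ys "w i" "u i"] by blast
    then show "\<exists>ys. set ys \<subseteq> X \<and> w i ys \<noteq> 0" using * by blast
  qed
  then show "finite {i\<in>J. \<exists>ys. set ys \<subseteq> X \<and> wedge (w i) (u i) ys \<noteq> 0}"
    using lf X finite_subset by blast
qed

lemma local_sum_wedge_finite:
  assumes "locally_finite J w" "finite X"
  obtains K where "finite K" "K \<subseteq> J"
    "\<And>u ys. set ys \<subseteq> X \<Longrightarrow> local_sum J (\<lambda>i. wedge (w i) (u i)) ys = (\<Sum>i\<in>K. wedge (w i) (u i)) ys"
proof
  let ?K = "{i\<in>J. \<exists>ys. set ys \<subseteq> X \<and> w i ys \<noteq> 0}"
  show "finite ?K" using assms by (auto simp: locally_finite_def)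
  show "?K \<subseteq> J" by auto
  fix u ys assume ys: "set ys \<subseteq> X"
  show "local_sum J (\<lambda>i. wedge (w i) (u i)) ys = (\<Sum>i\<in>?K. wedge (w i) (u i)) ys"
  proof (rule local_sum_eq)
    fix i assume "i \<in> J" "i \<notin> ?K"
    then show "wedge (w i) (u i) ys = 0" using ys by (intro wedge_eq_0_left) auto
  qed (use \<open>finite ?K\<close> in auto)
qed

lemma local_sum_finite:
  assumes "locally_finite J w" "finite X"
  obtains K where "finite K" "K \<subseteq> J"
    "\<And>ys. set ys \<subseteq> X \<Longrightarrow> local_sum J w ys = (\<Sum>i\<in>K. w i) ys"
proof -
  from assms obtain K where "finite K" "K \<subseteq> J"
    "\<And>u ys. set ys \<subseteq> X \<Longrightarrow> local_sum J (\<lambda>i. wedge (w i) (u i)) ys = (\<Sum>i\<in>K. wedge (w i) (u i)) ys"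
    by (rule local_sum_wedge_finite) blast
  from that[OF this(1,2)] this(3)[of _ "\<lambda>_. ext_one"] show thesis by simp
qed

locale based_space = vector_space sc for sc :: "complex \<Rightarrow> 'g \<Rightarrow> 'g::ab_group_add" +
  fixes C E :: "'g set"
  assumes independent_E: "independent E" and span_E: "span E = C"
begin

abbreviation "R \<equiv> ext_dual sc C"
abbreviation "eps \<equiv> dual_basis_form sc E"
abbreviation "coord \<equiv> representation E"

lemma subspace_C: "subspace C" using span_E subspace_span by blast

lemma E_sub: "E \<subseteq> C" using span_E span_superset by blast

lemma eps_apply: "eps e [x] = coord x e" and eps_Nil: "eps e [] = 0"
  and eps_Cons2: "eps e (x # y # zs) = 0"
  by (auto simp: dual_basis_form_def)

lemma contract_eps: "contract x (eps e) = fscale (coord x e) ext_one"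
  by (auto simp: fun_eq_iff contract_def ext_one_def dual_basis_form_def split: list.splits)

definition supp :: "'g set \<Rightarrow> 'g set" where "supp X = {e. \<exists>x\<in>X. coord x e \<noteq> 0}"

lemma finite_supp: "finite X \<Longrightarrow> finite (supp X)"
proof -
  have "supp X = (\<Union>x\<in>X. {e. coord x e \<noteq> 0})" by (auto simp: supp_def)
  then show "finite X \<Longrightarrow> finite (supp X)" by (simp add: finite_representation)
qed

lemma supp_sub: "supp X \<subseteq> E" by (auto simp: supp_def intro: representation_ne_zero)

lemma coord_expand:
  assumes "x \<in> C" "finite T" "supp {x} \<subseteq> T"
  shows "(\<Sum>e\<in>T. sc (coord x e) e) = x"
proof -
  have "(\<Sum>e | coord x e \<noteq> 0. sc (coord x e) e) = x"
    using sum_nonzero_representation_eq[OF independent_E] assms(1) span_E by blast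
  moreover have "(\<Sum>e | coord x e \<noteq> 0. sc (coord x e) e) = (\<Sum>e\<in>T. sc (coord x e) e)"
    by (rule sum.mono_neutral_left) (use assms in \<open>auto simp: supp_def\<close>)
  ultimately show ?thesis by simp
qed

lemma linear_expand:
  assumes "linear_betw sc C (*) f" "x \<in> C" "finite T" "supp {x} \<subseteq> T" "T \<subseteq> E"
  shows "f x = (\<Sum>e\<in>T. coord x e * f e)"
proof -
  have "f x = f (\<Sum>e\<in>T. sc (coord x e) e)" using coord_expand assms by simp
  also have "\<dots> = (\<Sum>e\<in>T. coord x e * f e)"
    by (rule linear_betw_sum[OF assms(1) module_axioms subspace_C]) (use E_sub assms in auto)
  finally show ?thesis .
qed

lemma ext_support: "r \<in> R n \<Longrightarrow> r xs \<noteq> 0 \<Longrightarrow> int (length xs) = n \<and> set xs \<subseteq> C"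
  unfolding ext_dual_def by blast

lemma ext_eq_0: "r \<in> R n \<Longrightarrow> int (length xs) \<noteq> n \<or> \<not> set xs \<subseteq> C \<Longrightarrow> r xs = 0"
  using ext_support by blast

lemma ext_homogeneous: "r \<in> R n \<Longrightarrow> homogeneous n r"
  unfolding homogeneous_def using ext_support by blast

lemma ext_linear: "r \<in> R n \<Longrightarrow> set xs \<subseteq> C \<Longrightarrow> set ys \<subseteq> C \<Longrightarrow> linear_betw sc C (*) (\<lambda>x. r (xs @ x # ys))"
  unfolding ext_dual_def by blast

lemma ext_alternating: "r \<in> R n \<Longrightarrow> r (xs @ x # ys @ x # zs) = 0"
  unfolding ext_dual_def by blast

lemma ext_negative: "r \<in> R n \<Longrightarrow> n < 0 \<Longrightarrow> r = 0"
  by (rule ext, rule ccontr) (use ext_support[of r n] in fastforce)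

lemma ext_contract:
  assumes "r \<in> R n"
  shows "contract x r \<in> R (n - 1)"
proof (cases "x \<in> C")
  case True
  show ?thesis unfolding ext_dual_def
  proof (intro CollectI conjI allI impI)
    fix xs assume "contract x r xs \<noteq> 0"
    then show "int (length xs) = n - 1" "set xs \<subseteq> C"
      using ext_support[OF assms, of "x # xs"] by (auto simp: contract_def)
  next
    fix xs ys assume "set xs \<subseteq> C \<and> set ys \<subseteq> C"
    then show "linear_betw sc C (*) (\<lambda>y. contract x r (xs @ y # ys))"
      using ext_linear[OF assms, of "x # xs" ys] True by (simp add: contract_def)
  next
    fix xs ys zs y
    show "contract x r (xs @ y # ys @ y # zs) = 0"
      using ext_alternating[OF assms, of "x # xs" y ys zs] by (simp add: contract_def)
  qed
next
  case False
  then have "r (x # xs) = 0" for xs using ext_support[OF assms, of "x # xs"] by auto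
  then have "contract x r = 0" by (simp add: contract_def fun_eq_iff)
  then show ?thesis by (simp add: ext_dual_def linear_betw_def)
qed

lemma ext_zero: "0 \<in> R n" by (simp add: ext_dual_def linear_betw_def)

lemma ext_contract_add:
  assumes "r \<in> R n" "x \<in> C" "y \<in> C"
  shows "contract (x + y) r = contract x r + contract y r"
proof
  fix zs
  show "contract (x + y) r zs = (contract x r + contract y r) zs"
  proof (cases "set zs \<subseteq> C")
    case True
    then show ?thesis using linear_betwD(1)[OF ext_linear[OF assms(1), of "[]" zs]] assms
      by (simp add: contract_def)
  next
    case False
    then show ?thesis using ext_eq_0[OF assms(1)] by (simp add: contract_def)
  qed
qed

lemma ext_contract_scale:
  assumes "r \<in> R n" "x \<in> C"
  shows "contract (sc c x) r = fscale c (contract x r)"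
proof
  fix zs
  show "contract (sc c x) r zs = (fscale c (contract x r)) zs"
  proof (cases "set zs \<subseteq> C")
    case True
    then show ?thesis using linear_betwD(2)[OF ext_linear[OF assms(1), of "[]" zs]] assms
      by (simp add: contract_def)
  next
    case False
    then show ?thesis using ext_eq_0[OF assms(1)] by (simp add: contract_def)
  qed
qed

lemma ext_contract_twice: "r \<in> R n \<Longrightarrow> contract x (contract x r) = 0"
  using ext_alternating[of r n "[]" x "[]"] by (auto simp: contract_def fun_eq_iff)

lemma ext_contract_swap:
  assumes "r \<in> R n" "x \<in> C" "y \<in> C"
  shows "contract x (contract y r) = - contract y (contract x r)"
proof -
  have "0 = contract (x + y) (contract (x + y) r)" using ext_contract_twice assms by metis
  also have "\<dots> = contract x (contract x r) + contract x (contract y r)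
      + (contract y (contract x r) + contract y (contract y r))"
    using assms by (simp add: ext_contract_add ext_contract_add[OF ext_contract])
  also have "\<dots> = contract x (contract y r) + contract y (contract x r)"
    using assms by (simp add: ext_contract_twice)
  finally show ?thesis by (simp add: eq_neg_iff_add_eq_0)
qed

lemma ext_add:
  assumes "r \<in> R n" "r' \<in> R n"
  shows "r + r' \<in> R n"
  unfolding ext_dual_def
proof (intro CollectI conjI allI impI)
  fix xs assume "(r + r') xs \<noteq> 0"
  then have "r xs \<noteq> 0 \<or> r' xs \<noteq> 0" by auto
  then show "int (length xs) = n" "set xs \<subseteq> C"
    using ext_support[OF assms(1), of xs] ext_support[OF assms(2), of xs] by auto
next
  fix xs ys assume "set xs \<subseteq> C \<and> set ys \<subseteq> C"
  then have "linear_betw sc C (*) (\<lambda>x. r (xs @ x # ys))" "linear_betw sc C (*) (\<lambda>x. r' (xs @ x # ys))"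
    using ext_linear assms by simp_all
  then show "linear_betw sc C (*) (\<lambda>x. (r + r') (xs @ x # ys))"
    by (simp add: linear_betw_def algebra_simps)
next
  fix xs ys zs x
  show "(r + r') (xs @ x # ys @ x # zs) = 0"
    using ext_alternating[OF assms(1)] ext_alternating[OF assms(2)] by simp
qed

lemma ext_scale: "r \<in> R n \<Longrightarrow> fscale c r \<in> R n"
  unfolding ext_dual_def linear_betw_def by (auto simp: algebra_simps)

lemma subspace_ext: "form.subspace (R n)"
  by (auto simp: form.subspace_def ext_zero ext_add ext_scale)

lemma ext_minus: "r \<in> R n \<Longrightarrow> - r \<in> R n"
  by (rule form.subspace_neg[OF subspace_ext])

lemma ext_diff: "r \<in> R n \<Longrightarrow> r' \<in> R n \<Longrightarrow> r - r' \<in> R n"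
  by (rule form.subspace_diff[OF subspace_ext])

lemma ext_sum: "(\<And>i. i \<in> K \<Longrightarrow> f i \<in> R n) \<Longrightarrow> (\<Sum>i\<in>K. f i) \<in> R n"
  by (rule form.subspace_sum[OF subspace_ext])

text \<open>A form can be recognised at the head of its argument list. Multilinearity further down is that of
  the contractions. A vector repeated at the head and further down is moved to the second place, up
  to sign, since the first two arguments are antisymmetric by polarisation.\<close>

lemma ext_dualI:
  assumes supp: "\<And>xs. r xs \<noteq> 0 \<Longrightarrow> int (length xs) = n \<and> set xs \<subseteq> C"
    and contr: "\<And>x. x \<in> C \<Longrightarrow> contract x r \<in> R (n - 1)"
    and add: "\<And>x y. x \<in> C \<Longrightarrow> y \<in> C \<Longrightarrow> contract (x + y) r = contract x r + contract y r"
    and scale: "\<And>c x. x \<in> C \<Longrightarrow> contract (sc c x) r = fscale c (contract x r)"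
    and twice: "\<And>x. x \<in> C \<Longrightarrow> contract x (contract x r) = 0"
  shows "r \<in> R n"
  unfolding ext_dual_def
proof (intro CollectI conjI allI impI)
  fix xs assume "r xs \<noteq> 0"
  then show "int (length xs) = n" "set xs \<subseteq> C" using supp by blast+
next
  fix xs ys assume *: "set xs \<subseteq> C \<and> set ys \<subseteq> C"
  show "linear_betw sc C (*) (\<lambda>x. r (xs @ x # ys))"
  proof (cases xs)
    case Nil
    then show ?thesis using add scale by (auto simp: linear_betw_def contract_def fun_eq_iff)
  next
    case (Cons a as)
    then have "linear_betw sc C (*) (\<lambda>x. contract a r (as @ x # ys))"
      using * by (intro ext_linear[OF contr]) auto
    then show ?thesis using Cons by (simp add: contract_def)
  qed
next
  fix xs x ys zs
  have swap: "contract x (contract y r) = - contract y (contract x r)" if "x \<in> C" "y \<in> C" for x y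
  proof -
    have xy: "x + y \<in> C" using that subspace_C by (simp add: subspace_add)
    have "0 = contract (x + y) (contract (x + y) r)" using twice xy by simp
    also have "\<dots> = contract (x + y) (contract x r) + contract (x + y) (contract y r)"
      using that by (simp add: add)
    also have "\<dots> = contract x (contract x r) + contract x (contract y r)
        + (contract y (contract x r) + contract y (contract y r))"
      using that by (simp add: ext_contract_add[OF contr])
    also have "\<dots> = contract x (contract y r) + contract y (contract x r)"
      using that by (simp add: twice)
    finally show ?thesis by (simp add: eq_neg_iff_add_eq_0)
  qed
  show "r (xs @ x # ys @ x # zs) = 0"
  proof (rule ccontr)
    assume nz: "r (xs @ x # ys @ x # zs) \<noteq> 0"
    then have inC: "set (xs @ x # ys @ x # zs) \<subseteq> C" using supp by blast
    have "r (xs @ x # ys @ x # zs) = 0"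
    proof (cases xs)
      case (Cons a as)
      then have "contract a r (as @ x # ys @ x # zs) = 0"
        using inC by (intro ext_alternating[OF contr]) auto
      then show ?thesis using Cons by (simp add: contract_def)
    next
      case Nil
      show ?thesis
      proof (cases ys)
        case Nil
        then show ?thesis using \<open>xs = []\<close> inC twice[of x] by (simp add: contract_def fun_eq_iff)
      next
        case (Cons a as)
        have "r (x # a # as @ x # zs) = contract a (contract x r) (as @ x # zs)" by (simp add: contract_def)
        also have "\<dots> = - contract x (contract a r) (as @ x # zs)" using swap[of a x] inC Cons by simp
        also have "\<dots> = - contract a r ([] @ x # as @ x # zs)" by (simp add: contract_def)
        also have "\<dots> = 0" using inC Cons by (subst ext_alternating[OF contr]) auto
        finally show ?thesis using \<open>xs = []\<close> Cons by simp
      qed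
    qed
    then show False using nz by simp
  qed
qed

lemma ext_one_mem: "ext_one \<in> R 0"
  by (rule ext_dualI) (auto simp: ext_one_def contract_def ext_zero[unfolded zero_fun_def] fun_eq_iff split: if_splits)

lemma ext_degree_0: "r \<in> R 0 \<Longrightarrow> r = fscale (r []) ext_one"
  using ext_eq_0[of r 0] by (auto simp: fun_eq_iff ext_one_def)

lemma eps_mem: "eps e \<in> R 1"
proof (rule ext_dualI)
  fix xs assume "eps e xs \<noteq> 0"
  then show "int (length xs) = 1 \<and> set xs \<subseteq> C"
    using span_E by (auto simp: dual_basis_form_def representation_def split: list.splits if_splits)
next
  fix x y assume "x \<in> C" "y \<in> C"
  then show "contract (x + y) (eps e) = contract x (eps e) + contract y (eps e)"
    using representation_add[OF independent_E] span_E
    by (simp add: contract_eps fun_eq_iff algebra_simps)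
next
  fix c x assume "x \<in> C"
  then show "contract (sc c x) (eps e) = fscale c (contract x (eps e))"
    using representation_scale[OF independent_E] span_E
    by (simp add: contract_eps fun_eq_iff)
next
  fix x assume "x \<in> C"
  show "contract x (contract x (eps e)) = 0"
    by (auto simp: contract_def fun_eq_iff eps_Cons2)
qed (simp add: contract_eps ext_scale ext_one_mem)

lemma wedge_support:
  assumes "r \<in> R m" "r' \<in> R n" "wedge r r' xs \<noteq> 0"
  shows "int (length xs) = m + n \<and> set xs \<subseteq> C"
  using assms
proof (induction xs arbitrary: r r' m n)
  case Nil
  then have "r [] \<noteq> 0" "r' [] \<noteq> 0" by auto
  then show ?case using ext_support[OF Nil(1)] ext_support[OF Nil(2)] by fastforce
next
  case (Cons x xs)
  have g: "wedge (grade_inv r) (contract x r') xs = ksign 1 m * wedge r (contract x r') xs"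
    using grade_inv_homogeneous[OF ext_homogeneous[OF Cons.prems(1)]] by (simp add: wedge_linear)
  have "x \<in> C"
  proof (rule ccontr)
    assume "x \<notin> C"
    then have "r (x # ys) = 0" "r' (x # ys) = 0" for ys
      using ext_support[OF Cons.prems(1), of "x # ys"] ext_support[OF Cons.prems(2), of "x # ys"] by auto
    then have "contract x r = 0" "contract x r' = 0" by (simp_all add: contract_def fun_eq_iff)
    then show False using Cons.prems(3) by (simp add: wedge_Cons wedge_linear)
  qed
  moreover have "wedge (contract x r) r' xs \<noteq> 0 \<or> wedge r (contract x r') xs \<noteq> 0"
    using Cons.prems(3) g by (auto simp: wedge_Cons)
  then have "int (length xs) = m + n - 1 \<and> set xs \<subseteq> C"
    using Cons.IH[OF ext_contract[OF Cons.prems(1)] Cons.prems(2)]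
      Cons.IH[OF Cons.prems(1) ext_contract[OF Cons.prems(2)]] by fastforce
  ultimately show ?case by auto
qed

lemma contract_wedge_ext:
  "r \<in> R m \<Longrightarrow> contract x (wedge r r') = wedge (contract x r) r' + fscale (ksign 1 m) (wedge r (contract x r'))"
  by (simp add: contract_wedge grade_inv_homogeneous[OF ext_homogeneous] wedge_linear)

text \<open>Induction on the total degree through the criterion at the head of the list. The point is that
  contracting twice with the same vector gives zero: by the product rule the two mixed terms occur
  with opposite signs.\<close>

lemma wedge_mem:
  assumes "r \<in> R m" "r' \<in> R n"
  shows "wedge r r' \<in> R (m + n)"
proof (cases "m < 0 \<or> n < 0")
  case True
  then show ?thesis using ext_negative[OF assms(1)] ext_negative[OF assms(2)] by (auto simp: wedge_linear ext_zero)
next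
  case False
  then show ?thesis using assms
  proof (induction "nat (m + n)" arbitrary: m n r r' rule: less_induct)
    case less
    have IH: "wedge u v \<in> R (i + j)" if "u \<in> R i" "v \<in> R j" "i + j < m + n" for i j u v
    proof (cases "i < 0 \<or> j < 0")
      case True
      then show ?thesis using ext_negative[OF that(1)] ext_negative[OF that(2)] by (auto simp: wedge_linear ext_zero)
    next
      case False
      then show ?thesis using less(1)[of i j u v] that by linarith
    qed
    note m = less.prems(2) and n = less.prems(3)
    show ?case
    proof (rule ext_dualI)
      fix xs assume "wedge r r' xs \<noteq> 0"
      then show "int (length xs) = m + n \<and> set xs \<subseteq> C" by (rule wedge_support[OF m n])
    next
      fix x assume x: "x \<in> C"
      have "wedge (contract x r) r' \<in> R (m + n - 1)" "wedge r (contract x r') \<in> R (m + n - 1)"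
        using IH[OF ext_contract[OF m] n] IH[OF m ext_contract[OF n]] by (simp_all add: algebra_simps)
      then show "contract x (wedge r r') \<in> R (m + n - 1)"
        by (simp add: contract_wedge_ext[OF m] ext_add ext_scale)
      show "contract x (contract x (wedge r r')) = 0"
        by (simp add: contract_wedge_ext[OF m] contract_wedge_ext[OF ext_contract[OF m]]
            ext_contract_twice[OF m] ext_contract_twice[OF n] wedge_linear ksign_eq)
    qed (simp_all add: contract_wedge_ext[OF m] ext_contract_add[OF m] ext_contract_add[OF n]
           ext_contract_scale[OF m] ext_contract_scale[OF n] wedge_linear form.scale_right_distrib ksign_eq)
  qed
qed

text \<open>Each defining condition of a form involves finitely many vectors, so it may be tested on the lists
  over a finite set; this is how locally finite sums of forms are seen to be forms.\<close>

lemma ext_dual_local: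
  assumes "\<And>X. finite X \<Longrightarrow> \<exists>g\<in>R n. \<forall>ys. set ys \<subseteq> X \<longrightarrow> f ys = g ys"
  shows "f \<in> R n"
  unfolding ext_dual_def
proof (intro CollectI conjI allI impI)
  fix xs assume nz: "f xs \<noteq> 0"
  obtain g where "g \<in> R n" "\<forall>ys. set ys \<subseteq> set xs \<longrightarrow> f ys = g ys" using assms[of "set xs"] by blast
  then show "int (length xs) = n" "set xs \<subseteq> C" using nz ext_support[of g n xs] by auto
next
  fix xs ys assume *: "set xs \<subseteq> C \<and> set ys \<subseteq> C"
  show "linear_betw sc C (*) (\<lambda>x. f (xs @ x # ys))"
  proof (rule linear_betwI)
    fix x y assume xy: "x \<in> C" "y \<in> C"
    obtain g where g: "g \<in> R n" "\<forall>zs. set zs \<subseteq> set xs \<union> set ys \<union> {x, y, x + y} \<longrightarrow> f zs = g zs"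
      using assms[of "set xs \<union> set ys \<union> {x, y, x + y}"] by blast
    have "g (xs @ (x + y) # ys) = g (xs @ x # ys) + g (xs @ y # ys)"
      using linear_betwD(1)[OF ext_linear[OF g(1)]] * xy by blast
    then show "f (xs @ (x + y) # ys) = f (xs @ x # ys) + f (xs @ y # ys)"
      using g(2) by (simp add: subset_insertI2 le_supI1)
  next
    fix c x assume xy: "x \<in> C"
    obtain g where g: "g \<in> R n" "\<forall>zs. set zs \<subseteq> set xs \<union> set ys \<union> {x, sc c x} \<longrightarrow> f zs = g zs"
      using assms[of "set xs \<union> set ys \<union> {x, sc c x}"] by blast
    have "g (xs @ sc c x # ys) = c * g (xs @ x # ys)"
      using linear_betwD(2)[OF ext_linear[OF g(1)]] * xy by blast
    then show "f (xs @ sc c x # ys) = c * f (xs @ x # ys)"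
      using g(2) by (simp add: subset_insertI2 le_supI1)
  qed
next
  fix xs ys zs x
  obtain g where g: "g \<in> R n" "\<forall>us. set us \<subseteq> set (xs @ x # ys @ x # zs) \<longrightarrow> f us = g us"
    using assms[of "set (xs @ x # ys @ x # zs)"] by blast
  then have "f (xs @ x # ys @ x # zs) = g (xs @ x # ys @ x # zs)" by blast
  then show "f (xs @ x # ys @ x # zs) = 0" using ext_alternating[OF g(1)] by simp
qed

lemma local_sum_mem:
  assumes "locally_finite J w" "\<And>i. i \<in> J \<Longrightarrow> w i \<in> R n"
  shows "local_sum J w \<in> R n"
proof (rule ext_dual_local)
  fix X :: "'g set" assume "finite X"
  then obtain K where "finite K" "K \<subseteq> J" "\<And>ys. set ys \<subseteq> X \<Longrightarrow> local_sum J w ys = (\<Sum>i\<in>K. w i) ys"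
    using local_sum_finite[OF assms(1)] by blast
  moreover have "(\<Sum>i\<in>K. w i) \<in> R n" using assms(2) \<open>K \<subseteq> J\<close> by (intro ext_sum) auto
  ultimately show "\<exists>g\<in>R n. \<forall>ys. set ys \<subseteq> X \<longrightarrow> local_sum J w ys = g ys" by blast
qed

lemma locally_finite_eps: "locally_finite E eps"
  unfolding locally_finite_def
proof (intro allI impI)
  fix X :: "'g set" assume "finite X"
  have "{e\<in>E. \<exists>ys. set ys \<subseteq> X \<and> eps e ys \<noteq> 0} \<subseteq> supp X"
  proof safe
    fix e ys assume "set ys \<subseteq> X" "eps e ys \<noteq> 0"
    moreover then obtain x where "ys = [x]" "coord x e \<noteq> 0"
      by (auto simp: dual_basis_form_def split: list.splits)
    ultimately show "e \<in> supp X" by (auto simp: supp_def)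
  qed
  then show "finite {e\<in>E. \<exists>ys. set ys \<subseteq> X \<and> eps e ys \<noteq> 0}"
    using finite_supp[OF \<open>finite X\<close>] finite_subset by blast
qed

text \<open>Euler's identity: wedging with \<open>\<epsilon>\<^sup>e\<close> after contracting with \<open>e\<close> counts the degree. At a given
  list finitely many basis vectors suffice, so up to finitely many evaluations every form of nonzero
  degree is a sum of products with one-forms. This is the density of the algebraic exterior algebra
  in its completion.\<close>

lemma euler_identity:
  assumes "r \<in> R n" "set xs \<subseteq> C" "finite T" "supp (set xs) \<subseteq> T" "T \<subseteq> E"
  shows "(\<Sum>e\<in>T. wedge (eps e) (contract e r)) xs = of_int n * r xs"
  using assms
proof (induction xs arbitrary: r n)
  case Nil
  then show ?case using ext_support[of r n "[]"] by (cases "r [] = 0") (simp_all add: sum_apply eps_Nil)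
next
  case (Cons x xs)
  have x: "x \<in> C" and xs: "set xs \<subseteq> C" using Cons.prems by auto
  have sx: "supp {x} \<subseteq> T" "supp (set xs) \<subseteq> T" using Cons.prems(4) by (auto simp: supp_def)
  note r = Cons.prems(1)
  have 1: "(\<Sum>e\<in>T. coord x e * contract e r xs) = contract x r xs"
    unfolding contract_def
    by (rule linear_expand[symmetric, where f="\<lambda>y. r (y # xs)"])
       (use ext_linear[OF r, of "[]" xs] x xs sx Cons.prems in auto)
  have 2: "wedge (eps e) (contract x (contract e r)) xs = - wedge (eps e) (contract e (contract x r)) xs" if "e \<in> T" for e
    using ext_contract_swap[OF r, of x e] x that E_sub Cons.prems(5) by (simp add: wedge_linear subset_iff)
  have "(\<Sum>e\<in>T. wedge (eps e) (contract e r)) (x # xs)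
     = (\<Sum>e\<in>T. contract x (wedge (eps e) (contract e r)) xs)"
    by (simp add: sum_apply contract_def)
  also have "\<dots> = (\<Sum>e\<in>T. coord x e * contract e r xs + wedge (eps e) (contract e (contract x r)) xs)"
    by (rule sum.cong) (auto simp: contract_wedge_ext[OF eps_mem] contract_eps wedge_linear 2 ksign_eq)
  also have "\<dots> = contract x r xs + (\<Sum>e\<in>T. wedge (eps e) (contract e (contract x r))) xs"
    by (simp add: sum.distrib 1 sum_apply)
  also have "\<dots> = contract x r xs + of_int (n - 1) * contract x r xs"
    using Cons.IH[OF ext_contract[OF r] xs] Cons.prems sx by simp
  also have "\<dots> = of_int n * r (x # xs)" by (simp add: contract_def algebra_simps)
  finally show ?case .
qed

text \<open>The superderivation whose value on the one-form dual to \<open>e i\<close> is \<open>w i\<close>, when \<open>e\<close> enumerates a basis.\<close>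

definition derivation_sum :: "'i set \<Rightarrow> ('i \<Rightarrow> 'g list \<Rightarrow> complex) \<Rightarrow> ('i \<Rightarrow> 'g) \<Rightarrow> ('g list \<Rightarrow> complex) \<Rightarrow> 'g list \<Rightarrow> complex"
  where "derivation_sum J w e r = local_sum J (\<lambda>i. wedge (w i) (contract (e i) r))"

lemma derivation_sum_finite:
  assumes "locally_finite J w" "finite X"
  obtains K where "finite K" "K \<subseteq> J"
    "\<And>r ys. set ys \<subseteq> X \<Longrightarrow> derivation_sum J w e r ys = (\<Sum>i\<in>K. wedge (w i) (contract (e i) r)) ys"
proof -
  from assms obtain K where "finite K" "K \<subseteq> J"
    "\<And>u ys. set ys \<subseteq> X \<Longrightarrow> local_sum J (\<lambda>i. wedge (w i) (u i)) ys = (\<Sum>i\<in>K. wedge (w i) (u i)) ys"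
    by (rule local_sum_wedge_finite) blast
  from that[OF this(1,2)] this(3) show thesis by (simp add: derivation_sum_def)
qed

lemma derivation_sum_mem:
  assumes "locally_finite J w" "\<And>i. i \<in> J \<Longrightarrow> w i \<in> R (k + 1)" "r \<in> R n"
  shows "derivation_sum J w e r \<in> R (n + k)"
  unfolding derivation_sum_def
proof (rule local_sum_mem)
  show "locally_finite J (\<lambda>i. wedge (w i) (contract (e i) r))" by (rule locally_finite_wedge[OF assms(1)])
  fix i assume i: "i \<in> J"
  then show "wedge (w i) (contract (e i) r) \<in> R (n + k)"
    using wedge_mem[OF assms(2)[OF i] ext_contract[OF assms(3)]] by (simp add: algebra_simps)
qed

lemma derivation_sum_add: "locally_finite J w \<Longrightarrow> derivation_sum J w e (r + r') = derivation_sum J w e r + derivation_sum J w e r'"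
proof (rule ext)
  fix xs assume "locally_finite J w"
  then obtain K where K: "\<And>r. derivation_sum J w e r xs = (\<Sum>i\<in>K. wedge (w i) (contract (e i) r)) xs"
    using derivation_sum_finite[of J w "set xs" e] by (metis List.finite_set order_refl)
  show "derivation_sum J w e (r + r') xs = (derivation_sum J w e r + derivation_sum J w e r') xs"
    by (simp add: K wedge_linear sum_apply sum.distrib)
qed

lemma derivation_sum_scale: "locally_finite J w \<Longrightarrow> derivation_sum J w e (fscale c r) = fscale c (derivation_sum J w e r)"
proof (rule ext)
  fix xs assume "locally_finite J w"
  then obtain K where K: "\<And>r. derivation_sum J w e r xs = (\<Sum>i\<in>K. wedge (w i) (contract (e i) r)) xs"
    using derivation_sum_finite[of J w "set xs" e] by (metis List.finite_set order_refl)
  show "derivation_sum J w e (fscale c r) xs = (fscale c (derivation_sum J w e r)) xs"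
    by (simp add: K wedge_linear sum_apply sum_distrib_left)
qed

text \<open>Contraction is a superderivation of degree \<open>-1\<close>, and a left factor of degree \<open>k + 1\<close> commutes past
  the first argument with exactly the sign that turns this into degree \<open>k\<close>.\<close>

lemma derivation_sum_superderivation:
  assumes lf: "locally_finite J w" and w: "\<And>i. i \<in> J \<Longrightarrow> w i \<in> R (k + 1)"
  shows "superderivation fscale R wedge k (derivation_sum J w e)"
  unfolding superderivation_def graded_linear_def
proof (intro conjI allI ballI)
  show "linear_betw fscale (total fscale R) fscale (derivation_sum J w e)"
    by (simp add: linear_betw_def derivation_sum_add[OF lf] derivation_sum_scale[OF lf])
  show "derivation_sum J w e ` R n \<subseteq> R (n + k)" for n using derivation_sum_mem[OF lf w] by blast
  fix m n r r' assume r: "r \<in> R m" and r': "r' \<in> R n"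
  show "derivation_sum J w e (wedge r r') = wedge (derivation_sum J w e r) r' + fscale (ksign k m) (wedge r (derivation_sum J w e r'))"
  proof
    fix xs
    obtain K where K: "finite K" "K \<subseteq> J"
      "\<And>r ys. set ys \<subseteq> set xs \<Longrightarrow> derivation_sum J w e r ys = (\<Sum>i\<in>K. wedge (w i) (contract (e i) r)) ys"
      by (rule derivation_sum_finite[OF lf List.finite_set[of xs], where e=e]) (rule that, assumption+)
    have s: "fscale (ksign 1 m) (wedge (w i) (wedge r u)) = fscale (ksign k m) (wedge r (wedge (w i) u))" if "i \<in> K" for i u
    proof -
      have "w i \<in> R (k + 1)" using w K(2) that by auto
      then have "wedge (w i) r = fscale (ksign (k + 1) m) (wedge r (w i))"
        using wedge_supercomm ext_homogeneous r by blast
      then have "wedge (w i) (wedge r u) = fscale (ksign (k + 1) m) (wedge r (wedge (w i) u))"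
        by (simp add: wedge_assoc[symmetric] wedge_linear)
      then show ?thesis by (auto simp: ksign_eq)
    qed
    have t: "wedge (w i) (contract (e i) (wedge r r')) =
        wedge (wedge (w i) (contract (e i) r)) r' + fscale (ksign k m) (wedge r (wedge (w i) (contract (e i) r')))"
      if "i \<in> K" for i
      by (simp add: contract_wedge_ext[OF r] wedge_linear wedge_assoc s[OF that])
    have "derivation_sum J w e (wedge r r') xs = (\<Sum>i\<in>K. wedge (w i) (contract (e i) (wedge r r'))) xs"
      by (rule K(3)) simp
    also have "\<dots> = (\<Sum>i\<in>K. wedge (wedge (w i) (contract (e i) r)) r' + fscale (ksign k m) (wedge r (wedge (w i) (contract (e i) r')))) xs"
      unfolding sum_apply
      by (rule sum.cong) (simp_all only: t)
    also have "\<dots> = wedge (\<Sum>i\<in>K. wedge (w i) (contract (e i) r)) r' xs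
        + ksign k m * wedge r (\<Sum>i\<in>K. wedge (w i) (contract (e i) r')) xs"
      by (simp add: sum_apply wedge_linear sum.distrib sum_distrib_left)
    also have "wedge (\<Sum>i\<in>K. wedge (w i) (contract (e i) r)) r' xs = wedge (derivation_sum J w e r) r' xs"
      by (rule wedge_cong) (simp_all add: K(3))
    also have "wedge r (\<Sum>i\<in>K. wedge (w i) (contract (e i) r')) xs = wedge r (derivation_sum J w e r') xs"
      by (rule wedge_cong) (simp_all add: K(3))
    finally show "derivation_sum J w e (wedge r r') xs
      = (wedge (derivation_sum J w e r) r' + fscale (ksign k m) (wedge r (derivation_sum J w e r'))) xs" by simp
  qed
qed

lemma derivation_sum_degree_1:
  assumes "\<xi> \<in> R 1"
  shows "derivation_sum J w e \<xi> = local_sum J (\<lambda>i. fscale (\<xi> [e i]) (w i))"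
proof -
  have "contract x \<xi> = fscale (\<xi> [x]) ext_one" for x
    using ext_degree_0[of "contract x \<xi>"] ext_contract[OF assms, of x] by (simp add: contract_def)
  then show ?thesis unfolding derivation_sum_def by (simp add: wedge_linear)
qed

end

section \<open>The pointwise topology\<close>

lemma topspace_pointwise [simp]: "topspace (pointwise_topology S) = S"
  by (simp add: pointwise_topology_def)

lemma openin_pointwise:
  "openin (pointwise_topology S) V \<longleftrightarrow>
    V \<subseteq> S \<and> (\<forall>u\<in>V. \<exists>K. finite K \<and> (\<forall>v\<in>S. (\<forall>k\<in>K. v k = u k) \<longrightarrow> v \<in> V))"
    (is "?L \<longleftrightarrow> ?R")
proof
  assume ?L
  then obtain W where W: "openin (product_topology (\<lambda>_. discrete_topology UNIV) UNIV) W" "V = W \<inter> S"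
    by (auto simp: pointwise_topology_def openin_subtopology)
  show ?R
  proof (intro conjI ballI)
    show "V \<subseteq> S" using W by auto
    fix u assume "u \<in> V"
    then have "u \<in> W" using W by auto
    then obtain U where U: "finite {i. U i \<noteq> UNIV}" "u \<in> PiE UNIV U" "PiE UNIV U \<subseteq> W"
      using W(1) unfolding openin_product_topology_alt by (auto simp: )
    have "v \<in> V" if "v \<in> S" "\<forall>k\<in>{i. U i \<noteq> UNIV}. v k = u k" for v
    proof -
      have "v k \<in> U k" for k
        using that(2) U(2) by (cases "U k = UNIV") (auto simp: PiE_UNIV_domain Pi_iff)
      then show ?thesis using U(3) W(2) that(1) by (auto simp: PiE_UNIV_domain Pi_iff)
    qed
    then show "\<exists>K. finite K \<and> (\<forall>v\<in>S. (\<forall>k\<in>K. v k = u k) \<longrightarrow> v \<in> V)"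
      using U(1) by blast
  qed
next
  assume R: ?R
  have box: "openin (pointwise_topology S) {v\<in>S. \<forall>k\<in>K. v k = u k}" if "finite K" for u :: "'a \<Rightarrow> complex" and K
  proof -
    have "openin (product_topology (\<lambda>_. discrete_topology UNIV) UNIV) (PiE UNIV (\<lambda>k. if k \<in> K then {u k} else UNIV))"
      by (rule openin_PiE_gen[THEN iffD2]) (use that in \<open>auto elim: finite_subset[rotated]\<close>)
    moreover have "{v\<in>S. \<forall>k\<in>K. v k = u k} = PiE UNIV (\<lambda>k. if k \<in> K then {u k} else UNIV) \<inter> S"
      by (auto simp: PiE_UNIV_domain Pi_iff split: if_splits)
    ultimately show ?thesis unfolding pointwise_topology_def openin_subtopology by blast
  qed
  show ?L
  proof (subst openin_subopen, intro ballI)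
    fix u assume u: "u \<in> V"
    then obtain K where "finite K" "\<forall>v\<in>S. (\<forall>k\<in>K. v k = u k) \<longrightarrow> v \<in> V" using R by blast
    moreover have "u \<in> S" using R u by blast
    ultimately show "\<exists>T. openin (pointwise_topology S) T \<and> u \<in> T \<and> T \<subseteq> V"
      using box[of K u] by (intro exI[of _ "{v\<in>S. \<forall>k\<in>K. v k = u k}"]) auto
  qed
qed

lemma openin_pointwise_box:
  "finite K \<Longrightarrow> openin (pointwise_topology S) {v\<in>S. \<forall>k\<in>K. v k = u k}"
  unfolding openin_pointwise by auto

lemma continuous_map_pointwiseD:
  assumes "continuous_map (pointwise_topology S) (pointwise_topology T) f" "u \<in> S"
  shows "\<exists>K. finite K \<and> (\<forall>v\<in>S. (\<forall>k\<in>K. v k = u k) \<longrightarrow> f v x = f u x)"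
proof -
  have fT: "f v \<in> T" if "v \<in> S" for v
    using continuous_map_image_subset_topspace[OF assms(1)] that by auto
  have "openin (pointwise_topology T) {g\<in>T. \<forall>k\<in>{x}. g k = f u k}" by (rule openin_pointwise_box) simp
  then have "openin (pointwise_topology S) {v\<in>S. f v \<in> {g\<in>T. \<forall>k\<in>{x}. g k = f u k}}"
    using openin_continuous_map_preimage[OF assms(1)] by (metis (no_types) topspace_pointwise)
  moreover have "u \<in> {v\<in>S. f v \<in> {g\<in>T. \<forall>k\<in>{x}. g k = f u k}}" using assms(2) fT by simp
  ultimately obtain K where K: "finite K"
    "\<forall>v\<in>S. (\<forall>k\<in>K. v k = u k) \<longrightarrow> v \<in> {v\<in>S. f v \<in> {g\<in>T. \<forall>k\<in>{x}. g k = f u k}}"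
    unfolding openin_pointwise by meson
  then show ?thesis by (intro exI[of _ K]) simp
qed

text \<open>The finite sets of evaluation points are uniform in the arguments. This implies joint continuity for
  the pointwise topologies and is visibly preserved by finite sums and products, hence by the shuffle
  product.\<close>

definition finite_dependence :: "(('x \<Rightarrow> complex) \<Rightarrow> ('y \<Rightarrow> complex) \<Rightarrow> complex) \<Rightarrow> bool"
  where "finite_dependence h \<longleftrightarrow> (\<exists>K L. finite K \<and> finite L \<and>
    (\<forall>u u' v v'. (\<forall>k\<in>K. u k = u' k) \<longrightarrow> (\<forall>k\<in>L. v k = v' k) \<longrightarrow> h u v = h u' v'))"

lemma finite_dependence_left: "finite_dependence (\<lambda>u v. u k)"
  unfolding finite_dependence_def by (intro exI[of _ "{k}"] exI[of _ "{}"]) simp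

lemma finite_dependence_right: "finite_dependence (\<lambda>u v. v k)"
  unfolding finite_dependence_def by (intro exI[of _ "{}"] exI[of _ "{k}"]) simp

lemma finite_dependence_const: "finite_dependence (\<lambda>u v. c)"
  unfolding finite_dependence_def by (intro exI[of _ "{}"]) simp

lemma finite_dependence_comb:
  assumes "finite_dependence g" "finite_dependence h"
  shows "finite_dependence (\<lambda>u v. f (g u v) (h u v))"
proof -
  from assms(1) obtain K L where "finite K" "finite L"
    "\<forall>u u' v v'. (\<forall>k\<in>K. u k = u' k) \<longrightarrow> (\<forall>k\<in>L. v k = v' k) \<longrightarrow> g u v = g u' v'"
    unfolding finite_dependence_def by (elim exE conjE) (rule that, assumption+)
  moreover from assms(2) obtain K' L' where "finite K'" "finite L'"
    "\<forall>u u' v v'. (\<forall>k\<in>K'. u k = u' k) \<longrightarrow> (\<forall>k\<in>L'. v k = v' k) \<longrightarrow> h u v = h u' v'"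
    unfolding finite_dependence_def by (elim exE conjE) (rule that, assumption+)
  ultimately show ?thesis
    unfolding finite_dependence_def
    by (intro exI[of _ "K \<union> K'"] exI[of _ "L \<union> L'"]) (simp, metis (no_types, lifting) UnI1 UnI2)
qed

lemmas finite_dependence_add = finite_dependence_comb[where f="\<lambda>a b. a + b"]
  and finite_dependence_mult = finite_dependence_comb[where f="\<lambda>a b. a * b"]

lemma finite_dependence_minus: "finite_dependence h \<Longrightarrow> finite_dependence (\<lambda>u v. - h u v)"
  using finite_dependence_comb[where f="\<lambda>a b. - a"] by blast

lemma finite_dependence_sum:
  "(\<And>i. finite_dependence (h i)) \<Longrightarrow> finite_dependence (\<lambda>u v. \<Sum>i\<in>I. h i u v)"
  by (induction I rule: infinite_finite_induct) (auto intro: finite_dependence_const finite_dependence_add)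

lemma finite_dependence_wedge:
  assumes "\<And>ys. finite_dependence (\<lambda>u v. F u v ys)" "\<And>ys. finite_dependence (\<lambda>u v. G u v ys)"
  shows "finite_dependence (\<lambda>u v. wedge (F u v) (G u v) xs)"
  unfolding wedge_def
  by (intro finite_dependence_sum finite_dependence_mult finite_dependence_const assms)

lemmas finite_dependence_intros = finite_dependence_add finite_dependence_mult finite_dependence_minus
  finite_dependence_sum finite_dependence_wedge finite_dependence_const

lemma continuous_map_pointwise_joint:
  assumes "\<And>u v. u \<in> S \<Longrightarrow> v \<in> S' \<Longrightarrow> f u v \<in> T" "\<And>x. finite_dependence (\<lambda>u v. f u v x)"
  shows "continuous_map (prod_topology (pointwise_topology S) (pointwise_topology S'))
    (pointwise_topology T) (\<lambda>(u, v). f u v)"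
proof -
  obtain K L where KL: "\<And>x. finite (K x)" "\<And>x. finite (L x)"
    "\<And>x u u' v v'. \<lbrakk>\<forall>k\<in>K x. u k = u' k; \<forall>k\<in>L x. v k = v' k\<rbrakk> \<Longrightarrow> f u v x = f u' v' x"
    using assms(2) unfolding finite_dependence_def by metis
  show ?thesis
    unfolding continuous_map_def
  proof (intro conjI allI impI)
    show "(\<lambda>(u, v). f u v) \<in> topspace (prod_topology (pointwise_topology S) (pointwise_topology S')) \<rightarrow> topspace (pointwise_topology T)"
      using assms(1) by auto
    fix V assume V: "openin (pointwise_topology T) V"
    show "openin (prod_topology (pointwise_topology S) (pointwise_topology S'))
      {x \<in> topspace (prod_topology (pointwise_topology S) (pointwise_topology S')). (case x of (u, v) \<Rightarrow> f u v) \<in> V}"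
      (is "openin _ ?W")
      unfolding openin_prod_topology_alt
    proof (intro allI impI)
      fix u v assume uv: "(u, v) \<in> ?W"
      then have u: "u \<in> S" and v: "v \<in> S'" and fV: "f u v \<in> V" by auto
      then obtain M where M: "finite M" "\<forall>g\<in>T. (\<forall>k\<in>M. g k = f u v k) \<longrightarrow> g \<in> V"
        using V unfolding openin_pointwise by blast
      let ?U = "{w\<in>S. \<forall>k\<in>(\<Union>x\<in>M. K x). w k = u k}" and ?V = "{w\<in>S'. \<forall>k\<in>(\<Union>x\<in>M. L x). w k = v k}"
      have "f w w' \<in> V" if "w \<in> ?U" "w' \<in> ?V" for w w'
      proof -
        have "f w w' k = f u v k" if "k \<in> M" for k
          by (rule KL(3)) (use \<open>w \<in> ?U\<close> \<open>w' \<in> ?V\<close> u v that in auto)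
        moreover have "f w w' \<in> T" using assms(1) that by simp
        ultimately show ?thesis using M(2)[rule_format, of "f w w'"] by blast
      qed
      then have "?U \<times> ?V \<subseteq> ?W" by auto
      moreover have "openin (pointwise_topology S) ?U" "openin (pointwise_topology S') ?V"
        by (rule openin_pointwise_box, use M(1) KL(1,2) in blast)+
      ultimately show "\<exists>U V. openin (pointwise_topology S) U \<and> openin (pointwise_topology S') V \<and> u \<in> U \<and> v \<in> V \<and> U \<times> V \<subseteq> ?W"
        using u v by (intro exI[of _ ?U] exI[of _ ?V]) auto
    qed
  qed
qed

lemma continuous_map_pointwise:
  assumes "\<And>u. u \<in> S \<Longrightarrow> f u \<in> T" "\<And>x. finite_dependence (\<lambda>u (v :: unit \<Rightarrow> complex). f u x)"
  shows "continuous_map (pointwise_topology S) (pointwise_topology T) f"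
proof -
  have "continuous_map (prod_topology (pointwise_topology S) (pointwise_topology {\<lambda>_::unit. 0}))
    (pointwise_topology T) (\<lambda>(u, v). f u)"
    by (rule continuous_map_pointwise_joint[where f="\<lambda>u v. f u"]) (use assms in auto)
  moreover have "continuous_map (pointwise_topology S)
      (prod_topology (pointwise_topology S) (pointwise_topology {\<lambda>_::unit. 0::complex})) (\<lambda>u. (u, \<lambda>_. 0))"
    by (intro continuous_map_pairedI) auto
  ultimately have "continuous_map (pointwise_topology S) (pointwise_topology T)
      ((\<lambda>(u, v). f u) \<circ> (\<lambda>u. (u, \<lambda>_::unit. 0::complex)))"
    using continuous_map_compose by blast
  then show ?thesis by (simp add: o_def)
qed

lemma limitin_pointwiseD:
  assumes "limitin (pointwise_topology S) g l F"
  shows "l \<in> S" and "eventually (\<lambda>i. g i x = l x) F"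
proof -
  show l: "l \<in> S" using limitin_topspace[OF assms] by simp
  have "openin (pointwise_topology S) {v\<in>S. \<forall>k\<in>{x}. v k = l k}" by (rule openin_pointwise_box) simp
  then have "eventually (\<lambda>i. g i \<in> {v\<in>S. \<forall>k\<in>{x}. v k = l k}) F"
    using assms l unfolding limitin_def by auto
  then show "eventually (\<lambda>i. g i x = l x) F" by (rule eventually_mono) auto
qed

lemma limitin_pointwiseI:
  assumes "l \<in> S" "eventually (\<lambda>i. g i \<in> S) F" "\<And>x. eventually (\<lambda>i. g i x = l x) F"
  shows "limitin (pointwise_topology S) g l F"
  unfolding limitin_def
proof (intro conjI allI impI)
  show "l \<in> topspace (pointwise_topology S)" using assms(1) by simp
  fix U assume "openin (pointwise_topology S) U \<and> l \<in> U"
  then obtain K where K: "finite K" "\<forall>v\<in>S. (\<forall>k\<in>K. v k = l k) \<longrightarrow> v \<in> U"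
    unfolding openin_pointwise by blast
  have "eventually (\<lambda>i. \<forall>k\<in>K. g i k = l k) F"
    using K(1) assms(3) by (intro eventually_ball_finite) auto
  with assms(2) show "eventually (\<lambda>i. g i \<in> U) F" by eventually_elim (use K(2) in blast)
qed

section \<open>Continuous linear functionals on spaces of functions\<close>

text \<open>Continuity from the pointwise topology on \<open>S\<close> to the discrete field is written out in terms of
  finitely many evaluations, because these are what the density arguments approximate.\<close>

definition cont_functional :: "('x \<Rightarrow> complex) set \<Rightarrow> (('x \<Rightarrow> complex) \<Rightarrow> complex) \<Rightarrow> bool"
  where "cont_functional S g \<longleftrightarrow> linear_betw fscale S (*) g \<and>
    (\<forall>u\<in>S. \<exists>K. finite K \<and> (\<forall>v\<in>S. (\<forall>k\<in>K. v k = u k) \<longrightarrow> g v = g u))"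

definition cont_linear :: "('x \<Rightarrow> complex) set \<Rightarrow> ('y \<Rightarrow> complex) set \<Rightarrow> (('x \<Rightarrow> complex) \<Rightarrow> 'y \<Rightarrow> complex) \<Rightarrow> bool"
  where "cont_linear S T f \<longleftrightarrow> (\<forall>u\<in>S. f u \<in> T) \<and> (\<forall>y. cont_functional S (\<lambda>u. f u y))"

lemma cont_functionalI:
  assumes "linear_betw fscale S (*) g"
    "\<And>u. u \<in> S \<Longrightarrow> \<exists>K. finite K \<and> (\<forall>v\<in>S. (\<forall>k\<in>K. v k = u k) \<longrightarrow> g v = g u)"
  shows "cont_functional S g"
  using assms by (simp add: cont_functional_def)

lemma cont_functional_linear: "cont_functional S g \<Longrightarrow> linear_betw fscale S (*) g"
  by (simp add: cont_functional_def)

lemma cont_functional_finite: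
  assumes "cont_functional S g" "u \<in> S"
  obtains K where "finite K" "\<forall>v\<in>S. (\<forall>k\<in>K. v k = u k) \<longrightarrow> g v = g u"
  using assms unfolding cont_functional_def by metis

lemma cont_linear_mem: "cont_linear S T f \<Longrightarrow> u \<in> S \<Longrightarrow> f u \<in> T"
  by (simp add: cont_linear_def)

lemma cont_functional_apply: "cont_linear S T f \<Longrightarrow> cont_functional S (\<lambda>u. f u y)"
  by (simp add: cont_linear_def)

lemma cont_linear_id: "cont_linear S S (\<lambda>u. u)"
  unfolding cont_linear_def cont_functional_def by (auto simp: linear_betw_def intro: exI[of _ "{_}"])

lemma cont_functional_add: "cont_functional S f \<Longrightarrow> cont_functional S g \<Longrightarrow> cont_functional S (\<lambda>u. f u + g u)"
proof (rule cont_functionalI)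
  assume f: "cont_functional S f" and g: "cont_functional S g"
  then show "linear_betw fscale S (*) (\<lambda>u. f u + g u)" by (auto simp: cont_functional_def linear_betw_def algebra_simps)
  fix u assume u: "u \<in> S"
  from f u obtain K where K: "finite K" "\<forall>v\<in>S. (\<forall>k\<in>K. v k = u k) \<longrightarrow> f v = f u"
    by (rule cont_functional_finite) (rule that, assumption+)
  from g u obtain L where L: "finite L" "\<forall>v\<in>S. (\<forall>k\<in>L. v k = u k) \<longrightarrow> g v = g u"
    by (rule cont_functional_finite) (rule that, assumption+)
  show "\<exists>K. finite K \<and> (\<forall>v\<in>S. (\<forall>k\<in>K. v k = u k) \<longrightarrow> f v + g v = f u + g u)"
    using K L by (intro exI[of _ "K \<union> L"]) simp
qed

lemma cont_functional_scale: "cont_functional S f \<Longrightarrow> cont_functional S (\<lambda>u. c * f u)"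
proof (rule cont_functionalI)
  assume f: "cont_functional S f"
  then show "linear_betw fscale S (*) (\<lambda>u. c * f u)" by (auto simp: cont_functional_def linear_betw_def algebra_simps)
  fix u assume u: "u \<in> S"
  from f u obtain K where K: "finite K" "\<forall>v\<in>S. (\<forall>k\<in>K. v k = u k) \<longrightarrow> f v = f u"
    by (rule cont_functional_finite) (rule that, assumption+)
  show "\<exists>K. finite K \<and> (\<forall>v\<in>S. (\<forall>k\<in>K. v k = u k) \<longrightarrow> c * f v = c * f u)"
    using K by (intro exI[of _ K]) simp
qed

lemma cont_functional_minus: "cont_functional S f \<Longrightarrow> cont_functional S (\<lambda>u. - f u)"
  using cont_functional_scale[of S f "-1"] by simp

lemma cont_functional_diff: "cont_functional S f \<Longrightarrow> cont_functional S g \<Longrightarrow> cont_functional S (\<lambda>u. f u - g u)"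
  using cont_functional_add[OF _ cont_functional_minus, of S f g] by simp

lemma cont_functional_comp:
  assumes "cont_functional T g" "cont_linear S T f"
  shows "cont_functional S (\<lambda>u. g (f u))"
proof (rule cont_functionalI)
  have lf: "f (u + v) = f u + f v" "f (fscale c u) = fscale c (f u)" if "u \<in> S" "v \<in> S" for u v c
    using assms(2) that unfolding cont_linear_def cont_functional_def linear_betw_def by (auto simp: fun_eq_iff)
  show "linear_betw fscale S (*) (\<lambda>u. g (f u))"
    using assms lf unfolding cont_functional_def cont_linear_def linear_betw_def by simp
  fix u assume u: "u \<in> S"
  from assms(1) cont_linear_mem[OF assms(2) u]
  obtain L where L: "finite L" "\<forall>v\<in>T. (\<forall>k\<in>L. v k = f u k) \<longrightarrow> g v = g (f u)"
    by (rule cont_functional_finite) (rule that, assumption+)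
  have "\<exists>K. finite K \<and> (\<forall>v\<in>S. (\<forall>k\<in>K. v k = u k) \<longrightarrow> f v y = f u y)" for y
    using cont_functional_apply[OF assms(2), of y] u unfolding cont_functional_def by simp
  then obtain K where K: "\<And>y. finite (K y)" "\<And>y v. v \<in> S \<Longrightarrow> \<forall>k\<in>K y. v k = u k \<Longrightarrow> f v y = f u y"
    by metis
  show "\<exists>K. finite K \<and> (\<forall>v\<in>S. (\<forall>k\<in>K. v k = u k) \<longrightarrow> g (f v) = g (f u))"
  proof (intro exI[of _ "\<Union>y\<in>L. K y"] conjI ballI impI)
    show "finite (\<Union>y\<in>L. K y)" using L(1) K(1) by blast
    fix v assume v: "v \<in> S" "\<forall>k\<in>(\<Union>y\<in>L. K y). v k = u k"
    then have "f v k = f u k" if "k \<in> L" for k using K(2)[OF v(1), of k] that by simp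
    then show "g (f v) = g (f u)" using L(2) cont_linear_mem[OF assms(2) v(1)] by simp
  qed
qed

lemma cont_linear_comp:
  assumes "cont_linear T T' g" "cont_linear S T f"
  shows "cont_linear S T' (\<lambda>u. g (f u))"
  using assms cont_functional_comp[OF cont_functional_apply[OF assms(1)] assms(2)] by (simp add: cont_linear_def)

lemma cont_linearI_continuous:
  assumes "continuous_map (pointwise_topology S) (pointwise_topology T) f"
    and "linear_betw fscale S fscale f"
  shows "cont_linear S T f"
  unfolding cont_linear_def
proof (intro conjI ballI allI)
  show "f u \<in> T" if "u \<in> S" for u
    using continuous_map_image_subset_topspace[OF assms(1)] that by auto
  show "cont_functional S (\<lambda>u. f u y)" for y
    by (rule cont_functionalI) (use assms(2) continuous_map_pointwiseD[OF assms(1)] in \<open>auto simp: linear_betw_def\<close>)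
qed

lemma cont_linearI_finite_dependence:
  assumes "\<And>u. u \<in> S \<Longrightarrow> f u \<in> T" "linear_betw fscale S fscale f"
    "\<And>y. finite_dependence (\<lambda>u (v :: unit \<Rightarrow> complex). f u y)"
  shows "cont_linear S T f"
  by (rule cont_linearI_continuous[OF continuous_map_pointwise]) (use assms in auto)

context based_space begin

lemma cont_linear_wedge_right: "r \<in> R m \<Longrightarrow> cont_linear (R n) (R (m + n)) (\<lambda>r'. wedge r r')"
  by (rule cont_linearI_finite_dependence)
    (auto simp: wedge_mem linear_betw_def wedge_linear
      intro!: finite_dependence_wedge finite_dependence_left finite_dependence_const)

lemma cont_linear_wedge_left: "r \<in> R n \<Longrightarrow> cont_linear (R m) (R (m + n)) (\<lambda>r'. wedge r' r)"
  by (rule cont_linearI_finite_dependence)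
    (auto simp: wedge_mem linear_betw_def wedge_linear
      intro!: finite_dependence_wedge finite_dependence_left finite_dependence_const)

lemma R_eq_on_products:
  assumes g: "cont_functional (R n) g" and h: "cont_functional (R n) h" and n: "n \<noteq> 0" and r: "r \<in> R n"
    and eq: "\<And>\<xi> r'. \<xi> \<in> R 1 \<Longrightarrow> r' \<in> R (n - 1) \<Longrightarrow> g (wedge \<xi> r') = h (wedge \<xi> r')"
  shows "g r = h r"
proof -
  from g r obtain K where K: "finite K" "\<forall>v\<in>R n. (\<forall>k\<in>K. v k = r k) \<longrightarrow> g v = g r"
    by (rule cont_functional_finite) (rule that, assumption+)
  from h r obtain L where L: "finite L" "\<forall>v\<in>R n. (\<forall>k\<in>L. v k = r k) \<longrightarrow> h v = h r"
    by (rule cont_functional_finite) (rule that, assumption+)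
  define X where "X = (\<Union>xs\<in>K\<union>L. set xs)"
  have fX: "finite X" using K L by (simp add: X_def)
  define T where "T = supp X"
  have T: "finite T" "T \<subseteq> E" using finite_supp[OF fX] supp_sub by (auto simp: T_def)
  \<comment> \<open>The approximation of \<open>r\<close> supplied by Euler's identity, exact on all lists over \<open>X\<close>.\<close>
  define v where "v = (\<Sum>e\<in>T. fscale (1 / of_int n) (wedge (eps e) (contract e r)))"
  have summand: "wedge (eps e) (contract e r) \<in> R n" for e
    using wedge_mem[OF eps_mem ext_contract[OF r]] by simp
  have v: "v \<in> R n" unfolding v_def by (intro ext_sum ext_scale summand)
  have agree: "v xs = r xs" if "xs \<in> K \<union> L" for xs
  proof (cases "set xs \<subseteq> C")
    case True
    have "v xs = (1 / of_int n) * (\<Sum>e\<in>T. wedge (eps e) (contract e r)) xs"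
      by (simp add: v_def sum_apply sum_distrib_left)
    also have "(\<Sum>e\<in>T. wedge (eps e) (contract e r)) xs = of_int n * r xs"
      by (rule euler_identity[OF r True T(1) _ T(2)]) (use that in \<open>auto simp: T_def X_def supp_def\<close>)
    finally show ?thesis using n by simp
  next
    case False
    then show ?thesis using ext_eq_0[OF v] ext_eq_0[OF r] by simp
  qed
  have lin: "f v = (\<Sum>e\<in>T. 1 / of_int n * f (wedge (eps e) (contract e r)))" if "cont_functional (R n) f" for f
    unfolding v_def using that
    by (intro linear_betw_sum[OF _ form.module_axioms subspace_ext[of n]] summand) (simp add: cont_functional_def)
  have "g r = g v" using K(2) v agree by simp
  also have "g v = h v"
    unfolding lin[OF g] lin[OF h] using eq[OF eps_mem ext_contract[OF r]] by simp
  also have "h v = h r" using L(2) v agree by simp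
  finally show ?thesis .
qed

text \<open>The product rule of a superderivation by itself; linearity and degree are recorded degreewise by
  \<open>cont_linear\<close>, which is the form in which they survive composition.\<close>

definition leibniz :: "int \<Rightarrow> (('g list \<Rightarrow> complex) \<Rightarrow> 'g list \<Rightarrow> complex) \<Rightarrow> bool"
  where "leibniz k D \<longleftrightarrow> (\<forall>m n. \<forall>x\<in>R m. \<forall>y\<in>R n.
    D (wedge x y) = wedge (D x) y + fscale (ksign k m) (wedge x (D y)))"

lemma leibnizD:
  "leibniz k D \<Longrightarrow> x \<in> R m \<Longrightarrow> y \<in> R n \<Longrightarrow>
    D (wedge x y) = wedge (D x) y + fscale (ksign k m) (wedge x (D y))"
  by (simp add: leibniz_def)

lemma superderivation_leibniz: "superderivation fscale R wedge k D \<Longrightarrow> leibniz k D"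
  by (simp add: superderivation_def leibniz_def)

lemma leibniz_ext_one: "leibniz k D \<Longrightarrow> D ext_one = 0"
  using leibnizD[of k D ext_one 0 ext_one 0] ext_one_mem by (simp add: ksign_eq)

text \<open>One-forms generate the completed exterior algebra topologically, by Euler's identity.\<close>

lemma leibniz_eqI:
  assumes D: "leibniz k D" and D': "leibniz k D'"
    and cD: "\<And>n. cont_linear (R n) (R (n + k)) D" and cD': "\<And>n. cont_linear (R n) (R (n + k)) D'"
    and eq: "\<And>\<xi>. \<xi> \<in> R 1 \<Longrightarrow> D \<xi> = D' \<xi>"
    and r: "r \<in> R n"
  shows "D r = D' r"
proof (cases "n < 0")
  case True
  then have "r = 0" using ext_negative[OF r] by simp
  moreover have "F 0 = 0" if F: "cont_linear (R n) (R (n + k)) F" for F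
  proof
    fix x
    have "F (fscale 0 0) x = 0 * F 0 x"
      using linear_betwD(2)[OF cont_functional_linear[OF cont_functional_apply[OF F]] ext_zero] .
    then show "F 0 x = 0 x" by simp
  qed
  ultimately show ?thesis using cD[of n] cD'[of n] by metis
next
  case False
  then show ?thesis using r
  proof (induction "nat n" arbitrary: n r)
    case 0
    then have n: "n = 0" by simp
    have "F r = fscale (r []) (F ext_one)" if "cont_linear (R 0) (R (0 + k)) F" for F
    proof -
      have "F (fscale (r []) ext_one) = fscale (r []) (F ext_one)"
        using linear_betwD(2)[OF cont_functional_linear[OF cont_functional_apply[OF that]] ext_one_mem] by (auto simp: fun_eq_iff)
      then show ?thesis using ext_degree_0 0 n by metis
    qed
    then show ?case using cD[of 0] cD'[of 0] leibniz_ext_one[OF D] leibniz_ext_one[OF D'] by simp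
  next
    case (Suc m)
    show ?case
    proof
      fix xs
      show "D r xs = D' r xs"
      proof (rule R_eq_on_products[OF cont_functional_apply[OF cD] cont_functional_apply[OF cD']])
        show "n \<noteq> 0" using Suc by auto
        show "r \<in> R n" by (rule Suc.prems)
        fix \<xi> r' assume \<xi>: "\<xi> \<in> R 1" and r': "r' \<in> R (n - 1)"
        have "D r' = D' r'" by (rule Suc.hyps(1)[of "n - 1"]) (use Suc.hyps(2) r' in auto)
        moreover have "D (wedge \<xi> r') = wedge (D \<xi>) r' + fscale (ksign k 1) (wedge \<xi> (D r'))"
          "D' (wedge \<xi> r') = wedge (D' \<xi>) r' + fscale (ksign k 1) (wedge \<xi> (D' r'))"
          by (rule leibnizD[OF D \<xi> r'], rule leibnizD[OF D' \<xi> r'])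
        ultimately show "D (wedge \<xi> r') xs = D' (wedge \<xi> r') xs" using eq[OF \<xi>] by simp
      qed
    qed
  qed
qed

end

section \<open>The dual of the c-lattice\<close>

locale split_tate_lie_algebra =
  fixes sc :: "complex \<Rightarrow> 'g \<Rightarrow> 'g::{ab_group_add,uniform_topological_group_add,t2_space}"
    and lie :: "'g \<Rightarrow> 'g \<Rightarrow> 'g" and B :: "'g set" and s :: "'g \<Rightarrow> 'g" and E :: "'g set"
  assumes tate: "tate_lie_algebra sc lie"
    and subalgebra: "lie_subalgebra sc lie B"
    and lattice: "c_lattice sc B"
    and splitting: "linear_section sc B s"
    and basis: "basis_of sc (range s) E"

sublocale split_tate_lie_algebra \<subseteq> based_space sc "range s" E
  using tate basis
  by (simp add: based_space_def based_space_axioms_def tate_lie_algebra_def tate_space_def basis_of_def)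

context split_tate_lie_algebra begin

abbreviation "C \<equiv> range s"
abbreviation "Bdual \<equiv> tate_dual sc B"
abbreviation "A \<equiv> compl_tensor sc B C"
abbreviation "bpart z \<equiv> z - s z"

lemma linear_s: "Vector_Spaces.linear sc sc s"
  and s_B: "x \<in> B \<Longrightarrow> s x = 0" and bpart_B: "bpart x \<in> B"
  using splitting by (auto simp: linear_section_def)

lemma s_add: "s (x + y) = s x + s y" and s_scale: "s (sc c x) = sc c (s x)"
  and s_diff: "s (x - y) = s x - s y" and s_zero: "s 0 = 0" and s_minus: "s (- x) = - s x"
  using linear_s
  by (simp_all add: Vector_Spaces.linear_iff_module_hom module_hom.add module_hom.scale
      module_hom.diff module_hom.zero module_hom.neg)

lemma lie_linear: "Vector_Spaces.linear sc sc (lie x)" "Vector_Spaces.linear sc sc (\<lambda>x. lie x y)"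
  and lie_self: "lie x x = 0"
  and lie_cyclic: "lie x (lie y z) + lie y (lie z x) + lie z (lie x y) = 0"
  using tate by (auto simp: tate_lie_algebra_def lie_bracket_def)

lemma lie_add_right: "lie x (y + z) = lie x y + lie x z" and lie_scale_right: "lie x (sc c y) = sc c (lie x y)"
  and lie_diff_right: "lie x (y - z) = lie x y - lie x z" and lie_zero_right: "lie x 0 = 0"
  and lie_minus_right: "lie x (- y) = - lie x y"
  using lie_linear(1)[of x]
  by (simp_all add: Vector_Spaces.linear_iff_module_hom module_hom.add module_hom.scale
      module_hom.diff module_hom.zero module_hom.neg)

lemma lie_add_left: "lie (x + y) z = lie x z + lie y z" and lie_scale_left: "lie (sc c x) y = sc c (lie x y)"
  and lie_diff_left: "lie (x - y) z = lie x z - lie y z" and lie_zero_left: "lie 0 x = 0"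
  and lie_minus_left: "lie (- x) y = - lie x y"
proof -
  have h: "module_hom sc sc (\<lambda>x. lie x y)" for y
    using lie_linear(2) by (simp add: Vector_Spaces.linear_iff_module_hom)
  show "lie (x + y) z = lie x z + lie y z" by (rule module_hom.add[OF h])
  show "lie (sc c x) y = sc c (lie x y)" by (rule module_hom.scale[OF h])
  show "lie (x - y) z = lie x z - lie y z" by (rule module_hom.diff[OF h])
  show "lie 0 x = 0" by (rule module_hom.zero[OF h])
  show "lie (- x) y = - lie x y" by (rule module_hom.neg[OF h])
qed

lemmas lie_simps = lie_add_right lie_scale_right lie_diff_right lie_zero_right lie_minus_right
  lie_add_left lie_scale_left lie_diff_left lie_zero_left lie_minus_left

lemma lie_antisym: "lie x y = - lie y x"
proof -
  have "lie (x + y) (x + y) = lie x x + lie y x + (lie x y + lie y y)"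
    by (simp only: lie_add_left lie_add_right)
  then have "lie x y + lie y x = 0" by (simp only: lie_self add_0 add_0_right add.commute)
  then show ?thesis by (rule eq_neg_iff_add_eq_0[THEN iffD2])
qed

lemma lie_jacobi: "lie x (lie y z) = lie (lie x y) z + lie y (lie x z)"
  using lie_cyclic[of x y z] lie_antisym[of z x] lie_antisym[of z "lie x y"]
  by (simp add: lie_simps algebra_simps)

lemma lie_cyclic_left: "lie (lie x y) z - lie (lie x z) y + lie (lie y z) x = 0"
  unfolding lie_antisym[of "lie x z" y] lie_antisym[of "lie y z" x]
  by (simp add: lie_jacobi[of x y z])

lemma subspace_B: "subspace B" and lie_B: "x \<in> B \<Longrightarrow> y \<in> B \<Longrightarrow> lie x y \<in> B"
  using subalgebra by (auto simp: lie_subalgebra_def)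

lemmas B_closed = subspace_0[OF subspace_B] subspace_add[OF subspace_B] subspace_diff[OF subspace_B]
  subspace_scale[OF subspace_B] subspace_neg[OF subspace_B]

lemma open_B: "open B" using lattice by (simp add: c_lattice_def)

lemma B_finite_quotient:
  assumes "subspace U" "open U"
  obtains F where "finite F" "F \<subseteq> B" "B \<subseteq> span (F \<union> (B \<inter> U))"
  using lattice assms by (auto simp: c_lattice_def finite_quotient_def)

lemma open_subspace_nbhd:
  assumes "open N" "0 \<in> N"
  obtains U where "subspace U" "open U" "U \<subseteq> N"
  using tate assms unfolding tate_lie_algebra_def tate_space_def by metis

lemma continuous_lie_right: "continuous_on UNIV (lie x)"
proof -
  have "continuous_on UNIV (\<lambda>(x, y). lie x y)" using tate by (simp add: tate_lie_algebra_def)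
  then have "continuous_on UNIV (\<lambda>y. (\<lambda>(x, y). lie x y) (x, y))"
    by (rule continuous_on_compose2) (auto intro: continuous_intros)
  then show ?thesis by simp
qed

lemma open_lie_preimage:
  assumes "subspace U" "open U"
  shows "subspace {b. lie x b \<in> U}" "open {b. lie x b \<in> U}"
proof -
  show "subspace {b. lie x b \<in> U}"
    using assms(1) by (auto simp: subspace_def lie_simps)
  have "{b. lie x b \<in> U} = lie x -` U" by auto
  then show "open {b. lie x b \<in> U}" using open_vimage[OF assms(2) continuous_lie_right] by simp
qed

lemma dual_linear: "\<phi> \<in> Bdual \<Longrightarrow> linear_betw sc B (*) \<phi>"
  and dual_outside: "\<phi> \<in> Bdual \<Longrightarrow> x \<notin> B \<Longrightarrow> \<phi> x = 0"
  by (auto simp: tate_dual_def)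

text \<open>A linear form vanishing on an open subspace is locally constant.\<close>

lemma dualI:
  assumes lin: "linear_betw sc B (*) \<phi>" and out: "\<And>x. x \<notin> B \<Longrightarrow> \<phi> x = 0"
    and U: "subspace U" "open U" "\<And>x. x \<in> U \<Longrightarrow> x \<in> B \<Longrightarrow> \<phi> x = 0"
  shows "\<phi> \<in> Bdual"
proof -
  have "openin (top_of_set B) {x \<in> B. \<phi> x \<in> V}" for V
  proof (subst openin_subopen, intro ballI)
    fix x assume x: "x \<in> {x \<in> B. \<phi> x \<in> V}"
    let ?N = "(\<lambda>y. y - x) -` (U \<inter> B)"
    have "open ?N" using U(2) open_B by (intro open_vimage) (auto intro!: continuous_intros)
    moreover have "x \<in> ?N" using subspace_0[OF U(1)] subspace_0[OF subspace_B] by simp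
    moreover have sub: "?N \<subseteq> {x \<in> B. \<phi> x \<in> V}"
    proof
      fix y assume y: "y \<in> ?N"
      then have "x + (y - x) \<in> B" using x B_closed(2)[of x "y - x"] by simp
      moreover have "\<phi> (x + (y - x)) = \<phi> x + \<phi> (y - x)"
        by (rule linear_betwD(1)[OF lin]) (use x y in auto)
      ultimately show "y \<in> {x \<in> B. \<phi> x \<in> V}" using x y U(3) by simp
    qed
    ultimately show "\<exists>T. openin (top_of_set B) T \<and> x \<in> T \<and> T \<subseteq> {x \<in> B. \<phi> x \<in> V}"
      using open_B by (intro exI[of _ ?N]) (auto simp: openin_open_eq)
  qed
  then have "continuous_map (top_of_set B) (discrete_topology UNIV) \<phi>"
    by (simp add: continuous_map_def)
  then show ?thesis using lin out by (simp add: tate_dual_def)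
qed

lemma dual_open_kernel:
  assumes "\<phi> \<in> Bdual"
  obtains U where "subspace U" "open U" "U \<subseteq> B" "\<And>x. x \<in> U \<Longrightarrow> \<phi> x = 0"
proof -
  have "continuous_map (top_of_set B) (discrete_topology UNIV) \<phi>" using assms by (simp add: tate_dual_def)
  then have "openin (top_of_set B) {x \<in> topspace (top_of_set B). \<phi> x \<in> {0}}"
    by (rule openin_continuous_map_preimage) simp
  then have "open {x \<in> B. \<phi> x = 0}" using open_B by (simp add: openin_open_eq)
  moreover have "\<phi> (sc 0 0) = 0 * \<phi> 0" using linear_betwD(2)[OF dual_linear[OF assms]] B_closed(1) by blast
  then have "0 \<in> {x \<in> B. \<phi> x = 0}" using B_closed(1) by simp
  ultimately obtain U where "subspace U" "open U" "U \<subseteq> {x \<in> B. \<phi> x = 0}"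
    by (rule open_subspace_nbhd)
  then show thesis using that by blast
qed

lemma subspace_dual: "form.subspace Bdual"
  unfolding form.subspace_def
proof (intro conjI ballI allI)
  show "0 \<in> Bdual" by (rule dualI[of _ B]) (auto simp: linear_betw_def subspace_B open_B)
  fix \<phi> \<psi> assume \<phi>: "\<phi> \<in> Bdual" and \<psi>: "\<psi> \<in> Bdual"
  obtain U where U: "subspace U" "open U" "U \<subseteq> B" "\<And>x. x \<in> U \<Longrightarrow> \<phi> x = 0"
    using dual_open_kernel[OF \<phi>] by metis
  obtain V where V: "subspace V" "open V" "V \<subseteq> B" "\<And>x. x \<in> V \<Longrightarrow> \<psi> x = 0"
    using dual_open_kernel[OF \<psi>] by metis
  show "\<phi> + \<psi> \<in> Bdual"
    by (rule dualI[of _ "U \<inter> V"])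
      (use U V dual_outside[OF \<phi>] dual_outside[OF \<psi>] dual_linear[OF \<phi>] dual_linear[OF \<psi>] in
        \<open>auto simp: linear_betw_def algebra_simps subspace_inter open_Int\<close>)
next
  fix \<phi> c assume \<phi>: "\<phi> \<in> Bdual"
  obtain U where U: "subspace U" "open U" "U \<subseteq> B" "\<And>x. x \<in> U \<Longrightarrow> \<phi> x = 0"
    using dual_open_kernel[OF \<phi>] by metis
  show "fscale c \<phi> \<in> Bdual"
    by (rule dualI[of _ U])
      (use U dual_outside[OF \<phi>] dual_linear[OF \<phi>] in \<open>auto simp: linear_betw_def algebra_simps\<close>)
qed

lemmas dual_add = form.subspace_add[OF subspace_dual] and dual_scale = form.subspace_scale[OF subspace_dual]

text \<open>For a fixed vector \<open>x\<close>, the \<open>c\<close>-component of \<open>[b, x]\<close> paired with a one-form and the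
  \<open>B\<close>-component of \<open>[x, b]\<close> paired with a functional on \<open>B\<close> are again functionals of \<open>b\<close>. Since an
  element of the completed tensor product is a function of such functionals, all operations are
  expressed through \<open>coact_c\<close> and \<open>coact_b\<close>.\<close>

definition coact_c :: "('g list \<Rightarrow> complex) \<Rightarrow> 'g \<Rightarrow> 'g \<Rightarrow> complex"
  where "coact_c \<xi> x = (\<lambda>b. if b \<in> B then \<xi> [s (lie b x)] else 0)"

definition coact_b :: "('g \<Rightarrow> complex) \<Rightarrow> 'g \<Rightarrow> 'g \<Rightarrow> complex"
  where "coact_b \<phi> x = (\<lambda>b. if b \<in> B then \<phi> (bpart (lie x b)) else 0)"

lemma ext1_linear:
  assumes "\<xi> \<in> R 1"
  shows "x \<in> C \<Longrightarrow> y \<in> C \<Longrightarrow> \<xi> [x + y] = \<xi> [x] + \<xi> [y]" "x \<in> C \<Longrightarrow> \<xi> [sc c x] = c * \<xi> [x]"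
    "\<xi> [0] = 0"
proof -
  have l: "linear_betw sc C (*) (\<lambda>x. \<xi> [x])" using ext_linear[OF assms, of "[]" "[]"] by simp
  then show "x \<in> C \<Longrightarrow> y \<in> C \<Longrightarrow> \<xi> [x + y] = \<xi> [x] + \<xi> [y]" "x \<in> C \<Longrightarrow> \<xi> [sc c x] = c * \<xi> [x]"
    by (auto simp: linear_betw_def)
  from linear_betwD(2)[OF l subspace_0[OF subspace_C], of 0] show "\<xi> [0] = 0" by simp
qed

lemma coact_c_mem:
  assumes "\<xi> \<in> R 1"
  shows "coact_c \<xi> x \<in> Bdual"
proof (rule dualI[of _ "{b. lie x b \<in> B}"])
  show "linear_betw sc B (*) (coact_c \<xi> x)"
    by (rule linear_betwI) (auto simp: coact_c_def B_closed lie_simps s_add s_scale ext1_linear[OF assms])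
  show "coact_c \<xi> x b = 0" if "b \<in> {b. lie x b \<in> B}" "b \<in> B" for b
  proof -
    have "lie b x \<in> B" using that(1) lie_antisym[of b x] B_closed(5) by simp
    then show ?thesis by (simp add: coact_c_def s_B ext1_linear[OF assms])
  qed
qed (auto simp: coact_c_def intro: open_lie_preimage[OF subspace_B open_B])

lemma coact_b_mem:
  assumes "\<phi> \<in> Bdual"
  shows "coact_b \<phi> x \<in> Bdual"
proof -
  obtain U where U: "subspace U" "open U" "U \<subseteq> B" "\<And>x. x \<in> U \<Longrightarrow> \<phi> x = 0"
    using dual_open_kernel[OF assms] by metis
  note lin = linear_betwD[OF dual_linear[OF assms]]
  show ?thesis
  proof (rule dualI[of _ "{b. lie x b \<in> U}"])
    show "linear_betw sc B (*) (coact_b \<phi> x)"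
    proof (rule linear_betwI)
      fix b b' assume b: "b \<in> B" "b' \<in> B"
      have "bpart (lie x (b + b')) = bpart (lie x b) + bpart (lie x b')" by (simp add: lie_simps s_add)
      then show "coact_b \<phi> x (b + b') = coact_b \<phi> x b + coact_b \<phi> x b'"
        using b lin(1)[OF bpart_B bpart_B] by (simp add: coact_b_def B_closed)
    next
      fix c b assume b: "b \<in> B"
      have "bpart (lie x (sc c b)) = sc c (bpart (lie x b))" by (simp add: lie_simps s_scale scale_right_diff_distrib)
      then show "coact_b \<phi> x (sc c b) = c * coact_b \<phi> x b"
        using b lin(2)[OF bpart_B] by (simp add: coact_b_def B_closed)
    qed
    show "coact_b \<phi> x b = 0" if "b \<in> {b. lie x b \<in> U}" "b \<in> B" for b
      using that U(3,4) by (auto simp: coact_b_def s_B)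
  qed (auto simp: coact_b_def intro: open_lie_preimage[OF U(1,2)])
qed

lemma coact_b_add: "\<phi> \<in> Bdual \<Longrightarrow> \<psi> \<in> Bdual \<Longrightarrow> coact_b (\<phi> + \<psi>) x = coact_b \<phi> x + coact_b \<psi> x"
  and coact_b_scale: "coact_b (fscale c \<phi>) x = fscale c (coact_b \<phi> x)"
  by (auto simp: coact_b_def fun_eq_iff)

text \<open>The map \<open>b \<mapsto> [b, x]\<close> sends an open subspace into \<open>B\<close>, so modulo \<open>B\<close> it has finite rank on the
  bounded space \<open>B\<close>, and its image involves finitely many coordinates of \<open>c\<close>.\<close>

lemma coact_c_finite: "finite {j \<in> E. coact_c (eps j) x \<noteq> 0}"
proof -
  let ?T = "\<lambda>b. s (lie b x)"
  obtain F where F: "finite F" "F \<subseteq> B" "B \<subseteq> span (F \<union> (B \<inter> {b. lie x b \<in> B}))"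
    using B_finite_quotient[OF open_lie_preimage[OF subspace_B open_B]] by metis
  have "{j \<in> E. coact_c (eps j) x \<noteq> 0} \<subseteq> supp (?T ` F)"
  proof safe
    fix j assume "coact_c (eps j) x \<noteq> 0"
    show "j \<in> supp (?T ` F)"
    proof (rule ccontr)
      assume nj: "j \<notin> supp (?T ` F)"
      have "coord (?T b) j = 0" if "b \<in> span (F \<union> (B \<inter> {b. lie x b \<in> B}))" for b
        using that
      proof (induction rule: span_induct)
        show "subspace {b. coord (?T b) j = 0}"
          using span_E by (auto simp: subspace_def lie_simps s_add s_scale s_zero representation_zero
              representation_add[OF independent_E] representation_scale[OF independent_E])
        fix b assume "b \<in> F \<union> (B \<inter> {b. lie x b \<in> B})"
        then consider "b \<in> F" | "lie x b \<in> B" by blast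
        then show "coord (?T b) j = 0"
        proof cases
          case 1 then show ?thesis using nj by (auto simp: supp_def)
        next
          case 2
          then have "lie b x \<in> B" using lie_antisym[of b x] B_closed(5) by simp
          then show ?thesis by (simp add: s_B representation_zero)
        qed
      qed
      then have "coact_c (eps j) x = 0" using F(3) by (auto simp: coact_c_def fun_eq_iff eps_apply)
      then show False using \<open>coact_c (eps j) x \<noteq> 0\<close> by simp
    qed
  qed
  then show ?thesis using finite_supp[of "?T ` F"] F(1) finite_subset by blast
qed

text \<open>Continuity of the bracket at the origin and boundedness of \<open>B\<close> give an open subspace \<open>W\<close> with
  \<open>\<phi>([W, B]) = 0\<close>. Then \<open>b \<mapsto> \<phi>([b, -])\<close> factors through the finite-dimensional quotient \<open>B / W\<close>, and
  expanding it in a basis of its image gives the finite sum.\<close>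

lemma bracket_finite_rank:
  assumes \<phi>: "\<phi> \<in> Bdual"
  shows "\<exists>Q p. finite Q \<and> Q \<subseteq> Bdual \<and> (\<forall>q\<in>Q. p q \<in> Bdual) \<and>
    (\<forall>b\<in>B. \<forall>b'\<in>B. \<phi> (lie b b') = (\<Sum>q\<in>Q. p q b * q b'))"
proof -
  obtain U where U: "subspace U" "open U" "U \<subseteq> B" "\<And>x. x \<in> U \<Longrightarrow> \<phi> x = 0"
    using dual_open_kernel[OF \<phi>] by metis
  have "open ((\<lambda>(x, y). lie x y) -` U)"
    by (rule open_vimage[OF U(2)]) (use tate in \<open>simp add: tate_lie_algebra_def\<close>)
  moreover have "(0, 0) \<in> (\<lambda>(x, y). lie x y) -` U" using subspace_0[OF U(1)] by (simp add: lie_simps)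
  ultimately obtain N1 N2 where N: "open N1" "open N2" "0 \<in> N1" "0 \<in> N2"
    "N1 \<times> N2 \<subseteq> (\<lambda>(x, y). lie x y) -` U"
    unfolding open_prod_def by (metis mem_Sigma_iff)
  obtain V where V: "subspace V" "open V" "V \<subseteq> N1 \<inter> N2"
    by (rule open_subspace_nbhd[of "N1 \<inter> N2"]) (use N in auto)
  have VV: "lie x y \<in> U" if "x \<in> V" "y \<in> V" for x y
  proof -
    have "(x, y) \<in> N1 \<times> N2" using V(3) that by auto
    then have "(x, y) \<in> (\<lambda>(x, y). lie x y) -` U" using N(5) by (rule rev_subsetD)
    then show ?thesis by simp
  qed
  obtain F where F: "finite F" "F \<subseteq> B" "B \<subseteq> span (F \<union> (B \<inter> V))"
    using B_finite_quotient[OF V(1,2)] by metis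
  \<comment> \<open>On \<open>W\<close> the bracket with \<open>V\<close> and with the finitely many complementary vectors lands in the kernel.\<close>
  define W where "W = V \<inter> (\<Inter>f\<in>F. {b. lie f b \<in> U})"
  have W: "subspace W" "open W"
    unfolding W_def
    by (intro subspace_inter subspace_Int V(1) open_lie_preimage[OF U(1,2)],
        intro open_Int open_INT V(2) F(1) ballI open_lie_preimage[OF U(1,2)])
  have kill: "\<phi> (lie w b) = 0" if w: "w \<in> W" and b: "b \<in> B" for w b
  proof -
    have "lie w b \<in> U" if "b \<in> span (F \<union> (B \<inter> V))" for b
      using that
    proof (induction rule: span_induct)
      show "subspace {b. lie w b \<in> U}" using open_lie_preimage[OF U(1,2)] by blast
      fix b assume "b \<in> F \<union> (B \<inter> V)"
      then consider "b \<in> F" | "b \<in> V" by blast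
      then show "lie w b \<in> U"
      proof cases
        case 1
        then have "lie b w \<in> U" using w by (auto simp: W_def)
        then show ?thesis using lie_antisym[of w b] subspace_neg[OF U(1)] by simp
      next
        case 2 then show ?thesis using VV w by (auto simp: W_def)
      qed
    qed
    then show ?thesis using U(4) F(3) b by blast
  qed
  obtain G where G: "finite G" "G \<subseteq> B" "B \<subseteq> span (G \<union> (B \<inter> W))"
    using B_finite_quotient[OF W] by metis
  define \<beta> where "\<beta> b = coact_b \<phi> b" for b
  have \<beta>: "\<beta> b b' = \<phi> (lie b b')" if "b \<in> B" "b' \<in> B" for b b'
    using that by (simp add: \<beta>_def coact_b_def s_B lie_B)
  have \<beta>_add: "\<beta> (a + b) = \<beta> a + \<beta> b" if "a \<in> B" "b \<in> B" for a b
  proof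
    fix b'
    show "\<beta> (a + b) b' = (\<beta> a + \<beta> b) b'"
      using that linear_betwD(1)[OF dual_linear[OF \<phi>] lie_B lie_B]
      by (cases "b' \<in> B") (simp_all add: \<beta> B_closed lie_simps, simp add: \<beta>_def coact_b_def)
  qed
  have \<beta>_scale: "\<beta> (sc c b) = fscale c (\<beta> b)" if "b \<in> B" for b c
  proof
    fix b'
    show "\<beta> (sc c b) b' = (fscale c (\<beta> b)) b'"
      using that linear_betwD(2)[OF dual_linear[OF \<phi>] lie_B]
      by (cases "b' \<in> B") (simp_all add: \<beta> B_closed lie_simps, simp add: \<beta>_def coact_b_def)
  qed
  have \<beta>_W: "\<beta> w = 0" if "w \<in> W" "w \<in> B" for w
    using kill[OF that(1)] that(2) by (auto simp: fun_eq_iff \<beta>_def coact_b_def s_B lie_B)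
  \<comment> \<open>The image of \<open>b \<mapsto> \<phi>([b, -])\<close> is spanned by the finite set \<open>\<beta> ` G\<close>.\<close>
  obtain Q where Q: "Q \<subseteq> \<beta> ` G" "form.independent Q" "\<beta> ` G \<subseteq> form.span Q"
    by (rule form.maximal_independent_subset[of "\<beta> ` G"])
  have finQ: "finite Q" using Q(1) G(1) finite_subset by blast
  have QB: "Q \<subseteq> Bdual" using Q(1) coact_b_mem[OF \<phi>] by (auto simp: \<beta>_def)
  have \<beta>_span: "b \<in> B \<and> \<beta> b \<in> form.span Q" if "b \<in> span (G \<union> (B \<inter> W))" for b
    using that
  proof (induction rule: span_induct)
    show "subspace {b. b \<in> B \<and> \<beta> b \<in> form.span Q}"
      using \<beta>_W[of 0] subspace_0[OF W(1)]
      by (auto simp: subspace_def B_closed \<beta>_add \<beta>_scale form.span_add form.span_scale form.span_zero)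
    fix b assume "b \<in> G \<union> (B \<inter> W)"
    then show "b \<in> B \<and> \<beta> b \<in> form.span Q" using G(2) Q(3) \<beta>_W form.span_zero by auto
  qed
  \<comment> \<open>The coordinates of \<open>\<phi>([b, -])\<close> with respect to \<open>Q\<close>, as functionals of \<open>b\<close>.\<close>
  define p where "p q b = (if b \<in> B then form.representation Q (\<beta> b) q else 0)" for q b
  have "p q \<in> Bdual" for q
  proof (rule dualI[OF _ _ W])
    show "linear_betw sc B (*) (p q)"
      using \<beta>_span G(3)
      by (auto simp: linear_betw_def p_def B_closed \<beta>_add \<beta>_scale form.representation_add[OF Q(2)]
          form.representation_scale[OF Q(2)] subset_iff)
  qed (auto simp: p_def \<beta>_W form.representation_zero)
  moreover have "\<phi> (lie b b') = (\<Sum>q\<in>Q. p q b * q b')" if "b \<in> B" "b' \<in> B" for b b'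
  proof -
    have "(\<Sum>q\<in>Q. fscale (form.representation Q (\<beta> b) q) q) = \<beta> b"
      using \<beta>_span G(3) that(1) by (intro form.sum_representation_eq[OF Q(2) _ finQ]) auto
    then have "\<beta> b b' = (\<Sum>q\<in>Q. fscale (form.representation Q (\<beta> b) q) q) b'" by simp
    then show ?thesis using that by (simp add: sum_apply p_def \<beta>)
  qed
  ultimately show ?thesis using finQ QB by blast
qed

text \<open>Functionals are added one at a time. The new one, corrected by its values on the old dual vectors,
  is nonzero by independence; a vector where it does not vanish, corrected in turn, is annihilated
  by the old functionals but not by the new one.\<close>

lemma dual_vectors:
  assumes "finite P" "P \<subseteq> Bdual" "form.independent P"
  shows "\<exists>b. \<forall>p\<in>P. b p \<in> B \<and> (\<forall>q\<in>P. q (b p) = (if p = q then 1 else 0))"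
  using assms
proof (induction P rule: finite_induct)
  case (insert p0 P)
  have ind: "form.independent P" and p0: "p0 \<in> Bdual" "p0 \<notin> form.span P" and PB: "P \<subseteq> Bdual"
  proof -
    have ins: "form.independent (insert p0 P)" by (rule insert.prems(2))
    then show "form.independent P" by (rule form.independent_mono) blast
    have "p0 \<notin> form.span (insert p0 P - {p0})" using ins unfolding form.dependent_def by blast
    then show "p0 \<notin> form.span P" using insert.hyps(2) by simp
    show "p0 \<in> Bdual" "P \<subseteq> Bdual" using insert.prems(1) by auto
  qed
  then obtain b where b: "\<And>p. p \<in> P \<Longrightarrow> b p \<in> B" "\<And>p q. p \<in> P \<Longrightarrow> q \<in> P \<Longrightarrow> q (b p) = (if p = q then 1 else 0)"
    using insert.IH by metis
  \<comment> \<open>The part of the new functional that vanishes on the old dual vectors.\<close>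
  let ?p = "p0 - (\<Sum>q\<in>P. fscale (p0 (b q)) q)"
  have "?p \<noteq> 0"
  proof
    assume "?p = 0"
    then have "p0 = (\<Sum>q\<in>P. fscale (p0 (b q)) q)" by simp
    also have "\<dots> \<in> form.span P" by (intro form.span_sum form.span_scale form.span_base)
    finally show False using p0(2) by simp
  qed
  then obtain x where x: "?p x \<noteq> 0" by (auto simp: fun_eq_iff)
  have xB: "x \<in> B"
  proof (rule ccontr)
    assume nx: "x \<notin> B"
    have "(\<Sum>q\<in>P. p0 (b q) * q x) = 0"
    proof (rule sum.neutral, intro ballI)
      fix q assume "q \<in> P"
      then have "q x = 0" using dual_outside[OF _ nx, of q] PB by blast
      then show "p0 (b q) * q x = 0" by simp
    qed
    then have "?p x = 0" using dual_outside[OF p0(1) nx] by (simp add: sum_apply)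
    then show False using x by simp
  qed
  have sB: "(\<Sum>q\<in>P. sc (q x) (b q)) \<in> B" by (intro subspace_sum[OF subspace_B]) (simp add: B_closed b(1))
  define y where "y = x - (\<Sum>q\<in>P. sc (q x) (b q))"
  have yB: "y \<in> B" unfolding y_def by (rule B_closed(3)[OF xB sB])
  have eval: "\<psi> y = \<psi> x - (\<Sum>q\<in>P. q x * \<psi> (b q))" if "\<psi> \<in> Bdual" for \<psi>
  proof -
    note lin = dual_linear[OF that]
    have "\<psi> (y + (\<Sum>q\<in>P. sc (q x) (b q))) = \<psi> y + \<psi> (\<Sum>q\<in>P. sc (q x) (b q))"
      by (rule linear_betwD(1)[OF lin yB sB])
    moreover have "\<psi> (\<Sum>q\<in>P. sc (q x) (b q)) = (\<Sum>q\<in>P. q x * \<psi> (b q))"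
      by (rule linear_betw_sum[OF lin module_axioms subspace_B b(1)])
    ultimately show ?thesis by (simp add: y_def)
  qed
  have qy: "q y = 0" if "q \<in> P" for q
  proof -
    have "(\<Sum>q'\<in>P. q' x * q (b q')) = (\<Sum>q'\<in>P. if q' = q then q x else 0)"
      
    proof (rule sum.cong[OF refl])
      fix q' assume "q' \<in> P"
      from b(2)[OF this that] show "q' x * q (b q') = (if q' = q then q x else 0)" by simp
    qed
    also have "\<dots> = q x" using that insert.hyps(1) by simp
    finally show ?thesis using eval[of q] PB that by auto
  qed
  have p0y: "p0 y \<noteq> 0" using x eval[OF p0(1)] by (simp add: sum_apply mult.commute)
  define b0 where "b0 = sc (1 / p0 y) y"
  have b0B: "b0 \<in> B" unfolding b0_def by (rule B_closed(4)[OF yB])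
  have p0b0: "p0 b0 = 1" unfolding b0_def using linear_betwD(2)[OF dual_linear[OF p0(1)] yB] p0y by simp
  have qb0: "q b0 = 0" if "q \<in> P" for q
  proof -
    have "q \<in> Bdual" using that PB by blast
    then show ?thesis unfolding b0_def using linear_betwD(2)[OF dual_linear yB, of q] qy[OF that] by simp
  qed
  define b' where "b' p = (if p = p0 then b0 else b p - sc (p0 (b p)) b0)" for p
  have ev: "\<psi> (b p - sc (p0 (b p)) b0) = \<psi> (b p) - p0 (b p) * \<psi> b0" if "\<psi> \<in> Bdual" "p \<in> P" for \<psi> p
  proof -
    note lin = dual_linear[OF that(1)]
    have "\<psi> ((b p - sc (p0 (b p)) b0) + sc (p0 (b p)) b0) = \<psi> (b p - sc (p0 (b p)) b0) + \<psi> (sc (p0 (b p)) b0)"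
      by (rule linear_betwD(1)[OF lin]) (simp_all add: B_closed b(1) that b0B)
    then show ?thesis using linear_betwD(2)[OF lin b0B] by simp
  qed
  show ?case
  proof (intro exI[of _ b'] ballI conjI)
    fix p assume p: "p \<in> insert p0 P"
    show "b' p \<in> B" using p by (auto simp: b'_def b0B B_closed b(1))
    fix q assume q: "q \<in> insert p0 P"
    have qB: "q \<in> Bdual" using q p0 PB by auto
    show "q (b' p) = (if p = q then 1 else 0)"
    proof (cases "p = p0")
      case True
      show ?thesis
      proof (cases "q = p0")
        case True
        then show ?thesis using \<open>p = p0\<close> p0b0 by (simp add: b'_def)
      next
        case False
        then show ?thesis using \<open>p = p0\<close> qb0[of q] q by (simp add: b'_def)
      qed
    next
      case False
      then have pP: "p \<in> P" using p by simp
      have "q (b' p) = q (b p) - p0 (b p) * q b0" using False ev[OF qB pP] by (simp add: b'_def)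
      show ?thesis
      proof (cases "q = p0")
        case True
        then show ?thesis using \<open>q (b' p) = _\<close> False p0b0 by simp
      next
        case False
        then have "q \<in> P" using q by simp
        then show ?thesis using \<open>q (b' p) = _\<close> qb0[of q] b(2)[OF pP] by simp
      qed
    qed
  qed
qed simp

section \<open>The completed tensor product\<close>

lemma tens_apply: "\<phi> \<in> Bdual \<Longrightarrow> tens sc B r b (\<phi>, xs) = r xs * \<phi> b"
  "\<phi> \<notin> Bdual \<Longrightarrow> tens sc B r b (\<phi>, xs) = 0"
  by (simp_all add: tens_def)

abbreviation slice :: "(('g \<Rightarrow> complex) \<times> 'g list \<Rightarrow> complex) \<Rightarrow> ('g \<Rightarrow> complex) \<Rightarrow> 'g list \<Rightarrow> complex"
  where "slice f \<phi> \<equiv> (\<lambda>xs. f (\<phi>, xs))"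

lemma A_outside: "f \<in> A n \<Longrightarrow> \<phi> \<notin> Bdual \<Longrightarrow> f (\<phi>, xs) = 0"
  and A_linear: "f \<in> A n \<Longrightarrow> linear_betw fscale Bdual (*) (\<lambda>\<phi>. f (\<phi>, xs))"
  and A_slice: "f \<in> A n \<Longrightarrow> \<phi> \<in> Bdual \<Longrightarrow> slice f \<phi> \<in> R n"
  unfolding compl_tensor_def by blast+

lemma A_slice': "f \<in> A n \<Longrightarrow> slice f \<phi> \<in> R n"
  using A_slice[of f n \<phi>] A_outside[of f n \<phi>] ext_zero[of n]
  by (cases "\<phi> \<in> Bdual") (auto simp: zero_fun_def)

lemma AI:
  assumes "\<And>\<phi> xs. \<phi> \<notin> Bdual \<Longrightarrow> f (\<phi>, xs) = 0"
    "\<And>\<phi> \<psi>. \<phi> \<in> Bdual \<Longrightarrow> \<psi> \<in> Bdual \<Longrightarrow> slice f (\<phi> + \<psi>) = slice f \<phi> + slice f \<psi>"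
    "\<And>\<phi> c. \<phi> \<in> Bdual \<Longrightarrow> slice f (fscale c \<phi>) = fscale c (slice f \<phi>)"
    "\<And>\<phi>. \<phi> \<in> Bdual \<Longrightarrow> slice f \<phi> \<in> R n"
  shows "f \<in> A n"
  using assms unfolding compl_tensor_def linear_betw_def by (auto simp: fun_eq_iff)

lemma A_slice_add: "f \<in> A n \<Longrightarrow> \<phi> \<in> Bdual \<Longrightarrow> \<psi> \<in> Bdual \<Longrightarrow> slice f (\<phi> + \<psi>) = slice f \<phi> + slice f \<psi>"
  and A_slice_scale: "f \<in> A n \<Longrightarrow> \<phi> \<in> Bdual \<Longrightarrow> slice f (fscale c \<phi>) = fscale c (slice f \<phi>)"
  using A_linear[of f n] unfolding linear_betw_def by (auto simp: fun_eq_iff)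

lemma A_slice_sum:
  assumes "f \<in> A n" "\<And>i. i \<in> K \<Longrightarrow> v i \<in> Bdual"
  shows "slice f (\<Sum>i\<in>K. fscale (c i) (v i)) = (\<Sum>i\<in>K. fscale (c i) (slice f (v i)))"
  using linear_betw_sum[OF A_linear[OF assms(1)] form.module_axioms subspace_dual assms(2)]
  by (auto simp: fun_eq_iff sum_apply)

lemma tens_mem:
  assumes "r \<in> R n" "b \<in> B"
  shows "tens sc B r b \<in> A n"
proof (rule AI)
  fix \<phi> assume "\<phi> \<in> Bdual"
  then have "slice (tens sc B r b) \<phi> = fscale (\<phi> b) r" by (auto simp: fun_eq_iff tens_apply)
  then show "slice (tens sc B r b) \<phi> \<in> R n" using ext_scale assms by simp
qed (auto simp: tens_apply dual_add dual_scale fun_eq_iff algebra_simps)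

lemma slice_tens: "\<phi> \<in> Bdual \<Longrightarrow> slice (tens sc B r b) \<phi> = fscale (\<phi> b) r"
  by (auto simp: fun_eq_iff tens_apply)

lemma slice_simps: "slice (f + g) \<phi> = slice f \<phi> + slice g \<phi>" "slice (f - g) \<phi> = slice f \<phi> - slice g \<phi>"
  "slice (fscale c f) \<phi> = fscale c (slice f \<phi>)" "slice (- f) \<phi> = - slice f \<phi>" "slice 0 \<phi> = 0"
  by (auto simp: fun_eq_iff)

lemma slice_eqI: "(\<And>\<phi>. slice f \<phi> = slice g \<phi>) \<Longrightarrow> f = g"
  by (rule ext) (metis prod.collapse)

lemma subspace_A: "form.subspace (A n)"
  unfolding form.subspace_def
proof (intro conjI ballI allI)
  show "0 \<in> A n" by (rule AI) (simp_all only: slice_simps ext_zero add_0 fscale_zero_right, simp)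
  show "f + g \<in> A n" if f: "f \<in> A n" and g: "g \<in> A n" for f g
  proof (rule AI, goal_cases)
    case 1 then show ?case by (simp add: A_outside[OF f] A_outside[OF g])
  next
    case 2 then show ?case
      by (simp only: slice_simps A_slice_add[OF f] A_slice_add[OF g] add.assoc add.left_commute)
  next
    case 3 then show ?case
      by (simp only: slice_simps A_slice_scale[OF f] A_slice_scale[OF g] form.scale_right_distrib)
  next
    case 4 then show ?case by (simp only: slice_simps ext_add[OF A_slice[OF f] A_slice[OF g]])
  qed
  show "fscale c f \<in> A n" if f: "f \<in> A n" for f c
  proof (rule AI, goal_cases)
    case 1 then show ?case by (simp add: A_outside[OF f])
  next
    case 2 then show ?case by (simp only: slice_simps A_slice_add[OF f] form.scale_right_distrib)
  next
    case 3 then show ?case by (simp only: slice_simps A_slice_scale[OF f] form.scale_scale mult.commute)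
  next
    case 4 then show ?case by (simp only: slice_simps ext_scale[OF A_slice[OF f]])
  qed
qed

lemmas A_add = form.subspace_add[OF subspace_A] and A_scale = form.subspace_scale[OF subspace_A]
  and A_zero = form.subspace_0[OF subspace_A] and A_diff = form.subspace_diff[OF subspace_A]
  and A_sum = form.subspace_sum[OF subspace_A]

text \<open>On the span of finitely many functionals an element of the double dual is given by vectors of \<open>B\<close>,
  namely by a dual system for a basis of the span.\<close>

lemma tens_dense:
  assumes f: "f \<in> A n" and \<Phi>: "finite \<Phi>" "\<Phi> \<subseteq> Bdual"
  shows "\<exists>(P :: ('g \<Rightarrow> complex) set) r b. (\<forall>p\<in>P. r p \<in> R n \<and> b p \<in> B) \<and>
    (\<forall>\<phi>\<in>\<Phi>. slice (\<Sum>p\<in>P. tens sc B (r p) (b p)) \<phi> = slice f \<phi>)"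
proof -
  obtain P where P: "P \<subseteq> \<Phi>" "form.independent P" "\<Phi> \<subseteq> form.span P"
    by (rule form.maximal_independent_subset[of \<Phi>])
  have finP: "finite P" and PB: "P \<subseteq> Bdual" using P(1) \<Phi> finite_subset by blast+
  obtain b where b: "\<And>p. p \<in> P \<Longrightarrow> b p \<in> B" "\<And>p q. p \<in> P \<Longrightarrow> q \<in> P \<Longrightarrow> q (b p) = (if p = q then 1 else 0)"
    using dual_vectors[OF finP PB P(2)] by metis
  have "slice (\<Sum>p\<in>P. tens sc B (slice f p) (b p)) \<phi> = slice f \<phi>" if \<phi>: "\<phi> \<in> \<Phi>" for \<phi>
  proof -
    define c where "c = form.representation P \<phi>"
    have \<phi>eq: "(\<Sum>p\<in>P. fscale (c p) p) = \<phi>"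
      unfolding c_def using P \<phi> by (intro form.sum_representation_eq[OF _ _ finP]) auto
    have ev: "\<phi> (b p) = c p" if "p \<in> P" for p
    proof -
      have "\<phi> (b p) = (\<Sum>q\<in>P. c q * q (b p))" by (subst \<phi>eq[symmetric]) (simp add: sum_apply)
      also have "\<dots> = (\<Sum>q\<in>P. if q = p then c p else 0)" 
      proof (rule sum.cong[OF refl])
        fix q assume "q \<in> P"
        from b(2)[OF that this] show "c q * q (b p) = (if q = p then c p else 0)" by simp
      qed
      finally show ?thesis using that finP by simp
    qed
    have \<phi>B: "\<phi> \<in> Bdual" using \<phi> \<Phi>(2) by blast
    have "slice f \<phi> = (\<Sum>p\<in>P. fscale (c p) (slice f p))"
      using A_slice_sum[OF f, of P "\<lambda>p. p" c] PB \<phi>eq by auto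
    also have "\<dots> = slice (\<Sum>p\<in>P. tens sc B (slice f p) (b p)) \<phi>"
      using ev by (auto simp: fun_eq_iff sum_apply tens_apply[OF] \<phi>B mult.commute intro!: sum.cong)
    finally show ?thesis by simp
  qed
  then show ?thesis using b(1) A_slice[OF f] PB
    by (intro exI[of _ P] exI[of _ "slice f"] exI[of _ b]) auto
qed

lemma A_eq_on_tens:
  assumes g: "cont_functional (A n) g" and h: "cont_functional (A n) h" and f: "f \<in> A n"
    and eq: "\<And>r b. r \<in> R n \<Longrightarrow> b \<in> B \<Longrightarrow> g (tens sc B r b) = h (tens sc B r b)"
  shows "g f = h f"
proof -
  from g f obtain K where K: "finite K" "\<forall>v\<in>A n. (\<forall>k\<in>K. v k = f k) \<longrightarrow> g v = g f"
    by (rule cont_functional_finite) (rule that, assumption+)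
  from h f obtain L where L: "finite L" "\<forall>v\<in>A n. (\<forall>k\<in>L. v k = f k) \<longrightarrow> h v = h f"
    by (rule cont_functional_finite) (rule that, assumption+)
  define \<Phi> where "\<Phi> = fst ` (K \<union> L) \<inter> Bdual"
  have \<Phi>: "finite \<Phi>" "\<Phi> \<subseteq> Bdual" using K L by (auto simp: \<Phi>_def)
  from tens_dense[OF f \<Phi>] obtain P :: "('g \<Rightarrow> complex) set" and r b
    where rb': "\<forall>p\<in>P. r p \<in> R n \<and> b p \<in> B"
      and agree': "\<forall>\<phi>\<in>\<Phi>. slice (\<Sum>p\<in>P. tens sc B (r p) (b p)) \<phi> = slice f \<phi>"
    by (elim exE conjE) (rule that, assumption+)
  note rb = rb'[rule_format] and agree = agree'[rule_format]
  define v where "v = (\<Sum>p\<in>P. tens sc B (r p) (b p))"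
  have tm: "tens sc B (r p) (b p) \<in> A n" if "p \<in> P" for p using rb[OF that] by (simp add: tens_mem)
  have v: "v \<in> A n" unfolding v_def by (rule A_sum) (rule tm)
  have ag: "v k = f k" if "k \<in> K \<union> L" for k
  proof (cases "fst k \<in> Bdual")
    case True
    then have "fst k \<in> \<Phi>" using that by (auto simp: \<Phi>_def)
    from fun_cong[OF agree[OF this], of "snd k"] show ?thesis by (simp add: v_def)
  next
    case False
    then show ?thesis using A_outside[OF v, of "fst k" "snd k"] A_outside[OF f, of "fst k" "snd k"] by simp
  qed
  have lin: "F v = (\<Sum>p\<in>P. 1 * F (tens sc B (r p) (b p)))" if "cont_functional (A n) F" for F
  proof -
    have "F (\<Sum>p\<in>P. fscale 1 (tens sc B (r p) (b p))) = (\<Sum>p\<in>P. 1 * F (tens sc B (r p) (b p)))"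
      by (rule linear_betw_sum[OF cont_functional_linear[OF that] form.module_axioms subspace_A]) (rule tm)
    then show ?thesis by (simp add: v_def)
  qed
  have "g v = g f" by (rule K(2)[rule_format, OF v], rule ag, simp)
  then have "g f = g v" by simp
  also have "g v = h v" unfolding lin[OF g] lin[OF h] using eq rb by simp
  also have "h v = h f" by (rule L(2)[rule_format, OF v], rule ag, simp)
  finally show ?thesis .
qed

lemma tens_smul_tens: "tens_smul r (tens sc B r' b) = tens sc B (wedge r r') b"
proof
  fix p :: "('g \<Rightarrow> complex) \<times> 'g list"
  obtain \<phi> xs where p: "p = (\<phi>, xs)" by fastforce
  show "tens_smul r (tens sc B r' b) p = tens sc B (wedge r r') b p"
  proof (cases "\<phi> \<in> Bdual")
    case True
    have "wedge r (slice (tens sc B r' b) \<phi>) xs = wedge r (fscale (\<phi> b) r') xs"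
      by (simp only: slice_tens[OF True])
    then show ?thesis
      by (simp only: p tens_smul_def prod.case tens_apply(1)[OF True] wedge_scale_right fscale_apply mult.commute)
  next
    case False
    then show ?thesis using wedge_zero_right[of r] by (simp add: p tens_smul_def tens_apply zero_fun_def)
  qed
qed

lemma slice_smul: "slice (tens_smul r f) \<phi> = wedge r (slice f \<phi>)"
  by (simp add: tens_smul_def)

lemma smul_mem:
  assumes "r \<in> R m" "f \<in> A n"
  shows "tens_smul r f \<in> A (m + n)"
proof (rule AI)
  fix \<phi> xs assume "\<phi> \<notin> Bdual"
  then have "slice f \<phi> = 0" using A_outside[OF assms(2)] by (auto simp: fun_eq_iff)
  then show "tens_smul r f (\<phi>, xs) = 0" by (simp add: tens_smul_def wedge_linear)
qed (simp_all only: slice_smul A_slice_add[OF assms(2)] A_slice_scale[OF assms(2)] wedge_linear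
    wedge_mem[OF assms(1) A_slice[OF assms(2)]])

lemma smul_simps:
  "tens_smul (r + r') f = tens_smul r f + tens_smul r' f"
  "tens_smul (r - r') f = tens_smul r f - tens_smul r' f"
  "tens_smul (- r) f = - tens_smul r f"
  "tens_smul (fscale c r) f = fscale c (tens_smul r f)"
  "tens_smul r (f + g) = tens_smul r f + tens_smul r g"
  "tens_smul r (f - g) = tens_smul r f - tens_smul r g"
  "tens_smul r (- f) = - tens_smul r f"
  "tens_smul r (fscale c f) = fscale c (tens_smul r f)"
  "tens_smul (0 :: 'g list \<Rightarrow> complex) f = 0" "tens_smul r (0 :: ('g \<Rightarrow> complex) \<times> 'g list \<Rightarrow> complex) = 0"
  by (rule slice_eqI, simp only: slice_smul slice_simps wedge_linear)+

lemma smul_assoc: "tens_smul (wedge r r') f = tens_smul r (tens_smul r' f)"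
  by (auto simp: fun_eq_iff tens_smul_def wedge_assoc)

lemma smul_one: "tens_smul ext_one f = f"
  by (auto simp: fun_eq_iff tens_smul_def)

lemma cont_linear_slice: "cont_linear (A n) (R n) (\<lambda>f. slice f \<phi>)"
  by (rule cont_linearI_finite_dependence)
    (auto simp: A_slice' linear_betw_def slice_simps intro!: finite_dependence_left)

lemma cont_linear_smul_right:
  assumes "r \<in> R m" shows "cont_linear (A n) (A (m + n)) (\<lambda>f. tens_smul r f)"
proof (rule cont_linearI_finite_dependence)
  show "finite_dependence (\<lambda>f (v :: unit \<Rightarrow> complex). tens_smul r f y)" for y
    unfolding tens_smul_def split_beta
    by (intro finite_dependence_wedge finite_dependence_left finite_dependence_const)
qed (auto simp: smul_mem assms linear_betw_def smul_simps)

lemma cont_linear_smul_left: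
  assumes "f \<in> A n" shows "cont_linear (R m) (A (m + n)) (\<lambda>r. tens_smul r f)"
proof (rule cont_linearI_finite_dependence)
  show "finite_dependence (\<lambda>r (v :: unit \<Rightarrow> complex). tens_smul r f y)" for y
    unfolding tens_smul_def split_beta
    by (intro finite_dependence_wedge finite_dependence_left finite_dependence_const)
qed (auto simp: smul_mem assms linear_betw_def smul_simps)

end

section \<open>Forms of low degree\<close>

context based_space begin

lemma ext_linear_contract: "r \<in> R n \<Longrightarrow> set ys \<subseteq> C \<Longrightarrow> linear_betw sc C (*) (\<lambda>x. r (x # ys))"
  using ext_linear[of r n "[]" ys] by simp

definition two_form :: "('g \<Rightarrow> 'g \<Rightarrow> complex) \<Rightarrow> 'g list \<Rightarrow> complex"
  where "two_form \<beta> xs = (case xs of [x, y] \<Rightarrow> if x \<in> C \<and> y \<in> C then \<beta> x y else 0 | _ \<Rightarrow> 0)"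

lemma two_form_apply: "x \<in> C \<Longrightarrow> y \<in> C \<Longrightarrow> two_form \<beta> [x, y] = \<beta> x y"
  by (simp add: two_form_def)

lemma two_form_cases:
  assumes "two_form \<beta> xs \<noteq> 0"
  obtains x y where "xs = [x, y]" "x \<in> C" "y \<in> C"
  using assms by (auto simp: two_form_def split: list.splits if_splits)

lemma one_formI:
  assumes "linear_betw sc C (*) f"
  shows "(\<lambda>xs. case xs of [x] \<Rightarrow> if x \<in> C then f x else 0 | _ \<Rightarrow> 0) \<in> R 1" (is "?f \<in> _")
proof (rule ext_dualI)
  have c: "contract x ?f = fscale (f x) ext_one" if "x \<in> C" for x
    using that by (auto simp: fun_eq_iff contract_def ext_one_def split: list.splits)
  fix x assume x: "x \<in> C"
  show "contract x ?f \<in> R (1 - 1)" by (simp add: c[OF x] ext_scale ext_one_mem)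
  show "contract x (contract x ?f) = 0"
    by (auto simp: fun_eq_iff contract_def split: list.splits)
  fix k
  show "contract (sc k x) ?f = fscale k (contract x ?f)"
    using linear_betwD(2)[OF assms x] c[OF x] c[OF subspace_scale[OF subspace_C x]] by (simp add: fun_eq_iff)
next
  have c: "contract x ?f = fscale (f x) ext_one" if "x \<in> C" for x
    using that by (auto simp: fun_eq_iff contract_def ext_one_def split: list.splits)
  fix x y assume x: "x \<in> C" "y \<in> C"
  show "contract (x + y) ?f = contract x ?f + contract y ?f"
    using linear_betwD(1)[OF assms x] c[OF x(1)] c[OF x(2)] c[OF subspace_add[OF subspace_C x]]
    by (simp add: fun_eq_iff algebra_simps)
qed (auto split: list.splits if_splits)

lemma two_formI:
  assumes l1: "\<And>y. y \<in> C \<Longrightarrow> linear_betw sc C (*) (\<lambda>x. \<beta> x y)"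
    and l2: "\<And>x. x \<in> C \<Longrightarrow> linear_betw sc C (*) (\<beta> x)"
    and alt: "\<And>x. x \<in> C \<Longrightarrow> \<beta> x x = 0"
  shows "two_form \<beta> \<in> R 2"
proof (rule ext_dualI)
  fix xs assume "two_form \<beta> xs \<noteq> 0"
  then show "int (length xs) = 2 \<and> set xs \<subseteq> C" by (auto elim!: two_form_cases)
next
  fix x assume x: "x \<in> C"
  have "contract x (two_form \<beta>) = (\<lambda>xs. case xs of [y] \<Rightarrow> if y \<in> C then \<beta> x y else 0 | _ \<Rightarrow> 0)"
    using x by (auto simp: fun_eq_iff contract_def two_form_def split: list.splits)
  then show "contract x (two_form \<beta>) \<in> R (2 - 1)" using one_formI[OF l2[OF x]] by simp
  show "contract x (contract x (two_form \<beta>)) = 0"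
    using alt[OF x] by (auto simp: fun_eq_iff contract_def two_form_def split: list.splits)
  fix k
  show "contract (sc k x) (two_form \<beta>) = fscale k (contract x (two_form \<beta>))"
    using x linear_betwD(2)[OF l1 x] subspace_scale[OF subspace_C x]
    by (auto simp: fun_eq_iff contract_def two_form_def split: list.splits)
next
  fix x y assume x: "x \<in> C" "y \<in> C"
  show "contract (x + y) (two_form \<beta>) = contract x (two_form \<beta>) + contract y (two_form \<beta>)"
    using x linear_betwD(1)[OF l1 x] subspace_add[OF subspace_C x]
    by (auto simp: fun_eq_iff contract_def two_form_def split: list.splits)
qed

lemma wedge_1_1: "r [] = 0 \<Longrightarrow> r' [] = 0 \<Longrightarrow> wedge r r' [x, y] = r [x] * r' [y] - r [y] * r' [x]"
  by (simp add: wedge_Cons contract_def grade_inv_def)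

text \<open>As soon as \<open>F\<close> contains all pairs of coordinates of the two vectors, the sum is the bilinear
  expansion of \<open>\<beta>\<close>, antisymmetrised by the product of one-forms.\<close>

lemma eventually_sum_eps_eps:
  assumes l1: "\<And>y. y \<in> C \<Longrightarrow> linear_betw sc C (*) (\<lambda>x. \<beta> x y)"
    and l2: "\<And>x. x \<in> C \<Longrightarrow> linear_betw sc C (*) (\<beta> x)"
    and g: "g \<in> R 2" "\<And>x y. x \<in> C \<Longrightarrow> y \<in> C \<Longrightarrow> g [x, y] = \<beta> x y - \<beta> y x"
  shows "eventually (\<lambda>F. (\<Sum>(i, j)\<in>F. \<beta> i j * wedge (eps i) (eps j) xs) = g xs) (finite_subsets_at_top (E \<times> E))"
proof (cases "\<exists>x y. xs = [x, y] \<and> x \<in> C \<and> y \<in> C")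
  case True
  then obtain x y where xs: "xs = [x, y]" and x: "x \<in> C" and y: "y \<in> C" by blast
  let ?T = "supp {x, y}"
  have T: "finite ?T" "?T \<subseteq> E" "supp {x} \<subseteq> ?T" "supp {y} \<subseteq> ?T"
    using supp_sub by (auto simp: finite_supp) (auto simp: supp_def)
  have ex: "(\<Sum>i\<in>?T. \<Sum>j\<in>?T. \<beta> i j * (coord u i * coord v j)) = \<beta> u v"
    if u: "u \<in> C" "supp {u} \<subseteq> ?T" and v: "v \<in> C" "supp {v} \<subseteq> ?T" for u v
  proof -
    have "\<beta> u v = (\<Sum>i\<in>?T. coord u i * \<beta> i v)"
      by (rule linear_expand[OF l1[OF v(1)] u(1) T(1) u(2) T(2)])
    also have "\<dots> = (\<Sum>i\<in>?T. coord u i * (\<Sum>j\<in>?T. coord v j * \<beta> i j))"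
    proof (rule sum.cong[OF refl])
      fix i assume "i \<in> ?T"
      then have "i \<in> C" using T(2) E_sub by blast
      from linear_expand[OF l2[OF this] v(1) T(1) v(2) T(2)]
      show "coord u i * \<beta> i v = coord u i * (\<Sum>j\<in>?T. coord v j * \<beta> i j)" by simp
    qed
    finally show ?thesis by (simp add: sum_distrib_left algebra_simps)
  qed
  have "(\<Sum>(i, j)\<in>F. \<beta> i j * wedge (eps i) (eps j) xs) = g xs"
    if F: "finite F" "?T \<times> ?T \<subseteq> F" "F \<subseteq> E \<times> E" for F
  proof -
    have w: "wedge (eps i) (eps j) xs = coord x i * coord y j - coord y i * coord x j" for i j
      unfolding xs by (subst wedge_1_1) (simp_all add: eps_Nil eps_apply)
    have "(\<Sum>(i, j)\<in>F. \<beta> i j * wedge (eps i) (eps j) xs) = (\<Sum>(i, j)\<in>?T \<times> ?T. \<beta> i j * wedge (eps i) (eps j) xs)"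
      by (rule sum.mono_neutral_right[OF F(1,2)]) (auto simp: w supp_def)
    also have "\<dots> = (\<Sum>i\<in>?T. \<Sum>j\<in>?T. \<beta> i j * (coord x i * coord y j)) - (\<Sum>i\<in>?T. \<Sum>j\<in>?T. \<beta> i j * (coord y i * coord x j))"
      by (simp add: sum.cartesian_product[symmetric] w sum_subtractf right_diff_distrib)
    also have "\<dots> = g xs" unfolding ex[OF x T(3) y T(4)] ex[OF y T(4) x T(3)] xs g(2)[OF x y] ..
    finally show ?thesis .
  qed
  then show ?thesis
    unfolding eventually_finite_subsets_at_top using T by (intro exI[of _ "?T \<times> ?T"]) auto
next
  case False
  then have bad: "int (length xs) \<noteq> 2 \<or> \<not> set xs \<subseteq> C"
    by (cases xs rule: list.exhaust; cases "tl xs" rule: list.exhaust; cases "tl (tl xs)" rule: list.exhaust) auto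
  have "wedge (eps i) (eps j) xs = 0" for i j
    by (rule ext_eq_0[OF _ bad]) (use wedge_mem[OF eps_mem eps_mem] in simp)
  then have "(\<Sum>(i, j)\<in>F. \<beta> i j * wedge (eps i) (eps j) xs) = g xs" for F
    using ext_eq_0[OF g(1) bad] by simp
  then show ?thesis by simp
qed

lemma supp_vanish:
  assumes "set ys \<subseteq> X" "j \<notin> supp X"
  shows "eps j ys = 0"
proof (rule ccontr)
  assume "eps j ys \<noteq> 0"
  then obtain x where "ys = [x]" "coord x j \<noteq> 0" by (auto simp: dual_basis_form_def split: list.splits)
  then show False using assms by (auto simp: supp_def)
qed

lemma local_sum_eps_wedge:
  assumes "finite X" "set ys \<subseteq> X"
  shows "local_sum E (\<lambda>j. wedge (eps j) (u j)) ys = (\<Sum>j\<in>supp X. wedge (eps j) (u j)) ys"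
proof (rule local_sum_eq)
  fix j assume "j \<notin> supp X"
  then show "wedge (eps j) (u j) ys = 0"
    using assms by (intro wedge_eq_0_left supp_vanish[of _ X]) auto
qed (use finite_supp[OF assms(1)] supp_sub in auto)

end

context split_tate_lie_algebra begin

section \<open>Construction of the action\<close>

definition coact_support :: "'g \<Rightarrow> 'g set" where "coact_support k = {j \<in> E. coact_c (eps j) k \<noteq> 0}"

text \<open>The matrix coefficient \<open>b \<mapsto> \<epsilon>\<^sup>j([b, e\<^sub>k])\<close> for \<open>i = (k, j)\<close>, up to sign the coefficient of
  \<open>\<epsilon>\<^sup>k\<close> in the coadjoint action of \<open>b\<close> on \<open>\<epsilon>\<^sup>j\<close>.\<close>

definition pair_coact :: "'g \<times> 'g \<Rightarrow> 'g \<Rightarrow> complex" where "pair_coact i = coact_c (eps (snd i)) (fst i)"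

abbreviation "pairs \<equiv> Sigma E coact_support"
abbreviation "pairs_at X \<equiv> Sigma (supp X) coact_support"

lemma pair_coact_mem: "pair_coact i \<in> Bdual" by (simp add: pair_coact_def coact_c_mem eps_mem)

lemma finite_pairs_at: "finite X \<Longrightarrow> finite (pairs_at X)"
  using finite_supp coact_c_finite by (auto simp: coact_support_def)

lemma local_sum_pairs:
  assumes "finite X" "set ys \<subseteq> X"
    and "\<And>k j. k \<notin> supp X \<Longrightarrow> g (k, j) ys = 0"
  shows "local_sum pairs g ys = (\<Sum>i\<in>pairs_at X. g i) ys"
  by (rule local_sum_eq) (use finite_pairs_at[OF assms(1)] supp_sub[of X] assms(3) in auto)

lemma wedge_eq_0_right:
  assumes "\<And>ys. set ys \<subseteq> set xs \<Longrightarrow> r' ys = 0"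
  shows "wedge r r' xs = 0"
proof -
  have "wedge r r' xs = wedge r 0 xs" by (rule wedge_cong) (use assms in auto)
  then show ?thesis by (simp add: wedge_linear)
qed

text \<open>The part along \<open>\<epsilon>\<^sup>k\<close> of the image of \<open>\<epsilon>\<^sup>j\<close> under \<open>a\<close>; the minus sign is that of the coadjoint
  action.\<close>

definition act_weight :: "(('g \<Rightarrow> complex) \<times> 'g list \<Rightarrow> complex) \<Rightarrow> 'g \<times> 'g \<Rightarrow> 'g list \<Rightarrow> complex"
  where "act_weight a i = - wedge (slice a (pair_coact i)) (eps (fst i))"

definition act0 :: "(('g \<Rightarrow> complex) \<times> 'g list \<Rightarrow> complex) \<Rightarrow> ('g list \<Rightarrow> complex) \<Rightarrow> 'g list \<Rightarrow> complex"
  where "act0 a = derivation_sum pairs (act_weight a) snd"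

lemma act_weight_vanish: "set ys \<subseteq> X \<Longrightarrow> k \<notin> supp X \<Longrightarrow> act_weight a (k, j) ys = 0"
  unfolding act_weight_def by simp (intro wedge_eq_0_right supp_vanish[of _ X], auto)

lemma locally_finite_act: "locally_finite pairs (act_weight a)"
  unfolding locally_finite_def
proof (intro allI impI)
  fix X :: "'g set" assume X: "finite X"
  have "{i \<in> pairs. \<exists>ys. set ys \<subseteq> X \<and> act_weight a i ys \<noteq> 0} \<subseteq> pairs_at X"
  proof
    fix i assume i: "i \<in> {i \<in> pairs. \<exists>ys. set ys \<subseteq> X \<and> act_weight a i ys \<noteq> 0}"
    then obtain ys where "set ys \<subseteq> X" "act_weight a i ys \<noteq> 0" by blast
    then have "fst i \<in> supp X" using act_weight_vanish[of ys X "fst i" a "snd i"] by auto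
    then show "i \<in> pairs_at X" using i by auto
  qed
  then show "finite {i \<in> pairs. \<exists>ys. set ys \<subseteq> X \<and> act_weight a i ys \<noteq> 0}"
    using finite_pairs_at[OF X] finite_subset by blast
qed

lemma act0_finite:
  assumes "finite X" "set ys \<subseteq> X"
  shows "act0 a r ys = (\<Sum>i\<in>pairs_at X. wedge (act_weight a i) (contract (snd i) r)) ys"
  unfolding act0_def derivation_sum_def
  by (rule local_sum_pairs[OF assms], intro wedge_eq_0_left act_weight_vanish[of _ X]) (use assms in auto)

lemma act_weight_mem: "a \<in> A m \<Longrightarrow> act_weight a i \<in> R (m + 1)"
  unfolding act_weight_def by (intro ext_minus wedge_mem A_slice[OF _ pair_coact_mem] eps_mem)

lemma act0_mem:
  assumes "a \<in> A m" "r \<in> R n"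
  shows "act0 a r \<in> R (m + n)"
  using derivation_sum_mem[OF locally_finite_act act_weight_mem[OF assms(1)] assms(2)]
  by (simp add: act0_def add.commute)

lemma act0_superderivation: "a \<in> A m \<Longrightarrow> superderivation fscale R wedge m (act0 a)"
  unfolding act0_def by (rule derivation_sum_superderivation[OF locally_finite_act act_weight_mem])

lemma act_weight_linear:
  "act_weight (a + a') i = act_weight a i + act_weight a' i"
  "act_weight (fscale c a) i = fscale c (act_weight a i)"
  by (simp_all only: act_weight_def slice_simps wedge_linear) (simp_all add: fun_eq_iff)

lemma act0_linear:
  "act0 (a + a') r = act0 a r + act0 a' r" "act0 (fscale c a) r = fscale c (act0 a r)"
  "act0 a (r + r') = act0 a r + act0 a r'" "act0 a (fscale c r) = fscale c (act0 a r)"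
  by (rule ext, simp add: act0_finite[OF List.finite_set order_refl] act_weight_linear wedge_linear
      sum.distrib sum_apply sum_distrib_left)+

lemma graded_bilinearI:
  assumes "\<And>x x' y. f (x + x') y = f x y + f x' y" "\<And>c x y. f (fscale c x) y = fscale c (f x y)"
    "\<And>x y y'. f x (y + y') = f x y + f x y'" "\<And>c x y. f x (fscale c y) = fscale c (f x y)"
    "\<And>m n x y. x \<in> U m \<Longrightarrow> y \<in> V n \<Longrightarrow> f x y \<in> W (m + n)"
  shows "graded_bilinear fscale U fscale V fscale W f"
  using assms unfolding graded_bilinear_def linear_betw_def by simp

lemma act0_bilinear: "graded_bilinear fscale A fscale R fscale R act0"
  by (rule graded_bilinearI) (simp_all add: act0_linear act0_mem)

lemma act0_dependence:
  assumes "\<And>\<phi> ys. finite_dependence (\<lambda>u v. F u v (\<phi>, ys))" "\<And>ys. finite_dependence (\<lambda>u v. G u v ys)"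
  shows "finite_dependence (\<lambda>u v. act0 (F u v) (G u v) xs)"
  unfolding act0_finite[OF List.finite_set order_refl] sum_apply act_weight_def uminus_apply contract_def fun_Compl_def
  by (intro finite_dependence_intros assms)

lemma act0_continuous:
  "continuous_map (prod_topology (pointwise_topology (A m)) (pointwise_topology (R n)))
     (pointwise_topology (R (m + n))) (\<lambda>(a, r). act0 a r)"
  by (rule continuous_map_pointwise_joint[OF act0_mem])
    (auto intro: act0_dependence finite_dependence_left finite_dependence_right)

lemma act0_smul: "act0 (tens_smul u a) r = wedge u (act0 a r)"
proof
  fix xs
  have "wedge u (act0 a r) xs = wedge u (\<Sum>i\<in>pairs_at (set xs). wedge (act_weight a i) (contract (snd i) r)) xs"
    by (rule wedge_cong) (simp_all add: act0_finite[of "set xs"])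
  also have "\<dots> = act0 (tens_smul u a) r xs"
    unfolding act0_finite[OF List.finite_set order_refl] act_weight_def slice_smul
    by (simp only: wedge_linear wedge_assoc sum_apply)
  finally show "act0 (tens_smul u a) r xs = wedge u (act0 a r) xs" by simp
qed

definition rho0 :: "'g \<Rightarrow> ('g list \<Rightarrow> complex) \<Rightarrow> 'g list \<Rightarrow> complex"
  where "rho0 b = act0 (tens sc B ext_one b)"

lemma act0_tens: "act0 (tens sc B r b) r' = wedge r (rho0 b r')"
  using act0_smul[of r "tens sc B ext_one b" r'] by (simp add: rho0_def tens_smul_tens)

lemma coadjoint_linear:
  assumes "\<xi> \<in> R 1" shows "linear_betw sc C (*) (\<lambda>x. \<xi> [s (lie b x)])"
  by (rule linear_betwI) (auto simp: lie_simps s_add s_scale ext1_linear[OF assms])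

lemma rho0_coadjoint:
  assumes b: "b \<in> B" and \<xi>: "\<xi> \<in> R 1" and x: "x \<in> C"
  shows "rho0 b \<xi> [x] = - \<xi> [s (lie b x)]"
proof -
  have cj: "pair_coact (k, j) b = coord (s (lie b k)) j" for k j using b by (simp add: pair_coact_def coact_c_def eps_apply)
  have fin: "finite (coact_support k)" for k using coact_c_finite by (simp add: coact_support_def)
  have w: "act_weight (tens sc B ext_one b) (k, j) [x] = - (coord (s (lie b k)) j * coord x k)" for k j
    by (simp add: act_weight_def slice_tens[OF pair_coact_mem] wedge_linear cj eps_apply)
  have "rho0 b \<xi> [x] = local_sum pairs (\<lambda>i. fscale (\<xi> [snd i]) (act_weight (tens sc B ext_one b) i)) [x]"
    by (simp add: rho0_def act0_def derivation_sum_degree_1[OF \<xi>])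
  also have "\<dots> = (\<Sum>i\<in>pairs_at {x}. fscale (\<xi> [snd i]) (act_weight (tens sc B ext_one b) i)) [x]"
    by (rule local_sum_pairs) (auto simp: act_weight_vanish[of _ "{x}"])
  also have "\<dots> = (\<Sum>k\<in>supp {x}. \<Sum>j\<in>coact_support k. \<xi> [j] * - (coord (s (lie b k)) j * coord x k))"
    unfolding sum_apply by (subst sum.Sigma) (auto simp: w finite_supp fin intro!: sum.cong)
  also have "\<dots> = (\<Sum>k\<in>supp {x}. - (coord x k * (\<Sum>j\<in>coact_support k. coord (s (lie b k)) j * \<xi> [j])))"
    by (simp add: sum_negf sum_distrib_left algebra_simps)
  also have "\<dots> = (\<Sum>k\<in>supp {x}. - (coord x k * \<xi> [s (lie b k)]))"
  proof (rule sum.cong[OF refl])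
    fix k
    have "\<xi> [s (lie b k)] = (\<Sum>j\<in>coact_support k. coord (s (lie b k)) j * \<xi> [j])"
    proof (rule linear_expand[where f="\<lambda>x. \<xi> [x]"])
      show "linear_betw sc C (*) (\<lambda>x. \<xi> [x])" using ext_linear_contract[OF \<xi>, of "[]"] by simp
      show "supp {s (lie b k)} \<subseteq> coact_support k"
      proof
        fix j assume "j \<in> supp {s (lie b k)}"
        then have "coact_c (eps j) k b \<noteq> 0" "j \<in> E"
          using b supp_sub by (auto simp: coact_c_def eps_apply supp_def)
        then show "j \<in> coact_support k" by (auto simp: coact_support_def)
      qed
    qed (use fin in \<open>auto simp: coact_support_def\<close>)
    then show "- (coord x k * (\<Sum>j\<in>coact_support k. coord (s (lie b k)) j * \<xi> [j])) = - (coord x k * \<xi> [s (lie b k)])"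
      by simp
  qed
  also have "\<dots> = - \<xi> [s (lie b x)]"
    using linear_expand[OF coadjoint_linear[OF \<xi>] x finite_supp[of "{x}"] order_refl supp_sub]
    by (simp add: sum_negf)
  finally show ?thesis .
qed

end

context split_tate_lie_algebra begin

section \<open>Construction of the bracket\<close>

text \<open>The last term of the bracket, in which the second argument differentiates the form of the first.
  Putting the coefficients of \<open>a\<close> on the right absorbs the sign \<open>(-1)\<^bsup>|r||r'|\<^esup>\<close> of that term
  (\<open>right_act_eq\<close>), so that the expression is bilinear without reference to degrees.\<close>

definition right_act :: "('g list \<Rightarrow> complex) \<Rightarrow> (('g \<Rightarrow> complex) \<times> 'g list \<Rightarrow> complex) \<Rightarrow> 'g list \<Rightarrow> complex"
  where "right_act r a = local_sum pairs (\<lambda>i. wedge (wedge (eps (fst i)) (contract (snd i) r)) (slice a (pair_coact i)))"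

lemma right_act_finite:
  "right_act r a xs = (\<Sum>i\<in>pairs_at (set xs). wedge (wedge (eps (fst i)) (contract (snd i) r)) (slice a (pair_coact i))) xs"
  unfolding right_act_def
  by (rule local_sum_pairs[OF List.finite_set order_refl], unfold wedge_assoc, intro wedge_eq_0_left supp_vanish[of _ "set xs"]) auto

lemma right_act_eq:
  assumes r: "r \<in> R m" and a: "a \<in> A n"
  shows "right_act r a = - fscale (ksign m n) (act0 a r)"
proof
  fix xs
  have t: "wedge (wedge (eps (fst i)) (contract (snd i) r)) (slice a (pair_coact i))
    = - fscale (ksign m n) (wedge (act_weight a i) (contract (snd i) r))" for i
  proof -
    have "wedge (eps (fst i)) (contract (snd i) r) \<in> R m"
      using wedge_mem[OF eps_mem ext_contract[OF r]] by simp
    then have "wedge (wedge (eps (fst i)) (contract (snd i) r)) (slice a (pair_coact i))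
      = fscale (ksign m n) (wedge (slice a (pair_coact i)) (wedge (eps (fst i)) (contract (snd i) r)))"
      by (rule wedge_supercomm[OF ext_homogeneous ext_homogeneous[OF A_slice[OF a pair_coact_mem]]])
    then show ?thesis by (simp add: act_weight_def wedge_linear wedge_assoc form.scale_minus_right)
  qed
  show "right_act r a xs = (- fscale (ksign m n) (act0 a r)) xs"
    unfolding right_act_finite t by (simp add: act0_finite[OF List.finite_set order_refl] sum_apply sum_negf sum_distrib_left)
qed

definition dual_basis :: "('g \<Rightarrow> complex) set"
  where "dual_basis = (SOME P. P \<subseteq> Bdual \<and> form.independent P \<and> Bdual \<subseteq> form.span P)"

lemma dual_basis: "dual_basis \<subseteq> Bdual" "form.independent dual_basis" "Bdual \<subseteq> form.span dual_basis"
proof -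
  obtain P where "P \<subseteq> Bdual" "form.independent P" "Bdual \<subseteq> form.span P"
    by (rule form.maximal_independent_subset[of Bdual])
  then have "\<exists>P. P \<subseteq> Bdual \<and> form.independent P \<and> Bdual \<subseteq> form.span P" by blast
  from someI_ex[OF this]
  show "dual_basis \<subseteq> Bdual" "form.independent dual_basis" "Bdual \<subseteq> form.span dual_basis"
    unfolding dual_basis_def by blast+
qed

abbreviation "dcoord \<equiv> form.representation dual_basis"

definition is_factorization :: "('g \<Rightarrow> complex) \<Rightarrow> ('g \<Rightarrow> complex) set \<times> (('g \<Rightarrow> complex) \<Rightarrow> 'g \<Rightarrow> complex) \<Rightarrow> bool"
  where "is_factorization \<phi> Qp \<longleftrightarrow> (case Qp of (Q, p) \<Rightarrow> finite Q \<and> Q \<subseteq> Bdual \<and> (\<forall>q\<in>Q. p q \<in> Bdual) \<and>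
    (\<forall>b\<in>B. \<forall>b'\<in>B. \<phi> (lie b b') = (\<Sum>q\<in>Q. p q b * q b')))"

definition factorization :: "('g \<Rightarrow> complex) \<Rightarrow> ('g \<Rightarrow> complex) set \<times> (('g \<Rightarrow> complex) \<Rightarrow> 'g \<Rightarrow> complex)"
  where "factorization \<phi> = (SOME Qp. is_factorization \<phi> Qp)"

lemma factorization:
  assumes "\<phi> \<in> Bdual"
  defines "Q \<equiv> fst (factorization \<phi>)" and "p \<equiv> snd (factorization \<phi>)"
  shows "finite Q" "Q \<subseteq> Bdual" "q \<in> Q \<Longrightarrow> p q \<in> Bdual"
    "b \<in> B \<Longrightarrow> b' \<in> B \<Longrightarrow> (\<Sum>q\<in>Q. p q b * q b') = \<phi> (lie b b')"
proof -
  have "\<exists>Qp. is_factorization \<phi> Qp"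
    using bracket_finite_rank[OF assms(1)] by (simp add: is_factorization_def split_paired_Ex)
  then have "is_factorization \<phi> (factorization \<phi>)" unfolding factorization_def by (rule someI_ex)
  then have *: "finite Q \<and> Q \<subseteq> Bdual \<and> (\<forall>q\<in>Q. p q \<in> Bdual) \<and>
    (\<forall>b\<in>B. \<forall>b'\<in>B. \<phi> (lie b b') = (\<Sum>q\<in>Q. p q b * q b'))"
    by (simp add: is_factorization_def Q_def p_def case_prod_beta)
  from * show "finite Q" "Q \<subseteq> Bdual" by blast+
  from * show "q \<in> Q \<Longrightarrow> p q \<in> Bdual" by blast
  from * show "b \<in> B \<Longrightarrow> b' \<in> B \<Longrightarrow> (\<Sum>q\<in>Q. p q b * q b') = \<phi> (lie b b')" by simp
qed

text \<open>The part \<open>r r' \<otimes> [b, b']\<close> of the bracket, paired with \<open>\<psi>\<close> by means of a factorization of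
  \<open>\<psi>([b, b'])\<close>. A factorization is far from unique; it is used for \<open>\<psi>\<close> in a basis of the dual only
  and then extended linearly, so that the result is linear in the functional by definition.\<close>

definition basic_bracket where
  "basic_bracket a a' \<psi> = (\<Sum>q\<in>fst (factorization \<psi>). wedge (slice a (snd (factorization \<psi>) q)) (slice a' q))"

definition lin_bracket where
  "lin_bracket a a' \<phi> = (\<Sum>\<psi>\<in>{\<psi>. dcoord \<phi> \<psi> \<noteq> 0}. fscale (dcoord \<phi> \<psi>) (basic_bracket a a' \<psi>))"

lemma lin_bracket_eq:
  assumes "finite T" "{\<psi>. dcoord \<phi> \<psi> \<noteq> 0} \<subseteq> T"
  shows "lin_bracket a a' \<phi> = (\<Sum>\<psi>\<in>T. fscale (dcoord \<phi> \<psi>) (basic_bracket a a' \<psi>))"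
  unfolding lin_bracket_def by (rule sum.mono_neutral_left) (use assms in auto)

lemma lin_bracket_add:
  assumes "\<phi> \<in> Bdual" "\<phi>' \<in> Bdual"
  shows "lin_bracket a a' (\<phi> + \<phi>') = lin_bracket a a' \<phi> + lin_bracket a a' \<phi>'"
proof -
  let ?T = "{\<psi>. dcoord \<phi> \<psi> \<noteq> 0} \<union> {\<psi>. dcoord \<phi>' \<psi> \<noteq> 0}"
  have fin: "finite ?T" using form.finite_representation by blast
  have rep: "dcoord (\<phi> + \<phi>') \<psi> = dcoord \<phi> \<psi> + dcoord \<phi>' \<psi>" for \<psi>
    by (subst form.representation_add[OF dual_basis(2)]) (use dual_basis(3) assms in auto)
  have "lin_bracket a a' (\<phi> + \<phi>') = (\<Sum>\<psi>\<in>?T. fscale (dcoord (\<phi> + \<phi>') \<psi>) (basic_bracket a a' \<psi>))"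
    by (rule lin_bracket_eq[OF fin]) (auto simp: rep)
  also have "\<dots> = (\<Sum>\<psi>\<in>?T. fscale (dcoord \<phi> \<psi>) (basic_bracket a a' \<psi>)) + (\<Sum>\<psi>\<in>?T. fscale (dcoord \<phi>' \<psi>) (basic_bracket a a' \<psi>))"
    by (simp add: rep form.scale_left_distrib sum.distrib)
  also have "\<dots> = lin_bracket a a' \<phi> + lin_bracket a a' \<phi>'"
    by (subst (1 2) lin_bracket_eq[OF fin]) auto
  finally show ?thesis .
qed

lemma lin_bracket_scale:
  assumes "\<phi> \<in> Bdual"
  shows "lin_bracket a a' (fscale c \<phi>) = fscale c (lin_bracket a a' \<phi>)"
proof -
  let ?T = "{\<psi>. dcoord \<phi> \<psi> \<noteq> 0}"
  have fin: "finite ?T" using form.finite_representation by blast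
  have rep: "dcoord (fscale c \<phi>) \<psi> = c * dcoord \<phi> \<psi>" for \<psi>
    by (subst form.representation_scale[OF dual_basis(2)]) (use dual_basis(3) assms in auto)
  have "lin_bracket a a' (fscale c \<phi>) = (\<Sum>\<psi>\<in>?T. fscale (dcoord (fscale c \<phi>) \<psi>) (basic_bracket a a' \<psi>))"
    by (rule lin_bracket_eq[OF fin]) (auto simp: rep)
  also have "\<dots> = fscale c (lin_bracket a a' \<phi>)"
    unfolding lin_bracket_def form.scale_sum_right by (simp add: rep)
  finally show ?thesis .
qed

lemma dcoord_dual: "dcoord \<phi> \<psi> \<noteq> 0 \<Longrightarrow> \<psi> \<in> Bdual"
  using form.representation_ne_zero dual_basis(1) by blast

lemma lin_bracket_mem:
  assumes "a \<in> A m" "a' \<in> A n"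
  shows "lin_bracket a a' \<phi> \<in> R (m + n)"
  unfolding lin_bracket_def
proof (rule ext_sum)
  fix \<psi> assume "\<psi> \<in> {\<psi>. dcoord \<phi> \<psi> \<noteq> 0}"
  then have "\<psi> \<in> Bdual" using dcoord_dual by blast
  note f = factorization[OF this]
  have "basic_bracket a a' \<psi> \<in> R (m + n)"
    unfolding basic_bracket_def
    by (rule ext_sum, rule wedge_mem[OF A_slice[OF assms(1) f(3)] A_slice[OF assms(2)]]) (use f(2) in auto)
  then show "fscale (dcoord \<phi> \<psi>) (basic_bracket a a' \<psi>) \<in> R (m + n)" by (rule ext_scale)
qed

lemma lin_bracket_tens:
  assumes b: "b \<in> B" "b' \<in> B" and \<phi>: "\<phi> \<in> Bdual"
  shows "lin_bracket (tens sc B r b) (tens sc B r' b') \<phi> = fscale (\<phi> (lie b b')) (wedge r r')"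
proof -
  have bb: "basic_bracket (tens sc B r b) (tens sc B r' b') \<psi> = fscale (\<psi> (lie b b')) (wedge r r')" if "\<psi> \<in> Bdual" for \<psi>
  proof -
    note f = factorization[OF that]
    have "basic_bracket (tens sc B r b) (tens sc B r' b') \<psi>
       = (\<Sum>q\<in>fst (factorization \<psi>). fscale (snd (factorization \<psi>) q b * q b') (wedge r r'))"
      unfolding basic_bracket_def
    proof (rule sum.cong[OF refl])
      fix q assume q: "q \<in> fst (factorization \<psi>)"
      then have "q \<in> Bdual" using f(2) by blast
      then show "wedge (slice (tens sc B r b) (snd (factorization \<psi>) q)) (slice (tens sc B r' b') q)
        = fscale (snd (factorization \<psi>) q b * q b') (wedge r r')"
        by (simp only: slice_tens f(3)[OF q] wedge_linear form.scale_scale mult.commute)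
    qed
    also have "\<dots> = fscale (\<psi> (lie b b')) (wedge r r')"
      by (simp only: form.scale_sum_left[symmetric] f(4)[OF b])
    finally show ?thesis .
  qed
  have "lin_bracket (tens sc B r b) (tens sc B r' b') \<phi>
     = (\<Sum>\<psi>\<in>{\<psi>. dcoord \<phi> \<psi> \<noteq> 0}. fscale (dcoord \<phi> \<psi> * \<psi> (lie b b')) (wedge r r'))"
    unfolding lin_bracket_def by (rule sum.cong) (auto simp: bb dcoord_dual)
  also have "\<dots> = fscale (\<Sum>\<psi>\<in>{\<psi>. dcoord \<phi> \<psi> \<noteq> 0}. dcoord \<phi> \<psi> * \<psi> (lie b b')) (wedge r r')"
    by (rule form.scale_sum_left[symmetric])
  also have "(\<Sum>\<psi>\<in>{\<psi>. dcoord \<phi> \<psi> \<noteq> 0}. dcoord \<phi> \<psi> * \<psi> (lie b b')) = (\<Sum>\<psi> | dcoord \<phi> \<psi> \<noteq> 0. fscale (dcoord \<phi> \<psi>) \<psi>) (lie b b')"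
    by (simp add: sum_apply)
  also have "(\<Sum>\<psi> | dcoord \<phi> \<psi> \<noteq> 0. fscale (dcoord \<phi> \<psi>) \<psi>) = \<phi>"
    by (rule form.sum_nonzero_representation_eq[OF dual_basis(2)]) (use dual_basis(3) \<phi> in blast)
  finally show ?thesis .
qed

lemma lin_bracket_linear:
  "lin_bracket (a + c) a' \<phi> = lin_bracket a a' \<phi> + lin_bracket c a' \<phi>"
  "lin_bracket (fscale k a) a' \<phi> = fscale k (lin_bracket a a' \<phi>)"
  "lin_bracket a (a' + c) \<phi> = lin_bracket a a' \<phi> + lin_bracket a c \<phi>"
  "lin_bracket a (fscale k a') \<phi> = fscale k (lin_bracket a a' \<phi>)"
  unfolding lin_bracket_def basic_bracket_def slice_simps wedge_linear
  by (simp_all only: sum.distrib form.scale_right_distrib form.scale_sum_right form.scale_left_commute)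

text \<open>Functions on functionals are extended by zero, as the elements of the completed tensor product are.\<close>

definition on_dual :: "(('g \<Rightarrow> complex) \<Rightarrow> 'g list \<Rightarrow> complex) \<Rightarrow> ('g \<Rightarrow> complex) \<times> 'g list \<Rightarrow> complex"
  where "on_dual F = (\<lambda>(\<phi>, xs). if \<phi> \<in> Bdual then F \<phi> xs else 0)"

lemma on_dual_apply: "\<phi> \<in> Bdual \<Longrightarrow> on_dual F (\<phi>, xs) = F \<phi> xs"
  by (simp add: on_dual_def)

lemma slice_on_dual: "\<phi> \<in> Bdual \<Longrightarrow> slice (on_dual F) \<phi> = F \<phi>"
  and on_dual_outside: "\<phi> \<notin> Bdual \<Longrightarrow> on_dual F (\<phi>, xs) = 0"
  by (simp_all add: on_dual_def)

lemma on_dual_mem: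
  assumes "\<And>\<phi> \<psi>. \<phi> \<in> Bdual \<Longrightarrow> \<psi> \<in> Bdual \<Longrightarrow> F (\<phi> + \<psi>) = F \<phi> + F \<psi>"
    "\<And>\<phi> c. \<phi> \<in> Bdual \<Longrightarrow> F (fscale c \<phi>) = fscale c (F \<phi>)" "\<And>\<phi>. \<phi> \<in> Bdual \<Longrightarrow> F \<phi> \<in> R n"
  shows "on_dual F \<in> A n"
proof (rule AI, goal_cases)
  case 1 then show ?case by (rule on_dual_outside)
next
  case 2 then show ?case by (simp only: slice_on_dual dual_add assms(1))
next
  case 3 then show ?case by (simp only: slice_on_dual dual_scale assms(2))
next
  case 4 then show ?case by (simp only: slice_on_dual assms(3))
qed

lemma on_dual_eqI:
  assumes "f \<in> A n" "\<And>\<phi>. \<phi> \<in> Bdual \<Longrightarrow> F \<phi> = slice f \<phi>"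
  shows "on_dual F = f"
proof (rule ext)
  fix p :: "('g \<Rightarrow> complex) \<times> 'g list"
  obtain \<phi> xs where p: "p = (\<phi>, xs)" by fastforce
  show "on_dual F p = f p"
    by (cases "\<phi> \<in> Bdual") (simp_all add: p on_dual_def assms A_outside[OF assms(1)])
qed

lemma on_dual_dependence:
  assumes "\<And>\<phi> xs. finite_dependence (\<lambda>u v. F u v \<phi> xs)"
  shows "finite_dependence (\<lambda>u v. on_dual (F u v) y)"
  by (cases y; cases "fst y \<in> Bdual") (simp_all add: on_dual_def assms finite_dependence_const)

lemma on_dual_add: "on_dual (\<lambda>\<phi>. F \<phi> + G \<phi>) = on_dual F + on_dual G"
  and on_dual_scale: "on_dual (\<lambda>\<phi>. fscale c (F \<phi>)) = fscale c (on_dual F)"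
  by (auto simp: on_dual_def fun_eq_iff)

definition br0 where
  "br0 a a' = on_dual (\<lambda>\<phi>. lin_bracket a a' \<phi> + act0 a (slice a' \<phi>) + right_act (slice a \<phi>) a')"

lemma right_act_linear:
  "right_act (r + r') a = right_act r a + right_act r' a" "right_act (fscale c r) a = fscale c (right_act r a)"
  "right_act r (a + a') = right_act r a + right_act r a'" "right_act r (fscale c a) = fscale c (right_act r a)"
proof -
  show "right_act (r + r') a = right_act r a + right_act r' a"
    by (rule ext, subst plus_fun_apply, simp only: right_act_finite contract_simps wedge_linear sum.distrib,
        simp only: plus_fun_apply)
  show "right_act (fscale c r) a = fscale c (right_act r a)"
    by (rule ext, subst fscale_apply, simp only: right_act_finite contract_simps wedge_linear
        form.scale_sum_right[symmetric], simp only: fscale_apply)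
  show "right_act r (a + a') = right_act r a + right_act r a'"
    by (rule ext, subst plus_fun_apply, simp only: right_act_finite slice_simps wedge_linear sum.distrib,
        simp only: plus_fun_apply)
  show "right_act r (fscale c a) = fscale c (right_act r a)"
    by (rule ext, subst fscale_apply, simp only: right_act_finite slice_simps wedge_linear
        form.scale_sum_right[symmetric], simp only: fscale_apply)
qed

lemma right_act_mem: "r \<in> R m \<Longrightarrow> a \<in> A n \<Longrightarrow> right_act r a \<in> R (m + n)"
  using act0_mem[of a n r m] by (simp add: right_act_eq ext_minus ext_scale add.commute)

lemma br0_mem:
  assumes "a \<in> A m" "a' \<in> A n"
  shows "br0 a a' \<in> A (m + n)"
  unfolding br0_def
proof (rule on_dual_mem)
  fix \<phi> \<psi> c assume \<phi>: "\<phi> \<in> Bdual"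
  show "lin_bracket a a' (fscale c \<phi>) + act0 a (slice a' (fscale c \<phi>)) + right_act (slice a (fscale c \<phi>)) a'
    = fscale c (lin_bracket a a' \<phi> + act0 a (slice a' \<phi>) + right_act (slice a \<phi>) a')"
    by (simp only: lin_bracket_scale[OF \<phi>] A_slice_scale[OF assms(1) \<phi>] A_slice_scale[OF assms(2) \<phi>]
        act0_linear right_act_linear form.scale_right_distrib)
  show "lin_bracket a a' \<phi> + act0 a (slice a' \<phi>) + right_act (slice a \<phi>) a' \<in> R (m + n)"
    by (intro ext_add lin_bracket_mem act0_mem right_act_mem A_slice[OF _ \<phi>] assms)
  assume \<psi>: "\<psi> \<in> Bdual"
  show "lin_bracket a a' (\<phi> + \<psi>) + act0 a (slice a' (\<phi> + \<psi>)) + right_act (slice a (\<phi> + \<psi>)) a'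
    = lin_bracket a a' \<phi> + act0 a (slice a' \<phi>) + right_act (slice a \<phi>) a'
    + (lin_bracket a a' \<psi> + act0 a (slice a' \<psi>) + right_act (slice a \<psi>) a')"
    by (simp only: lin_bracket_add[OF \<phi> \<psi>] A_slice_add[OF assms(1) \<phi> \<psi>] A_slice_add[OF assms(2) \<phi> \<psi>]
        act0_linear right_act_linear add_ac)
qed

lemma br0_bilinear: "graded_bilinear fscale A fscale A fscale A br0"
proof (rule graded_bilinearI)
  show "br0 (a + c) a' = br0 a a' + br0 c a'" "br0 a' (a + c) = br0 a' a + br0 a' c" for a a' c
    unfolding br0_def on_dual_add[symmetric]
    by (simp_all only: slice_simps lin_bracket_linear act0_linear right_act_linear add_ac)
  show "br0 (fscale k a) a' = fscale k (br0 a a')" "br0 a' (fscale k a) = fscale k (br0 a' a)" for a a' k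
    unfolding br0_def on_dual_scale[symmetric]
    by (simp_all only: slice_simps lin_bracket_linear act0_linear right_act_linear form.scale_right_distrib)
qed (rule br0_mem)

lemma br0_dependence: "finite_dependence (\<lambda>a a'. br0 a a' y)"
  unfolding br0_def
proof (rule on_dual_dependence)
  fix \<phi> xs
  have 1: "finite_dependence (\<lambda>a a'. lin_bracket a a' \<phi> xs)"
    unfolding lin_bracket_def basic_bracket_def sum_apply fscale_apply
    by (intro finite_dependence_intros finite_dependence_left finite_dependence_right)
  have 2: "finite_dependence (\<lambda>a a'. act0 a (slice a' \<phi>) xs)"
    by (rule act0_dependence[OF finite_dependence_left finite_dependence_right])
  have 3: "finite_dependence (\<lambda>a a'. right_act (slice a \<phi>) a' xs)"
    unfolding right_act_finite sum_apply contract_def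
    by (intro finite_dependence_intros finite_dependence_left finite_dependence_right)
  show "finite_dependence (\<lambda>a a'. (lin_bracket a a' \<phi> + act0 a (slice a' \<phi>) + right_act (slice a \<phi>) a') xs)"
    unfolding plus_fun_apply by (intro finite_dependence_add 1 2 3)
qed

lemma br0_continuous:
  "continuous_map (prod_topology (pointwise_topology (A m)) (pointwise_topology (A n)))
     (pointwise_topology (A (m + n))) (\<lambda>(a, a'). br0 a a')"
  by (rule continuous_map_pointwise_joint[OF br0_mem br0_dependence])

lemma br0_tens:
  assumes r: "r \<in> R m" and b: "b \<in> B" and r': "r' \<in> R n" and b': "b' \<in> B"
  shows "br0 (tens sc B r b) (tens sc B r' b') =
    tens sc B (wedge r r') (lie b b') + tens sc B (wedge r (rho0 b r')) b'
    - fscale (ksign m n) (tens sc B (wedge r' (rho0 b' r)) b)" (is "_ = ?rhs")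
  unfolding br0_def
proof (rule on_dual_eqI)
  have rho: "rho0 b r \<in> R k" if "b \<in> B" "r \<in> R k" for b r k
    using act0_mem[OF tens_mem[OF ext_one_mem that(1)] that(2)] by (simp add: rho0_def)
  show "?rhs \<in> A (m + n)"
    using tens_mem[OF wedge_mem[OF r r'] lie_B[OF b b']] tens_mem[OF wedge_mem[OF r rho[OF b r']] b']
      tens_mem[OF wedge_mem[OF r' rho[OF b' r]] b]
    by (intro A_diff A_add A_scale) (simp_all add: add.commute)
  fix \<phi> assume \<phi>: "\<phi> \<in> Bdual"
  have "right_act (slice (tens sc B r b) \<phi>) (tens sc B r' b') = fscale (\<phi> b) (- fscale (ksign m n) (wedge r' (rho0 b' r)))"
    unfolding slice_tens[OF \<phi>] right_act_linear right_act_eq[OF r tens_mem[OF r' b']] act0_tens ..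
  then show "lin_bracket (tens sc B r b) (tens sc B r' b') \<phi> + act0 (tens sc B r b) (slice (tens sc B r' b') \<phi>)
      + right_act (slice (tens sc B r b) \<phi>) (tens sc B r' b') = slice ?rhs \<phi>"
    unfolding slice_simps slice_tens[OF \<phi>] lin_bracket_tens[OF b b' \<phi>] act0_linear act0_tens
    by (simp add: form.scale_minus_right mult.commute)
qed

section \<open>Construction of the differentials and the curvature\<close>

lemma bracket_C_linear:
  assumes "\<xi> \<in> R 1"
  shows "linear_betw sc C (*) (\<lambda>x. k * \<xi> [s (lie x y)])" "linear_betw sc C (*) (\<lambda>y. k * \<xi> [s (lie x y)])"
  by (rule linear_betwI; auto simp: lie_simps s_add s_scale ext1_linear[OF assms] algebra_simps)+

lemma dual_bpart_linear:
  assumes "\<phi> \<in> Bdual"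
  shows "\<phi> (bpart (x + y)) = \<phi> (bpart x) + \<phi> (bpart y)" "\<phi> (bpart (sc c x)) = c * \<phi> (bpart x)"
    "\<phi> (bpart (- x)) = - \<phi> (bpart x)" "\<phi> (bpart 0) = 0"
proof -
  note lin = linear_betwD[OF dual_linear[OF assms]]
  have a: "bpart (x + y) = bpart x + bpart y" for x y by (simp add: s_add)
  have m: "bpart (sc c x) = sc c (bpart x)" for x c by (simp add: s_scale scale_right_diff_distrib)
  show "\<phi> (bpart (x + y)) = \<phi> (bpart x) + \<phi> (bpart y)"
    by (simp only: a lin(1)[OF bpart_B bpart_B])
  have sc: "\<phi> (bpart (sc c x)) = c * \<phi> (bpart x)" for c x
    by (simp only: m lin(2)[OF bpart_B])
  show "\<phi> (bpart (sc c x)) = c * \<phi> (bpart x)" by (rule sc)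
  from sc[of "-1" x] show "\<phi> (bpart (- x)) = - \<phi> (bpart x)" by simp
  from sc[of 0 x] show "\<phi> (bpart 0) = 0" by simp
qed

lemma bracket_B_linear:
  assumes "\<phi> \<in> Bdual"
  shows "linear_betw sc C (*) (\<lambda>x. k * \<phi> (bpart (lie x y)))" "linear_betw sc C (*) (\<lambda>y. k * \<phi> (bpart (lie x y)))"
  by (rule linear_betwI; simp add: lie_add_left lie_add_right lie_scale_left lie_scale_right
      dual_bpart_linear[OF assms] distrib_left)+

text \<open>The Chevalley-Eilenberg differential of a one-form.\<close>

definition d_one :: "('g list \<Rightarrow> complex) \<Rightarrow> 'g list \<Rightarrow> complex"
  where "d_one \<xi> = two_form (\<lambda>x y. (- 1) * \<xi> [s (lie x y)])"

lemma d_one_mem: "\<xi> \<in> R 1 \<Longrightarrow> d_one \<xi> \<in> R 2"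
  unfolding d_one_def
  by (rule two_formI[OF bracket_C_linear(1) bracket_C_linear(2)]) (simp_all add: lie_self s_zero ext1_linear)

definition dR0 :: "('g list \<Rightarrow> complex) \<Rightarrow> 'g list \<Rightarrow> complex"
  where "dR0 = derivation_sum E (\<lambda>j. d_one (eps j)) (\<lambda>j. j)"

lemma d_one_eps_vanish:
  assumes "j \<notin> supp ((\<lambda>(x, y). s (lie x y)) ` (X \<times> X))" "set ys \<subseteq> X"
  shows "d_one (eps j) ys = 0"
proof (rule ccontr)
  assume nz: "d_one (eps j) ys \<noteq> 0"
  then obtain x y where ys: "ys = [x, y]" "x \<in> C" "y \<in> C" unfolding d_one_def by (rule two_form_cases)
  then have "coord (s (lie x y)) j \<noteq> 0" using nz by (simp add: d_one_def two_form_apply eps_apply)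
  then show False using assms ys by (force simp: supp_def)
qed

abbreviation dsupp :: "'g set \<Rightarrow> 'g set"
  where "dsupp X \<equiv> supp ((\<lambda>(x, y). s (lie x y)) ` (X \<times> X))"

lemma locally_finite_d_one: "locally_finite E (\<lambda>j. d_one (eps j))"
  unfolding locally_finite_def
proof (intro allI impI)
  fix X :: "'g set" assume X: "finite X"
  have "{j\<in>E. \<exists>ys. set ys \<subseteq> X \<and> d_one (eps j) ys \<noteq> 0} \<subseteq> dsupp X"
    using d_one_eps_vanish by blast
  moreover have "finite (dsupp X)" using X by (intro finite_supp finite_imageI) simp
  ultimately show "finite {j\<in>E. \<exists>ys. set ys \<subseteq> X \<and> d_one (eps j) ys \<noteq> 0}" using finite_subset by blast
qed

lemma dR0_finite: "dR0 r xs = (\<Sum>j\<in>dsupp (set xs). wedge (d_one (eps j)) (contract j r)) xs"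
  unfolding dR0_def derivation_sum_def
proof (rule local_sum_eq)
  show "finite (dsupp (set xs))" by (intro finite_supp finite_imageI) simp
  show "dsupp (set xs) \<subseteq> E" by (rule supp_sub)
  show "wedge (d_one (eps j)) (contract j r) xs = 0" if "j \<notin> dsupp (set xs)" for j
    using d_one_eps_vanish[OF that] by (intro wedge_eq_0_left)
qed

lemma d_one_eps_mem: "d_one (eps j) \<in> R (1 + 1)"
  using d_one_mem[OF eps_mem] by simp

lemma dR0_superderivation: "superderivation fscale R wedge 1 dR0"
  unfolding dR0_def by (rule derivation_sum_superderivation[OF locally_finite_d_one d_one_eps_mem])

lemma dR0_mem: "r \<in> R n \<Longrightarrow> dR0 r \<in> R (n + 1)"
  unfolding dR0_def by (rule derivation_sum_mem[OF locally_finite_d_one d_one_eps_mem])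

lemma dR0_linear: "dR0 (r + r') = dR0 r + dR0 r'" "dR0 (fscale c r) = fscale c (dR0 r)"
  unfolding dR0_def by (simp_all only: derivation_sum_add[OF locally_finite_d_one] derivation_sum_scale[OF locally_finite_d_one])

lemma dR0_dependence:
  "(\<And>ys. finite_dependence (\<lambda>u v. F u v ys)) \<Longrightarrow> finite_dependence (\<lambda>u v. dR0 (F u v) xs)"
  unfolding dR0_finite sum_apply contract_def by (intro finite_dependence_intros)

lemma dR0_continuous: "continuous_map (pointwise_topology (R n)) (pointwise_topology (R (n + 1))) dR0"
  by (rule continuous_map_pointwise[OF dR0_mem dR0_dependence[OF finite_dependence_left]])

lemma dR0_one_form:
  assumes "\<xi> \<in> R 1"
  shows "dR0 \<xi> = d_one \<xi>"
proof
  fix xs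
  show "dR0 \<xi> xs = d_one \<xi> xs"
  proof (cases "\<exists>x y. xs = [x, y] \<and> x \<in> C \<and> y \<in> C")
    case True
    then obtain x y where xs: "xs = [x, y]" "x \<in> C" "y \<in> C" by blast
    have c: "contract j \<xi> = fscale (\<xi> [j]) ext_one" for j
      using ext_degree_0[of "contract j \<xi>"] ext_contract[OF assms, of j] by (simp add: contract_def)
    let ?z = "s (lie x y)"
    have T: "finite (dsupp (set xs))" "dsupp (set xs) \<subseteq> E" "supp {?z} \<subseteq> dsupp (set xs)"
      using supp_sub by (auto intro!: finite_supp) (auto simp: supp_def xs)
    have "dR0 \<xi> xs = (\<Sum>j\<in>dsupp (set xs). \<xi> [j] * d_one (eps j) xs)"
      by (simp add: dR0_finite sum_apply c wedge_linear)
    also have "\<dots> = - (\<Sum>j\<in>dsupp (set xs). coord ?z j * \<xi> [j])"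
      by (simp add: d_one_def xs two_form_apply eps_apply sum_negf mult.commute)
    also have "\<dots> = - \<xi> [?z]"
      using linear_expand[OF ext_linear_contract[OF assms, of "[]"] _ T(1,3,2)] by simp
    finally show ?thesis by (simp add: d_one_def xs two_form_apply)
  next
    case False
    then have bad: "int (length xs) \<noteq> 2 \<or> \<not> set xs \<subseteq> C"
      by (cases xs rule: list.exhaust; cases "tl xs" rule: list.exhaust; cases "tl (tl xs)" rule: list.exhaust) auto
    show ?thesis
      using ext_eq_0[OF d_one_mem[OF assms] bad] ext_eq_0[OF _ bad, of "dR0 \<xi>"] dR0_mem[OF assms] by simp
  qed
qed

lemma dR0_generators:
  assumes "\<xi> \<in> R 1"
  shows "limitin (pointwise_topology (R 2))
    (\<lambda>F. \<Sum>(i, j)\<in>F. fscale (- 1 / 2 * \<xi> [s (lie i j)]) (wedge (eps i) (eps j)))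
    (dR0 \<xi>) (finite_subsets_at_top (E \<times> E))"
proof (rule limitin_pointwiseI)
  show mem: "dR0 \<xi> \<in> R 2" using dR0_mem[OF assms] by simp
  have ww: "wedge (eps i) (eps j) \<in> R 2" for i j using wedge_mem[OF eps_mem eps_mem] by simp
  show "eventually (\<lambda>F. (\<Sum>(i, j)\<in>F. fscale (- 1 / 2 * \<xi> [s (lie i j)]) (wedge (eps i) (eps j))) \<in> R 2)
      (finite_subsets_at_top (E \<times> E))"
    by (rule always_eventually, rule allI, rule ext_sum, simp only: case_prod_beta, rule ext_scale[OF ww])
  fix xs
  have "eventually (\<lambda>F. (\<Sum>(i, j)\<in>F. (- 1 / 2 * \<xi> [s (lie i j)]) * wedge (eps i) (eps j) xs) = dR0 \<xi> xs)
      (finite_subsets_at_top (E \<times> E))"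
  proof (rule eventually_sum_eps_eps[OF bracket_C_linear(1)[OF assms] bracket_C_linear(2)[OF assms] mem])
    fix x y assume "x \<in> C" "y \<in> C"
    moreover have "\<xi> [s (lie y x)] = - \<xi> [s (lie x y)]"
      using lie_antisym[of y x] ext1_linear(2)[OF assms, of "s (lie x y)" "-1"] by (simp add: s_minus)
    ultimately show "dR0 \<xi> [x, y] = - 1 / 2 * \<xi> [s (lie x y)] - - 1 / 2 * \<xi> [s (lie y x)]"
      by (simp add: dR0_one_form[OF assms] d_one_def two_form_apply)
  qed
  then show "eventually (\<lambda>F. (\<Sum>(i, j)\<in>F. fscale (- 1 / 2 * \<xi> [s (lie i j)]) (wedge (eps i) (eps j))) xs = dR0 \<xi> xs)
      (finite_subsets_at_top (E \<times> E))"
    by (simp add: sum_apply case_prod_beta)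
qed

text \<open>The contribution of \<open>b \<mapsto> \<Sum>\<^sub>j \<epsilon>\<^sup>j \<otimes> [e\<^sub>j, b]\<close>. With \<open>\<epsilon>\<^sup>j\<close> on the left of the form there is no
  degree-dependent sign: moving it to the right of \<open>r\<close> produces the sign in \<open>d\<^sub>A(r \<otimes> b)\<close>.\<close>

definition d_coeff where "d_coeff f \<phi> = local_sum E (\<lambda>j. wedge (eps j) (slice f (coact_b \<phi> j)))"

lemma d_coeff_finite: "d_coeff f \<phi> xs = (\<Sum>j\<in>supp (set xs). wedge (eps j) (slice f (coact_b \<phi> j))) xs"
  unfolding d_coeff_def by (rule local_sum_eps_wedge) simp_all

lemma d_coeff_mem:
  assumes "f \<in> A n" "\<phi> \<in> Bdual"
  shows "d_coeff f \<phi> \<in> R (n + 1)"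
  unfolding d_coeff_def
proof (rule local_sum_mem[OF locally_finite_wedge[OF locally_finite_eps]])
  fix j
  show "wedge (eps j) (slice f (coact_b \<phi> j)) \<in> R (n + 1)"
    using wedge_mem[OF eps_mem A_slice[OF assms(1) coact_b_mem[OF assms(2)]]] by (simp add: add.commute)
qed

lemma d_coeff_linear:
  "d_coeff (f + g) \<phi> = d_coeff f \<phi> + d_coeff g \<phi>" "d_coeff (fscale c f) \<phi> = fscale c (d_coeff f \<phi>)"
proof -
  show "d_coeff (f + g) \<phi> = d_coeff f \<phi> + d_coeff g \<phi>"
    by (rule ext, subst plus_fun_apply, simp only: d_coeff_finite slice_simps wedge_linear sum.distrib,
        simp only: plus_fun_apply)
  show "d_coeff (fscale c f) \<phi> = fscale c (d_coeff f \<phi>)"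
    by (rule ext, subst fscale_apply, simp only: d_coeff_finite slice_simps wedge_linear
        form.scale_sum_right[symmetric], simp only: fscale_apply)
qed

lemma d_coeff_dual:
  assumes "f \<in> A n" "\<phi> \<in> Bdual"
  shows "\<psi> \<in> Bdual \<Longrightarrow> d_coeff f (\<phi> + \<psi>) = d_coeff f \<phi> + d_coeff f \<psi>"
    "d_coeff f (fscale c \<phi>) = fscale c (d_coeff f \<phi>)"
proof -
  show "d_coeff f (\<phi> + \<psi>) = d_coeff f \<phi> + d_coeff f \<psi>" if \<psi>: "\<psi> \<in> Bdual"
    by (rule ext, subst plus_fun_apply, simp only: d_coeff_finite coact_b_add[OF assms(2) \<psi>]
        A_slice_add[OF assms(1) coact_b_mem[OF assms(2)] coact_b_mem[OF \<psi>]] wedge_linear sum.distrib,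
        simp only: plus_fun_apply)
  show "d_coeff f (fscale c \<phi>) = fscale c (d_coeff f \<phi>)"
    by (rule ext, subst fscale_apply, simp only: d_coeff_finite coact_b_scale
        A_slice_scale[OF assms(1) coact_b_mem[OF assms(2)]] wedge_linear form.scale_sum_right[symmetric],
        simp only: fscale_apply)
qed

definition dA0 where "dA0 f = on_dual (\<lambda>\<phi>. dR0 (slice f \<phi>) + d_coeff f \<phi>)"

lemma dA0_mem:
  assumes "f \<in> A n" shows "dA0 f \<in> A (n + 1)"
  unfolding dA0_def
proof (rule on_dual_mem)
  fix \<phi> \<psi> c assume \<phi>: "\<phi> \<in> Bdual"
  show "dR0 (slice f \<phi>) + d_coeff f \<phi> \<in> R (n + 1)"
    by (intro ext_add dR0_mem d_coeff_mem A_slice assms \<phi>)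
  show "dR0 (slice f (fscale c \<phi>)) + d_coeff f (fscale c \<phi>) = fscale c (dR0 (slice f \<phi>) + d_coeff f \<phi>)"
    by (simp only: A_slice_scale[OF assms \<phi>] dR0_linear d_coeff_dual[OF assms \<phi>] form.scale_right_distrib)
  assume \<psi>: "\<psi> \<in> Bdual"
  show "dR0 (slice f (\<phi> + \<psi>)) + d_coeff f (\<phi> + \<psi>) = dR0 (slice f \<phi>) + d_coeff f \<phi> + (dR0 (slice f \<psi>) + d_coeff f \<psi>)"
    by (simp only: A_slice_add[OF assms \<phi> \<psi>] dR0_linear d_coeff_dual[OF assms \<phi>] \<psi> add_ac)
qed

lemma dA0_linear: "dA0 (f + g) = dA0 f + dA0 g" "dA0 (fscale c f) = fscale c (dA0 f)"
  unfolding dA0_def on_dual_add[symmetric] on_dual_scale[symmetric]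
  by (simp_all only: slice_simps dR0_linear d_coeff_linear form.scale_right_distrib add_ac)

lemma dA0_graded: "graded_linear fscale A fscale A 1 dA0"
  unfolding graded_linear_def linear_betw_def using dA0_mem by (auto simp: dA0_linear)

lemma dA0_continuous: "continuous_map (pointwise_topology (A n)) (pointwise_topology (A (n + 1))) dA0"
proof (rule continuous_map_pointwise[OF dA0_mem])
  fix y
  show "finite_dependence (\<lambda>u (v :: unit \<Rightarrow> complex). dA0 u y)"
    unfolding dA0_def
  proof (rule on_dual_dependence)
    fix \<phi> xs
    have 1: "finite_dependence (\<lambda>f (v :: unit \<Rightarrow> complex). dR0 (slice f \<phi>) xs)"
      by (rule dR0_dependence[OF finite_dependence_left])
    have 2: "finite_dependence (\<lambda>f (v :: unit \<Rightarrow> complex). d_coeff f \<phi> xs)"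
      unfolding d_coeff_finite sum_apply by (intro finite_dependence_intros finite_dependence_left)
    show "finite_dependence (\<lambda>f (v :: unit \<Rightarrow> complex). (dR0 (slice f \<phi>) + d_coeff f \<phi>) xs)"
      unfolding plus_fun_apply by (rule finite_dependence_add[OF 1 2])
  qed
qed

lemma dR0_one: "dR0 ext_one = 0"
proof
  fix xs
  have "contract j ext_one = 0" for j :: 'g by (auto simp: contract_def ext_one_def fun_eq_iff)
  then show "dR0 ext_one xs = 0 xs" by (simp add: dR0_finite sum_apply wedge_linear)
qed

lemma dA0_unit:
  assumes b: "b \<in> B" and \<phi>: "\<phi> \<in> Bdual"
  shows "slice (dA0 (tens sc B ext_one b)) \<phi> xs = (\<Sum>j\<in>supp (set xs). coact_b \<phi> j b * eps j xs)"
  unfolding dA0_def on_dual_apply[OF \<phi>]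
  by (simp add: d_coeff_finite slice_tens[OF \<phi>] slice_tens[OF coact_b_mem[OF \<phi>]] dR0_linear dR0_one
      wedge_linear sum_apply)

lemma dA0_tens:
  assumes r: "r \<in> R m" and b: "b \<in> B"
  shows "dA0 (tens sc B r b) =
    tens sc B (dR0 r) b + fscale (ksign 1 m) (tens_smul r (dA0 (tens sc B ext_one b)))" (is "_ = ?rhs")
  unfolding dA0_def[of "tens sc B r b"]
proof (rule on_dual_eqI)
  have "dA0 (tens sc B ext_one b) \<in> A 1" using dA0_mem[OF tens_mem[OF ext_one_mem b]] by simp
  then show "?rhs \<in> A (m + 1)" by (intro A_add A_scale tens_mem dR0_mem smul_mem r b)
  fix \<phi> assume \<phi>: "\<phi> \<in> Bdual"
  have "d_coeff (tens sc B r b) \<phi> = fscale (ksign 1 m) (wedge r (slice (dA0 (tens sc B ext_one b)) \<phi>))"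
  proof
    fix xs
    have sw: "wedge (eps j) r = fscale (ksign 1 m) (wedge r (eps j))" for j
      by (rule wedge_supercomm[OF ext_homogeneous[OF eps_mem] ext_homogeneous[OF r]])
    have "wedge r (slice (dA0 (tens sc B ext_one b)) \<phi>) xs
      = wedge r (\<Sum>j\<in>supp (set xs). fscale (coact_b \<phi> j b) (eps j)) xs"
    proof (rule wedge_cong)
      fix ys assume ys: "set ys \<subseteq> set xs"
      have "(\<Sum>j\<in>supp (set ys). coact_b \<phi> j b * eps j ys) = (\<Sum>j\<in>supp (set xs). coact_b \<phi> j b * eps j ys)"
      proof (rule sum.mono_neutral_left)
        show "finite (supp (set xs))" by (simp add: finite_supp)
        show "supp (set ys) \<subseteq> supp (set xs)" using ys by (auto simp: supp_def)
        show "\<forall>j\<in>supp (set xs) - supp (set ys). coact_b \<phi> j b * eps j ys = 0"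
          using supp_vanish[OF order_refl, of _ ys] by auto
      qed
      then show "slice (dA0 (tens sc B ext_one b)) \<phi> ys = (\<Sum>j\<in>supp (set xs). fscale (coact_b \<phi> j b) (eps j)) ys"
        by (simp add: dA0_unit[OF b \<phi>] sum_apply)
    qed simp
    then show "d_coeff (tens sc B r b) \<phi> xs = (fscale (ksign 1 m) (wedge r (slice (dA0 (tens sc B ext_one b)) \<phi>))) xs"
      by (simp add: d_coeff_finite slice_tens[OF coact_b_mem[OF \<phi>]] wedge_linear sw sum_apply sum_distrib_left algebra_simps)
  qed
  then show "dR0 (slice (tens sc B r b) \<phi>) + d_coeff (tens sc B r b) \<phi> = slice ?rhs \<phi>"
    by (simp only: slice_simps slice_tens[OF \<phi>] dR0_linear slice_smul)
qed

lemma dA0_generators: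
  assumes b: "b \<in> B"
  shows "limitin (pointwise_topology (A 1)) (\<lambda>F. \<Sum>j\<in>F. tens sc B (eps j) (bpart (lie j b)))
    (dA0 (tens sc B ext_one b)) (finite_subsets_at_top E)"
proof (rule limitin_pointwiseI)
  show mem: "dA0 (tens sc B ext_one b) \<in> A 1" using dA0_mem[OF tens_mem[OF ext_one_mem b]] by simp
  show "eventually (\<lambda>F. (\<Sum>j\<in>F. tens sc B (eps j) (bpart (lie j b))) \<in> A 1) (finite_subsets_at_top E)"
    by (rule always_eventually, rule allI, rule A_sum, rule tens_mem[OF eps_mem bpart_B])
  fix y :: "('g \<Rightarrow> complex) \<times> 'g list"
  obtain \<phi> xs where y: "y = (\<phi>, xs)" by fastforce
  show "eventually (\<lambda>F. (\<Sum>j\<in>F. tens sc B (eps j) (bpart (lie j b))) y = dA0 (tens sc B ext_one b) y) (finite_subsets_at_top E)"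
  proof (cases "\<phi> \<in> Bdual")
    case False
    then show ?thesis by (simp add: y sum_apply tens_apply A_outside[OF mem])
  next
    case True
    have "(\<Sum>j\<in>F. tens sc B (eps j) (bpart (lie j b))) y = dA0 (tens sc B ext_one b) y"
      if F: "finite F" "supp (set xs) \<subseteq> F" for F
    proof -
      have "(\<Sum>j\<in>F. tens sc B (eps j) (bpart (lie j b))) y = (\<Sum>j\<in>F. coact_b \<phi> j b * eps j xs)"
        using b by (simp add: y sum_apply tens_apply True coact_b_def mult.commute)
      also have "\<dots> = (\<Sum>j\<in>supp (set xs). coact_b \<phi> j b * eps j xs)"
        by (rule sum.mono_neutral_right[OF F]) (use supp_vanish[OF order_refl, of _ xs] in auto)
      finally show ?thesis using dA0_unit[OF b True, of xs] by (simp add: y)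
    qed
    then show ?thesis unfolding eventually_finite_subsets_at_top
      using finite_supp[of "set xs"] supp_sub by (intro exI[of _ "supp (set xs)"]) auto
  qed
qed

definition h0 where "h0 = on_dual (\<lambda>\<phi>. two_form (\<lambda>x y. \<phi> (bpart (lie x y))))"

lemma h0_mem: "h0 \<in> A 2"
  unfolding h0_def
proof (rule on_dual_mem)
  fix \<phi> \<psi> c assume \<phi>: "\<phi> \<in> Bdual"
  show "two_form (\<lambda>x y. \<phi> (bpart (lie x y))) \<in> R 2"
    using bracket_B_linear[OF \<phi>, of 1] dual_bpart_linear(4)[OF \<phi>]
    by (intro two_formI) (simp_all add: lie_self)
qed (auto simp: two_form_def fun_eq_iff split: list.splits)

lemma h0_limit:
  "limitin (pointwise_topology (A 2))
     (\<lambda>F. \<Sum>(i, j)\<in>F. fscale (1 / 2) (tens sc B (wedge (eps i) (eps j)) (bpart (lie i j))))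
     h0 (finite_subsets_at_top (E \<times> E))"
proof (rule limitin_pointwiseI[OF h0_mem])
  have ww: "wedge (eps i) (eps j) \<in> R 2" for i j using wedge_mem[OF eps_mem eps_mem] by simp
  show "eventually (\<lambda>F. (\<Sum>(i, j)\<in>F. fscale (1 / 2) (tens sc B (wedge (eps i) (eps j)) (bpart (lie i j)))) \<in> A 2)
      (finite_subsets_at_top (E \<times> E))"
    by (rule always_eventually, rule allI, rule A_sum, simp only: case_prod_beta,
        rule A_scale[OF tens_mem[OF ww bpart_B]])
  fix p :: "('g \<Rightarrow> complex) \<times> 'g list"
  obtain \<phi> xs where p: "p = (\<phi>, xs)" by fastforce
  show "eventually (\<lambda>F. (\<Sum>(i, j)\<in>F. fscale (1 / 2) (tens sc B (wedge (eps i) (eps j)) (bpart (lie i j)))) p = h0 p)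
      (finite_subsets_at_top (E \<times> E))"
  proof (cases "\<phi> \<in> Bdual")
    case False
    then show ?thesis by (simp add: p sum_apply tens_apply A_outside[OF h0_mem] case_prod_beta)
  next
    case True
    have "eventually (\<lambda>F. (\<Sum>(i, j)\<in>F. (1 / 2 * \<phi> (bpart (lie i j))) * wedge (eps i) (eps j) xs) = slice h0 \<phi> xs)
      (finite_subsets_at_top (E \<times> E))"
    proof (rule eventually_sum_eps_eps[OF bracket_B_linear(1)[OF True] bracket_B_linear(2)[OF True] A_slice[OF h0_mem True]])
      fix x y assume "x \<in> C" "y \<in> C"
      moreover have "\<phi> (bpart (lie y x)) = - \<phi> (bpart (lie x y))"
        unfolding lie_antisym[of y x] by (rule dual_bpart_linear(3)[OF True])
      ultimately show "slice h0 \<phi> [x, y] = 1 / 2 * \<phi> (bpart (lie x y)) - 1 / 2 * \<phi> (bpart (lie y x))"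
        by (simp add: h0_def on_dual_apply[OF True] two_form_apply)
    qed
    then show ?thesis by (simp add: p sum_apply case_prod_beta tens_apply True mult.assoc mult.commute)
  qed
qed

theorem cdg_data_exists:
  "c_lattice_cdg_data sc lie B s R A rho0 act0 br0 E dA0 dR0 h0"
proof
  fix b :: 'g and n assume b: "b \<in> B"
  show "superderivation fscale R wedge 0 (rho0 b)"
    unfolding rho0_def by (rule act0_superderivation[OF tens_mem[OF ext_one_mem b]])
  show "continuous_map (pointwise_topology (R n)) (pointwise_topology (R n)) (rho0 b)"
  proof (rule continuous_map_pointwise)
    show "rho0 b r \<in> R n" if "r \<in> R n" for r
      using act0_mem[OF tens_mem[OF ext_one_mem b] that] by (simp add: rho0_def)
    show "finite_dependence (\<lambda>u (v :: unit \<Rightarrow> complex). rho0 b u x)" for x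
      unfolding rho0_def by (rule act0_dependence[OF finite_dependence_const finite_dependence_left])
  qed
qed (rule refl rho0_coadjoint act0_bilinear act0_continuous act0_tens br0_bilinear br0_continuous br0_tens
    dR0_superderivation dR0_continuous dR0_generators dA0_graded dA0_continuous dA0_generators dA0_tens h0_limit;
    assumption)+

end

section \<open>The Lie algebroid of arbitrary data\<close>

lemma total_mem: "x \<in> V n \<Longrightarrow> x \<in> total fscale V"
  unfolding total_def by (rule form.span_base) blast

lemma graded_bilinear_linear:
  assumes "graded_bilinear fscale U fscale V fscale W f"
  shows "x \<in> U m \<Longrightarrow> linear_betw fscale (V n) fscale (f x)"
    and "y \<in> V n \<Longrightarrow> linear_betw fscale (U m) fscale (\<lambda>x. f x y)"
    and "x \<in> U m \<Longrightarrow> y \<in> V n \<Longrightarrow> f x y \<in> W (m + n)"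
  using assms total_mem[of _ U] total_mem[of _ V] unfolding graded_bilinear_def linear_betw_def by blast+

text \<open>Joint continuity is used in one variable at a time.\<close>

lemma cont_linear_joint:
  assumes bil: "graded_bilinear fscale U fscale V fscale W f"
    and cont: "continuous_map (prod_topology (pointwise_topology (U m)) (pointwise_topology (V n)))
      (pointwise_topology (W (m + n))) (\<lambda>(x, y). f x y)"
  shows "x \<in> U m \<Longrightarrow> cont_linear (V n) (W (m + n)) (f x)" and "y \<in> V n \<Longrightarrow> cont_linear (U m) (W (m + n)) (\<lambda>x. f x y)"
proof -
  assume x: "x \<in> U m"
  have "continuous_map (pointwise_topology (V n)) (prod_topology (pointwise_topology (U m)) (pointwise_topology (V n))) (\<lambda>y. (x, y))"
    using x by (intro continuous_map_pairedI) auto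
  from continuous_map_compose[OF this cont]
  have "continuous_map (pointwise_topology (V n)) (pointwise_topology (W (m + n))) (f x)" by (simp add: o_def)
  then show "cont_linear (V n) (W (m + n)) (f x)"
    using graded_bilinear_linear(1)[OF bil x] by (rule cont_linearI_continuous)
next
  assume y: "y \<in> V n"
  have "continuous_map (pointwise_topology (U m)) (prod_topology (pointwise_topology (U m)) (pointwise_topology (V n))) (\<lambda>x. (x, y))"
    using y by (intro continuous_map_pairedI) auto
  from continuous_map_compose[OF this cont]
  have "continuous_map (pointwise_topology (U m)) (pointwise_topology (W (m + n))) (\<lambda>x. f x y)" by (simp add: o_def)
  then show "cont_linear (U m) (W (m + n)) (\<lambda>x. f x y)"
    using graded_bilinear_linear(2)[OF bil y] by (rule cont_linearI_continuous)
qed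

lemma graded_linear_linear:
  assumes "graded_linear fscale V fscale W k f"
  shows "linear_betw fscale (V n) fscale f" and "x \<in> V n \<Longrightarrow> f x \<in> W (n + k)"
  using assms total_mem[of _ V] unfolding graded_linear_def linear_betw_def by blast+

lemma cont_linear_linear: "cont_linear S T f \<Longrightarrow> linear_betw fscale S fscale f"
  unfolding cont_linear_def cont_functional_def linear_betw_def by (auto simp: fun_eq_iff)

lemma cont_linear_add: "cont_linear S T f \<Longrightarrow> cont_linear S T' g \<Longrightarrow> cont_linear S UNIV (\<lambda>u. f u + g u)"
  and cont_linear_diff: "cont_linear S T f \<Longrightarrow> cont_linear S T' g \<Longrightarrow> cont_linear S UNIV (\<lambda>u. f u - g u)"
  and cont_linear_minus: "cont_linear S T f \<Longrightarrow> cont_linear S UNIV (\<lambda>u. - f u)"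
  and cont_linear_scale: "cont_linear S T f \<Longrightarrow> cont_linear S UNIV (\<lambda>u. fscale c (f u))"
  by (simp_all add: cont_linear_def cont_functional_add cont_functional_diff cont_functional_minus cont_functional_scale)

text \<open>The degree of a nonzero element is visible at any argument where it does not vanish, whence the
  independence of the components.\<close>

lemma graded_spaceI:
  assumes "\<And>n. form.subspace (V n)" "\<And>n v x. v \<in> V n \<Longrightarrow> v x \<noteq> 0 \<Longrightarrow> int (deg x) = n"
  shows "graded_space fscale V"
proof (intro graded_space.intro graded_space_axioms.intro vector_space_fscale assms(1))
  fix I x i assume I: "finite (I :: int set)" "\<And>i. i \<in> I \<Longrightarrow> x i \<in> V i" "(\<Sum>i\<in>I. x i) = 0" "i \<in> I"
  show "x i = 0"
  proof (rule ext, rule ccontr)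
    fix p assume nz: "x i p \<noteq> 0 p"
    have "x j p = (if j = i then x i p else 0)" if "j \<in> I" for j
    proof (cases "x j p = 0")
      case False
      then have "int (deg p) = j" by (rule assms(2)[OF I(2)[OF that]])
      moreover have "int (deg p) = i" by (rule assms(2)[OF I(2)[OF I(4)]]) (use nz in simp)
      ultimately show ?thesis by simp
    qed (use nz in auto)
    then have "(\<Sum>j\<in>I. x j) p = (\<Sum>j\<in>I. if j = i then x i p else 0)"
      unfolding sum_apply by (rule sum.cong[OF refl])
    also have "\<dots> = x i p" using I(1,4) by simp
    finally show False using nz I(3) by simp
  qed
qed

locale split_cdg_data =
  split_tate_lie_algebra sc lie B s E +
  c_lattice_cdg_data sc lie B s "ext_dual sc (range s)" "compl_tensor sc B (range s)" \<rho> act br E dA dR h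
  for sc :: "complex \<Rightarrow> 'g \<Rightarrow> 'g::{ab_group_add,uniform_topological_group_add,t2_space}"
    and lie B s E \<rho> act br dA dR h
begin

abbreviation "smul \<equiv> tens_smul"
abbreviation "gen b \<equiv> tens sc B ext_one b"

lemmas act_right_cont_linear = cont_linear_joint(1)[OF act_bilinear act_continuous]
  and act_left_cont_linear = cont_linear_joint(2)[OF act_bilinear act_continuous]
  and br_right_cont_linear = cont_linear_joint(1)[OF br_bilinear br_continuous]
  and br_left_cont_linear = cont_linear_joint(2)[OF br_bilinear br_continuous]

lemma dR_cont_linear: "cont_linear (R n) (R (n + 1)) dR"
  using dR_derivation dR_continuous
  by (intro cont_linearI_continuous graded_linear_linear(1)) (auto simp: superderivation_def)

lemma rho_cont_linear: "b \<in> B \<Longrightarrow> cont_linear (R n) (R n) (\<rho> b)"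
  using \<rho>_derivation[of b] \<rho>_continuous[of b]
  by (intro cont_linearI_continuous graded_linear_linear(1)) (auto simp: superderivation_def)

lemma dA_cont_linear: "cont_linear (A n) (A (n + 1)) dA"
  using dA_linear dA_continuous by (intro cont_linearI_continuous graded_linear_linear(1))

lemmas act_mem = cont_linear_mem[OF act_right_cont_linear] and br_mem = cont_linear_mem[OF br_right_cont_linear]
  and dR_mem = cont_linear_mem[OF dR_cont_linear] and rho_mem = cont_linear_mem[OF rho_cont_linear] and dA_mem = cont_linear_mem[OF dA_cont_linear]

lemma gen_mem: "b \<in> B \<Longrightarrow> gen b \<in> A 0"
  by (rule tens_mem[OF ext_one_mem])

lemma h_mem: "h \<in> A 2" by (rule limitin_pointwiseD(1)[OF h_limit])

lemmas mem_intros = act_mem br_mem dR_mem rho_mem dA_mem gen_mem h_mem tens_mem wedge_mem smul_mem ext_one_mem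

text \<open>These rules show, by following the structure of a term, that it is continuous and linear in one of
  its variables; they discharge the side conditions of the density arguments.\<close>

lemma cont_linear_intros:
  "a \<in> A m \<Longrightarrow> cont_linear S (R n) f \<Longrightarrow> cont_linear S (R (m + n)) (\<lambda>u. act a (f u))"
  "r \<in> R n \<Longrightarrow> cont_linear S (A m) g \<Longrightarrow> cont_linear S (R (m + n)) (\<lambda>u. act (g u) r)"
  "a \<in> A m \<Longrightarrow> cont_linear S (A n) g \<Longrightarrow> cont_linear S (A (m + n)) (\<lambda>u. br a (g u))"
  "a \<in> A n \<Longrightarrow> cont_linear S (A m) g \<Longrightarrow> cont_linear S (A (m + n)) (\<lambda>u. br (g u) a)"
  "cont_linear S (R n) f \<Longrightarrow> cont_linear S (R (n + 1)) (\<lambda>u. dR (f u))"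
  "cont_linear S (A n) g \<Longrightarrow> cont_linear S (A (n + 1)) (\<lambda>u. dA (g u))"
  "b \<in> B \<Longrightarrow> cont_linear S (R n) f \<Longrightarrow> cont_linear S (R n) (\<lambda>u. \<rho> b (f u))"
  "r \<in> R m \<Longrightarrow> cont_linear S (R n) f \<Longrightarrow> cont_linear S (R (m + n)) (\<lambda>u. wedge r (f u))"
  "r \<in> R n \<Longrightarrow> cont_linear S (R m) f \<Longrightarrow> cont_linear S (R (m + n)) (\<lambda>u. wedge (f u) r)"
  "r \<in> R m \<Longrightarrow> cont_linear S (A n) g \<Longrightarrow> cont_linear S (A (m + n)) (\<lambda>u. smul r (g u))"
  "a \<in> A n \<Longrightarrow> cont_linear S (R m) f \<Longrightarrow> cont_linear S (A (m + n)) (\<lambda>u. smul (f u) a)"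
  by (rule cont_linear_comp[OF act_right_cont_linear] cont_linear_comp[OF act_left_cont_linear] cont_linear_comp[OF br_right_cont_linear]
      cont_linear_comp[OF br_left_cont_linear] cont_linear_comp[OF dR_cont_linear] cont_linear_comp[OF dA_cont_linear] cont_linear_comp[OF rho_cont_linear]
      cont_linear_comp[OF cont_linear_wedge_right] cont_linear_comp[OF cont_linear_wedge_left] cont_linear_comp[OF cont_linear_smul_right]
      cont_linear_comp[OF cont_linear_smul_left]; assumption)+

lemmas cont_linear_all = cont_linear_intros cont_linear_add cont_linear_diff cont_linear_minus cont_linear_scale cont_linear_id

lemma A_eq_tens:
  assumes "cont_linear (A n) T g" "cont_linear (A n) T' g'" "a \<in> A n"
    and "\<And>r b. r \<in> R n \<Longrightarrow> b \<in> B \<Longrightarrow> g (tens sc B r b) = g' (tens sc B r b)"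
  shows "g a = g' a"
proof
  fix x
  show "g a x = g' a x"
    by (rule A_eq_on_tens[OF cont_functional_apply[OF assms(1)] cont_functional_apply[OF assms(2)] assms(3)]) (simp add: assms(4))
qed

lemma R_add: "cont_linear (R n) T f \<Longrightarrow> x \<in> R n \<Longrightarrow> y \<in> R n \<Longrightarrow> f (x + y) = f x + f y"
  and R_scale: "cont_linear (R n) T f \<Longrightarrow> x \<in> R n \<Longrightarrow> f (fscale c x) = fscale c (f x)"
  by (rule linear_betwD(1)[OF cont_linear_linear], assumption+) (rule linear_betwD(2)[OF cont_linear_linear], assumption+)

lemma A_lin_add: "cont_linear (A n) T f \<Longrightarrow> x \<in> A n \<Longrightarrow> y \<in> A n \<Longrightarrow> f (x + y) = f x + f y"
  and A_lin_scale: "cont_linear (A n) T f \<Longrightarrow> x \<in> A n \<Longrightarrow> f (fscale c x) = fscale c (f x)"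
  by (rule linear_betwD(1)[OF cont_linear_linear], assumption+) (rule linear_betwD(2)[OF cont_linear_linear], assumption+)

lemma rho_leibniz: "b \<in> B \<Longrightarrow> leibniz 0 (\<rho> b)"
  by (rule superderivation_leibniz[OF \<rho>_derivation])

lemma dR_leibniz: "leibniz 1 dR"
  by (rule superderivation_leibniz[OF dR_derivation])

lemma act_smul:
  assumes r: "r \<in> R m" and a: "a \<in> A n" and r': "r' \<in> R k"
  shows "act (smul r a) r' = wedge r (act a r')"
proof (rule A_eq_tens[OF _ _ a, where g="\<lambda>a. act (smul r a) r'" and g'="\<lambda>a. wedge r (act a r')"])
  fix u b assume u: "u \<in> R n" and b: "b \<in> B"
  show "act (smul r (tens sc B u b)) r' = wedge r (act (tens sc B u b) r')"
    unfolding tens_smul_tens act_tens[OF wedge_mem[OF r u] b r'] act_tens[OF u b r'] by (rule wedge_assoc)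
qed (rule cont_linear_all | rule r r')+

lemma act_leibniz:
  assumes a: "a \<in> A m"
  shows "leibniz m (act a)"
  unfolding leibniz_def
proof (intro allI ballI)
  fix k n x y assume x: "x \<in> R k" and y: "y \<in> R n"
  show "act a (wedge x y) = wedge (act a x) y + fscale (ksign m k) (wedge x (act a y))"
  proof (rule A_eq_tens[OF _ _ a, where g="\<lambda>a. act a (wedge x y)"
        and g'="\<lambda>a. wedge (act a x) y + fscale (ksign m k) (wedge x (act a y))"])
    fix u b assume u: "u \<in> R m" and b: "b \<in> B"
    have "wedge u x = fscale (ksign m k) (wedge x u)"
      by (rule wedge_supercomm[OF ext_homogeneous[OF u] ext_homogeneous[OF x]])
    then have "wedge u (wedge x (\<rho> b y)) = fscale (ksign m k) (wedge x (wedge u (\<rho> b y)))"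
      by (simp add: wedge_assoc[symmetric] wedge_linear)
    then show "act (tens sc B u b) (wedge x y) =
      wedge (act (tens sc B u b) x) y + fscale (ksign m k) (wedge x (act (tens sc B u b) y))"
      unfolding act_tens[OF u b wedge_mem[OF x y]] act_tens[OF u b x] act_tens[OF u b y]
        leibnizD[OF rho_leibniz[OF b] x y]
      by (simp add: wedge_linear wedge_assoc ksign_eq)
  qed (rule cont_linear_all | rule x y wedge_mem)+
qed

text \<open>Since \<open>B\<close> is a subalgebra, bracketing with \<open>b\<close> descends to \<open>g / B\<close>, so replacing \<open>z\<close> by its
  \<open>c\<close>-component does not change the \<open>c\<close>-component of the bracket.\<close>

lemma s_lie_B:
  assumes "b \<in> B"
  shows "s (lie b (s z)) = s (lie b z)" "s (lie (s z) b) = s (lie z b)"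
proof -
  have "s (lie b (bpart z)) = 0" "s (lie (bpart z) b) = 0"
    using lie_B[OF assms bpart_B] lie_B[OF bpart_B assms] by (simp_all add: s_B)
  then show "s (lie b (s z)) = s (lie b z)" "s (lie (s z) b) = s (lie z b)"
    by (simp_all add: lie_simps s_diff)
qed

lemma ext1_more:
  assumes "\<xi> \<in> R 1"
  shows "\<xi> [s (x + y)] = \<xi> [s x] + \<xi> [s y]" "\<xi> [s (x - y)] = \<xi> [s x] - \<xi> [s y]" "\<xi> [s (- x)] = - \<xi> [s x]"
proof -
  show add: "\<xi> [s (x + y)] = \<xi> [s x] + \<xi> [s y]" for x y by (simp add: s_add ext1_linear[OF assms])
  show neg: "\<xi> [s (- x)] = - \<xi> [s x]" for x
    using add[of x "- x"] by (simp add: s_zero ext1_linear(3)[OF assms] eq_neg_iff_add_eq_0 add.commute)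
  show "\<xi> [s (x - y)] = \<xi> [s x] - \<xi> [s y]" using add[of x "- y"] neg[of y] by simp
qed

lemma ext_eqI:
  assumes f: "f \<in> R n" and g: "g \<in> R n"
    and eq: "\<And>xs. int (length xs) = n \<Longrightarrow> set xs \<subseteq> C \<Longrightarrow> f xs = g xs"
  shows "f = g"
proof
  fix xs
  show "f xs = g xs"
    using eq[of xs] ext_eq_0[OF f, of xs] ext_eq_0[OF g, of xs]
    by (cases "int (length xs) = n \<and> set xs \<subseteq> C") auto
qed

lemma one_form_eqI:
  assumes "f \<in> R 1" "g \<in> R 1" "\<And>x. x \<in> C \<Longrightarrow> f [x] = g [x]"
  shows "f = g"
proof (rule ext_eqI[OF assms(1,2)])
  fix xs :: "'g list" assume "int (length xs) = 1" "set xs \<subseteq> C"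
  then show "f xs = g xs" by (cases xs) (auto simp: assms(3))
qed

lemma two_form_eqI:
  assumes "f \<in> R 2" "g \<in> R 2" "\<And>x y. x \<in> C \<Longrightarrow> y \<in> C \<Longrightarrow> f [x, y] = g [x, y]"
  shows "f = g"
proof (rule ext_eqI[OF assms(1,2)])
  fix xs :: "'g list" assume "int (length xs) = 2" and C: "set xs \<subseteq> C"
  then have "length xs = Suc (Suc 0)" by simp
  then show "f xs = g xs" using C by (auto simp: length_Suc_conv assms(3))
qed

lemma three_form_eqI:
  assumes "f \<in> R 3" "g \<in> R 3"
    "\<And>x y z. x \<in> C \<Longrightarrow> y \<in> C \<Longrightarrow> z \<in> C \<Longrightarrow> f [x, y, z] = g [x, y, z]"
  shows "f = g"
proof (rule ext_eqI[OF assms(1,2)])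
  fix xs :: "'g list" assume "int (length xs) = 3" and C: "set xs \<subseteq> C"
  then have "length xs = Suc (Suc (Suc 0))" by simp
  then show "f xs = g xs" using C by (auto simp: length_Suc_conv assms(3))
qed

lemma A_eq_slices:
  assumes "f \<in> A n" "g \<in> A n" "\<And>\<phi>. \<phi> \<in> Bdual \<Longrightarrow> slice f \<phi> = slice g \<phi>"
  shows "f = g"
proof (rule slice_eqI)
  fix \<phi> show "slice f \<phi> = slice g \<phi>"
    by (cases "\<phi> \<in> Bdual") (simp_all add: assms(3) A_outside[OF assms(1)] A_outside[OF assms(2)])
qed

lemma leibniz_commutator:
  assumes D: "leibniz k D" and D': "leibniz l D'"
    and cD: "\<And>n. cont_linear (R n) (R (n + k)) D" and cD': "\<And>n. cont_linear (R n) (R (n + l)) D'"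
  shows "leibniz (k + l) (\<lambda>r. D (D' r) - fscale (ksign k l) (D' (D r)))"
  unfolding leibniz_def
proof (intro allI ballI)
  fix m n x y assume x: "x \<in> R m" and y: "y \<in> R n"
  note Dx = cont_linear_mem[OF cD x] and Dy = cont_linear_mem[OF cD y] and D'x = cont_linear_mem[OF cD' x] and D'y = cont_linear_mem[OF cD' y]
  have mem: "wedge (D' x) y \<in> R (m + n + l)" "wedge x (D' y) \<in> R (m + n + l)"
    "wedge (D x) y \<in> R (m + n + k)" "wedge x (D y) \<in> R (m + n + k)"
    using wedge_mem[OF D'x y] wedge_mem[OF x D'y] wedge_mem[OF Dx y] wedge_mem[OF x Dy] by (simp_all add: ac_simps)
  have 1: "D (D' (wedge x y)) = wedge (D (D' x)) y + fscale (ksign k (m + l)) (wedge (D' x) (D y))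
      + fscale (ksign l m) (wedge (D x) (D' y) + fscale (ksign k m) (wedge x (D (D' y))))"
    unfolding leibnizD[OF D' x y] R_add[OF cD mem(1) ext_scale[OF mem(2)]] R_scale[OF cD mem(2)]
      leibnizD[OF D D'x y] leibnizD[OF D x D'y] ..
  have 2: "D' (D (wedge x y)) = wedge (D' (D x)) y + fscale (ksign l (m + k)) (wedge (D x) (D' y))
      + fscale (ksign k m) (wedge (D' x) (D y) + fscale (ksign l m) (wedge x (D' (D y))))"
    unfolding leibnizD[OF D x y] R_add[OF cD' mem(3) ext_scale[OF mem(4)]] R_scale[OF cD' mem(4)]
      leibnizD[OF D' Dx y] leibnizD[OF D' x Dy] ..
  show "D (D' (wedge x y)) - fscale (ksign k l) (D' (D (wedge x y))) =
      wedge (D (D' x) - fscale (ksign k l) (D' (D x))) y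
      + fscale (ksign (k + l) m) (wedge x (D (D' y) - fscale (ksign k l) (D' (D y))))"
    unfolding 1 2
    by (cases "even k"; cases "even l"; cases "even m") (simp_all add: ksign_eq wedge_linear algebra_simps)
qed

lemma cont_linear_commutator:
  assumes cD: "\<And>n. cont_linear (R n) (R (n + k)) D" and cD': "\<And>n. cont_linear (R n) (R (n + l)) D'"
  shows "cont_linear (R n) (R (n + (k + l))) (\<lambda>r. D (D' r) - fscale c (D' (D r)))"
proof -
  have 1: "cont_linear (R n) (R (n + l + k)) (\<lambda>r. D (D' r))" by (rule cont_linear_comp[OF cD cD'])
  have 2: "cont_linear (R n) (R (n + k + l)) (\<lambda>r. D' (D r))" by (rule cont_linear_comp[OF cD' cD])
  have "D (D' r) - fscale c (D' (D r)) \<in> R (n + (k + l))" if "r \<in> R n" for r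
    using cont_linear_mem[OF 1 that] cont_linear_mem[OF 2 that] by (intro ext_diff ext_scale) (simp_all add: ac_simps)
  then show ?thesis using cont_linear_diff[OF 1 cont_linear_scale[OF 2]] by (simp add: cont_linear_def)
qed

text \<open>Both sides are derivations. On one-forms this is the \<open>c\<close>-component of the Jacobi identity for two
  elements of \<open>B\<close> and a vector of \<open>c\<close>.\<close>

lemma rho_bracket:
  assumes b: "b \<in> B" and b': "b' \<in> B" and r: "r \<in> R n"
  shows "\<rho> (lie b b') r = \<rho> b (\<rho> b' r) - \<rho> b' (\<rho> b r)"
proof (rule leibniz_eqI[OF _ _ _ _ _ r, where k=0 and D="\<rho> (lie b b')" and D'="\<lambda>r. \<rho> b (\<rho> b' r) - \<rho> b' (\<rho> b r)"])
  have c: "cont_linear (R n) (R (n + 0)) (\<rho> c)" if "c \<in> B" for c n using rho_cont_linear[OF that] by simp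
  show "leibniz 0 (\<rho> (lie b b'))" by (rule rho_leibniz[OF lie_B[OF b b']])
  show "leibniz 0 (\<lambda>r. \<rho> b (\<rho> b' r) - \<rho> b' (\<rho> b r))"
    using leibniz_commutator[OF rho_leibniz[OF b] rho_leibniz[OF b'] c[OF b] c[OF b']] by (simp add: ksign_eq)
  show "cont_linear (R n) (R (n + 0)) (\<rho> (lie b b'))" for n by (rule c[OF lie_B[OF b b']])
  show "cont_linear (R n) (R (n + 0)) (\<lambda>r. \<rho> b (\<rho> b' r) - \<rho> b' (\<rho> b r))" for n
    using cont_linear_commutator[OF c[OF b] c[OF b'], of n 1] by simp
  fix \<xi> assume \<xi>: "\<xi> \<in> R 1"
  show "\<rho> (lie b b') \<xi> = \<rho> b (\<rho> b' \<xi>) - \<rho> b' (\<rho> b \<xi>)"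
  proof (rule one_form_eqI)
    show "\<rho> (lie b b') \<xi> \<in> R 1" "\<rho> b (\<rho> b' \<xi>) - \<rho> b' (\<rho> b \<xi>) \<in> R 1"
      by (intro ext_diff rho_mem lie_B b b' \<xi>)+
    fix x assume x: "x \<in> C"
    have "lie (lie b b') x = lie b (lie b' x) - lie b' (lie b x)" using lie_jacobi[of b b' x] by simp
    then show "\<rho> (lie b b') \<xi> [x] = (\<rho> b (\<rho> b' \<xi>) - \<rho> b' (\<rho> b \<xi>)) [x]"
      using \<rho>_coadjoint[OF lie_B[OF b b'] \<xi> x] \<rho>_coadjoint[OF b rho_mem[OF b' \<xi>] x]
        \<rho>_coadjoint[OF b' rho_mem[OF b \<xi>] x] \<rho>_coadjoint[OF b \<xi>, of "s (lie b' x)"] \<rho>_coadjoint[OF b' \<xi>, of "s (lie b x)"]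
      by (simp add: s_lie_B b b' ext1_more[OF \<xi>])
  qed
qed

lemma tens_additive:
  assumes "b \<in> B" "b' \<in> B"
  shows "tens sc B r (b + b') = tens sc B r b + tens sc B r b'" "tens sc B r (- b) = - tens sc B r b"
proof -
  have "tens sc B r (b + b') (\<phi>, xs) = (tens sc B r b + tens sc B r b') (\<phi>, xs)" for \<phi> xs
    using linear_betwD(1)[OF dual_linear assms, of \<phi>]
    by (cases "\<phi> \<in> Bdual") (simp_all add: tens_apply distrib_left)
  then show "tens sc B r (b + b') = tens sc B r b + tens sc B r b'" by (auto simp: fun_eq_iff)
  have "tens sc B r (- b) (\<phi>, xs) = (- tens sc B r b) (\<phi>, xs)" for \<phi> xs
    using linear_betwD(2)[OF dual_linear assms(1), of \<phi> "-1"]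
    by (cases "\<phi> \<in> Bdual") (simp_all add: tens_apply)
  then show "tens sc B r (- b) = - tens sc B r b" by (auto simp: fun_eq_iff)
qed

lemma tens_form_simps:
  "tens sc B (r + r') b = tens sc B r b + tens sc B r' b"
  "tens sc B (r - r') b = tens sc B r b - tens sc B r' b"
  "tens sc B (- r) b = - tens sc B r b"
  "tens sc B (fscale c r) b = fscale c (tens sc B r b)"
  "tens sc B (0 :: 'g list \<Rightarrow> complex) b = 0"
  by (auto simp: fun_eq_iff tens_def algebra_simps)

lemma act_br:
  assumes a: "a \<in> A m" and b: "b \<in> A n" and r: "r \<in> R k"
  shows "act (br a b) r = act a (act b r) - fscale (ksign m n) (act b (act a r))"
proof (rule A_eq_tens[OF _ _ a, where g="\<lambda>a. act (br a b) r"
      and g'="\<lambda>a. act a (act b r) - fscale (ksign m n) (act b (act a r))"])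
  fix u x assume u: "u \<in> R m" and x: "x \<in> B"
  show "act (br (tens sc B u x) b) r = act (tens sc B u x) (act b r) - fscale (ksign m n) (act b (act (tens sc B u x) r))"
  proof (rule A_eq_tens[OF _ _ b, where g="\<lambda>b. act (br (tens sc B u x) b) r"
      and g'="\<lambda>b. act (tens sc B u x) (act b r) - fscale (ksign m n) (act b (act (tens sc B u x) r))"])
    fix v y assume v: "v \<in> R n" and y: "y \<in> B"
    note xr = rho_mem[OF x r] and yr = rho_mem[OF y r] and xv = rho_mem[OF x v] and yu = rho_mem[OF y u]
    note xy = lie_B[OF x y]
    \<comment> \<open>Additivity in the first argument of the action is known within one degree only.\<close>
    have m1: "tens sc B (wedge u v) (lie x y) \<in> A (m + n)" "tens sc B (wedge u (\<rho> x v)) y \<in> A (m + n)"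
      "tens sc B (wedge v (\<rho> y u)) x \<in> A (m + n)"
      using tens_mem[OF wedge_mem[OF u v] xy] tens_mem[OF wedge_mem[OF u xv] y] tens_mem[OF wedge_mem[OF v yu] x]
      by (simp_all add: add.commute)
    have "act (br (tens sc B u x) (tens sc B v y)) r
      = act (tens sc B (wedge u v) (lie x y)) r + act (tens sc B (wedge u (\<rho> x v)) y) r
        - fscale (ksign m n) (act (tens sc B (wedge v (\<rho> y u)) x) r)"
    proof -
      note c = act_left_cont_linear[OF r, of "m + n"]
      have "act (br (tens sc B u x) (tens sc B v y)) r
        = act (tens sc B (wedge u v) (lie x y) + tens sc B (wedge u (\<rho> x v)) y
           + fscale (- ksign m n) (tens sc B (wedge v (\<rho> y u)) x)) r"
        unfolding br_tens[OF u x v y] by (simp add: form.scale_minus_left)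
      also have "\<dots> = act (tens sc B (wedge u v) (lie x y)) r + act (tens sc B (wedge u (\<rho> x v)) y) r
        + fscale (- ksign m n) (act (tens sc B (wedge v (\<rho> y u)) x) r)"
        unfolding A_lin_add[OF c A_add[OF m1(1,2)] A_scale[OF m1(3)]] A_lin_add[OF c m1(1,2)] A_lin_scale[OF c m1(3)] ..
      finally show ?thesis by (simp add: form.scale_minus_left)
    qed
    also have "\<dots> = wedge (wedge u v) (\<rho> x (\<rho> y r) - \<rho> y (\<rho> x r)) + wedge (wedge u (\<rho> x v)) (\<rho> y r)
        - fscale (ksign m n) (wedge (wedge v (\<rho> y u)) (\<rho> x r))"
      unfolding act_tens[OF wedge_mem[OF u v] xy r] act_tens[OF wedge_mem[OF u xv] y r]
        act_tens[OF wedge_mem[OF v yu] x r] rho_bracket[OF x y r] ..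
    finally have L: "act (br (tens sc B u x) (tens sc B v y)) r = \<dots>" .
    have R1: "act (tens sc B u x) (act (tens sc B v y) r) = wedge u (wedge (\<rho> x v) (\<rho> y r) + wedge v (\<rho> x (\<rho> y r)))"
      unfolding act_tens[OF v y r] act_tens[OF u x wedge_mem[OF v yr]] leibnizD[OF rho_leibniz[OF x] v yr]
      by (simp add: ksign_eq)
    have R2: "act (tens sc B v y) (act (tens sc B u x) r) = wedge v (wedge (\<rho> y u) (\<rho> x r) + wedge u (\<rho> y (\<rho> x r)))"
      unfolding act_tens[OF u x r] act_tens[OF v y wedge_mem[OF u xr]] leibnizD[OF rho_leibniz[OF y] u xr]
      by (simp add: ksign_eq)
    have "wedge u v = fscale (ksign m n) (wedge v u)"
      by (rule wedge_supercomm[OF ext_homogeneous[OF u] ext_homogeneous[OF v]])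
    then have sw: "wedge u (wedge v w) = fscale (ksign m n) (wedge v (wedge u w))" for w
      by (simp add: wedge_assoc[symmetric] wedge_linear)
    show "act (br (tens sc B u x) (tens sc B v y)) r = act (tens sc B u x) (act (tens sc B v y) r)
        - fscale (ksign m n) (act (tens sc B v y) (act (tens sc B u x) r))"
      unfolding L R1 R2
      by (simp add: wedge_linear wedge_assoc form.scale_right_distrib form.scale_right_diff_distrib
          sw[of "\<rho> y (\<rho> x r)"] algebra_simps)
  qed (rule cont_linear_all | rule mem_intros u x r)+
qed (rule cont_linear_all | rule mem_intros b r)+

end

context split_cdg_data begin

lemma br_add_right: "a \<in> A m \<Longrightarrow> x \<in> A n \<Longrightarrow> y \<in> A n \<Longrightarrow> br a (x + y) = br a x + br a y"
  and br_scale_right: "a \<in> A m \<Longrightarrow> x \<in> A n \<Longrightarrow> br a (fscale c x) = fscale c (br a x)"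
  and br_scale_left: "a \<in> A m \<Longrightarrow> x \<in> A n \<Longrightarrow> br (fscale c x) a = fscale c (br x a)"
  by (rule A_lin_add[OF br_right_cont_linear] A_lin_scale[OF br_right_cont_linear]
      A_lin_scale[OF br_left_cont_linear]; assumption)+

lemma act_add_left: "r \<in> R m \<Longrightarrow> a \<in> A n \<Longrightarrow> b \<in> A n \<Longrightarrow> act (a + b) r = act a r + act b r"
  and act_scale_left: "r \<in> R m \<Longrightarrow> a \<in> A n \<Longrightarrow> act (fscale c a) r = fscale c (act a r)"
  by (rule A_lin_add[OF act_left_cont_linear] A_lin_scale[OF act_left_cont_linear]; assumption)+

lemmas dR_scale = R_scale[OF dR_cont_linear]
  and dA_add = A_lin_add[OF dA_cont_linear] and dA_scale = A_lin_scale[OF dA_cont_linear]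
  and rho_scale = R_scale[OF rho_cont_linear]

lemma br_antisym:
  assumes a: "a \<in> A m" and b: "b \<in> A n"
  shows "br a b = - fscale (ksign m n) (br b a)"
proof (rule A_eq_tens[OF _ _ a, where g="\<lambda>a. br a b" and g'="\<lambda>a. - fscale (ksign m n) (br b a)"])
  fix u x assume u: "u \<in> R m" and x: "x \<in> B"
  show "br (tens sc B u x) b = - fscale (ksign m n) (br b (tens sc B u x))"
  proof (rule A_eq_tens[OF _ _ b, where g="\<lambda>b. br (tens sc B u x) b" and g'="\<lambda>b. - fscale (ksign m n) (br b (tens sc B u x))"])
    fix v y assume v: "v \<in> R n" and y: "y \<in> B"
    have "wedge u v = fscale (ksign m n) (wedge v u)"
      by (rule wedge_supercomm[OF ext_homogeneous[OF u] ext_homogeneous[OF v]])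
    then have sw: "tens sc B (wedge u v) (lie x y) = - fscale (ksign m n) (tens sc B (wedge v u) (lie y x))"
      using tens_additive(2)[OF lie_B[OF y x] lie_B[OF y x]] lie_antisym[of x y]
      by (simp add: tens_form_simps form.scale_minus_right)
    show "br (tens sc B u x) (tens sc B v y) = - fscale (ksign m n) (br (tens sc B v y) (tens sc B u x))"
      unfolding br_tens[OF u x v y] br_tens[OF v y u x] sw by (simp add: ksign_eq)
  qed (rule cont_linear_all | rule mem_intros u x)+
qed (rule cont_linear_all | rule b)+

lemma br_smul:
  assumes a: "a \<in> A m" and r: "r \<in> R n" and b: "b \<in> A k"
  shows "br a (smul r b) = smul (act a r) b + fscale (ksign m n) (smul r (br a b))"
proof (rule A_eq_tens[OF _ _ a, where g="\<lambda>a. br a (smul r b)"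
      and g'="\<lambda>a. smul (act a r) b + fscale (ksign m n) (smul r (br a b))"])
  fix u x assume u: "u \<in> R m" and x: "x \<in> B"
  show "br (tens sc B u x) (smul r b) = smul (act (tens sc B u x) r) b + fscale (ksign m n) (smul r (br (tens sc B u x) b))"
  proof (rule A_eq_tens[OF _ _ b, where g="\<lambda>b. br (tens sc B u x) (smul r b)"
      and g'="\<lambda>b. smul (act (tens sc B u x) r) b + fscale (ksign m n) (smul r (br (tens sc B u x) b))"])
    fix v y assume v: "v \<in> R k" and y: "y \<in> B"
    have "wedge u r = fscale (ksign m n) (wedge r u)"
      by (rule wedge_supercomm[OF ext_homogeneous[OF u] ext_homogeneous[OF r]])
    then have sw: "wedge u (wedge r w) = fscale (ksign m n) (wedge r (wedge u w))" for w
      by (simp add: wedge_assoc[symmetric] wedge_linear)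
    show "br (tens sc B u x) (smul r (tens sc B v y)) =
      smul (act (tens sc B u x) r) (tens sc B v y) + fscale (ksign m n) (smul r (br (tens sc B u x) (tens sc B v y)))"
      unfolding tens_smul_tens br_tens[OF u x wedge_mem[OF r v] y] br_tens[OF u x v y] act_tens[OF u x r]
        leibnizD[OF rho_leibniz[OF x] r v]
      by (cases "even m"; cases "even n"; cases "even k")
        (simp_all add: smul_simps tens_smul_tens wedge_linear wedge_assoc sw tens_form_simps ksign_eq algebra_simps)
  qed (rule cont_linear_all | rule mem_intros u x r)+
qed (rule cont_linear_all | rule mem_intros b r)+

lemma br_gen_gen:
  assumes "b \<in> B" "b' \<in> B"
  shows "br (gen b) (gen b') = gen (lie b b')"
  using br_tens[OF ext_one_mem assms(1) ext_one_mem assms(2)] leibniz_ext_one[OF rho_leibniz[OF assms(1)]]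
    leibniz_ext_one[OF rho_leibniz[OF assms(2)]]
  by (simp add: wedge_linear tens_form_simps)

definition jacobi_at :: "_ \<Rightarrow> _ \<Rightarrow> _ \<Rightarrow> int \<Rightarrow> int \<Rightarrow> bool" where
  "jacobi_at a b c m n \<longleftrightarrow> br a (br b c) = br (br a b) c + fscale (ksign m n) (br b (br a c))"

text \<open>The bracket is a first-order operator in its last argument. The terms that differentiate \<open>r\<close> twice
  cancel because the action respects brackets, those that differentiate it once cancel in pairs.\<close>

lemma jacobi_at_smul:
  assumes a: "a \<in> A m" and b: "b \<in> A n" and c: "c \<in> A k" and r: "r \<in> R l" and J: "jacobi_at a b c m n"
  shows "jacobi_at a b (smul r c) m n"
proof -
  have bc: "br b c \<in> A (n + k)" and ac: "br a c \<in> A (m + k)" and ab: "br a b \<in> A (m + n)"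
    by (rule mem_intros a b c)+
  have ar: "act a r \<in> R (m + l)" and br': "act b r \<in> R (n + l)" by (rule mem_intros a b r)+
  have m1: "smul (act b r) c \<in> A (n + l + k)" "smul r (br b c) \<in> A (n + l + k)"
    "smul (act a r) c \<in> A (m + l + k)" "smul r (br a c) \<in> A (m + l + k)"
    using smul_mem[OF br' c] smul_mem[OF r bc] smul_mem[OF ar c] smul_mem[OF r ac] by (simp_all add: ac_simps)
  have 1: "br a (br b (smul r c)) = smul (act a (act b r)) c + fscale (ksign m (n + l)) (smul (act b r) (br a c))
    + fscale (ksign n l) (smul (act a r) (br b c) + fscale (ksign m l) (smul r (br a (br b c))))"
    unfolding br_smul[OF b r c] br_add_right[OF a m1(1) A_scale[OF m1(2)]] br_scale_right[OF a m1(2)]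
      br_smul[OF a br' c] br_smul[OF a r bc] ..
  have 2: "br b (br a (smul r c)) = smul (act b (act a r)) c + fscale (ksign n (m + l)) (smul (act a r) (br b c))
    + fscale (ksign m l) (smul (act b r) (br a c) + fscale (ksign n l) (smul r (br b (br a c))))"
    unfolding br_smul[OF a r c] br_add_right[OF b m1(3) A_scale[OF m1(4)]] br_scale_right[OF b m1(4)]
      br_smul[OF b ar c] br_smul[OF b r ac] ..
  have 3: "br (br a b) (smul r c) = smul (act a (act b r) - fscale (ksign m n) (act b (act a r))) c
    + fscale (ksign (m + n) l) (smul r (br (br a b) c))"
    unfolding br_smul[OF ab r c] act_br[OF a b r] ..
  show ?thesis unfolding jacobi_at_def 1 2 3 J[unfolded jacobi_at_def]
    by (cases "even m"; cases "even n"; cases "even l") (simp_all add: ksign_eq smul_simps algebra_simps)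
qed

lemma jacobi_at_swap_left:
  assumes a: "a \<in> A m" and b: "b \<in> A n" and c: "c \<in> A k" and J: "jacobi_at a b c m n"
  shows "jacobi_at b a c n m"
proof -
  have "br (br b a) c = - fscale (ksign n m) (br (br a b) c)"
    unfolding br_antisym[OF b a] using br_scale_left[OF c br_mem[OF a b], of "- ksign n m"]
    by (simp add: form.scale_minus_left)
  then show ?thesis using J unfolding jacobi_at_def
    by (cases "even m"; cases "even n") (simp_all add: ksign_eq algebra_simps)
qed

lemma jacobi_at_swap_right:
  assumes a: "a \<in> A m" and b: "b \<in> A n" and c: "c \<in> A k" and J: "jacobi_at a b c m n"
  shows "jacobi_at a c b m k"
proof -
  have bc: "br b c \<in> A (n + k)" and ac: "br a c \<in> A (m + k)" and ab: "br a b \<in> A (m + n)"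
    by (rule mem_intros a b c)+
  have 1: "br a (br c b) = - fscale (ksign k n) (br a (br b c))"
    unfolding br_antisym[OF c b] using br_scale_right[OF a bc, of "- ksign k n"] by (simp add: form.scale_minus_left)
  note 2 = br_antisym[OF ac b] and 3 = br_antisym[OF c ab]
  show ?thesis using J unfolding jacobi_at_def 1 2 3
    by (cases "even m"; cases "even n"; cases "even k") (simp_all add: ksign_eq algebra_simps)
qed

lemma jacobi_at_dense:
  assumes a: "a \<in> A m" and b: "b \<in> A n" and c: "c \<in> A k" and J: "\<And>x. x \<in> B \<Longrightarrow> jacobi_at a b (gen x) m n"
  shows "jacobi_at a b c m n"
  unfolding jacobi_at_def
proof (rule A_eq_tens[OF _ _ c, where g="\<lambda>c. br a (br b c)"
      and g'="\<lambda>c. br (br a b) c + fscale (ksign m n) (br b (br a c))"])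
  fix r x assume "r \<in> R k" "x \<in> B"
  then show "br a (br b (tens sc B r x)) = br (br a b) (tens sc B r x) + fscale (ksign m n) (br b (br a (tens sc B r x)))"
    using jacobi_at_smul[OF a b gen_mem _ J, of x r k] by (simp add: jacobi_at_def tens_smul_tens)
qed (rule cont_linear_all | rule mem_intros a b)+

lemma jacobi_at_gen:
  assumes x: "x \<in> B" and y: "y \<in> B" and z: "z \<in> B"
  shows "jacobi_at (gen x) (gen y) (gen z) 0 0"
  using tens_additive(1)[OF lie_B[OF lie_B[OF x y] z] lie_B[OF y lie_B[OF x z]]]
  by (simp add: jacobi_at_def br_gen_gen x y z lie_B lie_jacobi[of x y z] ksign_eq)

text \<open>By linearity over \<open>R\<close> and density the last argument may always be replaced by elements \<open>1 \<otimes> x\<close>. As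
  the identity is symmetric in its arguments up to sign, each of the three can be moved to the last
  place in turn, starting from the Jacobi identity of \<open>B\<close>.\<close>

lemma br_jacobi:
  assumes a: "a \<in> A m" and b: "b \<in> A n" and c: "c \<in> A k"
  shows "br a (br b c) = br (br a b) c + fscale (ksign m n) (br b (br a c))"
proof -
  \<comment> \<open>General elements are admitted first in the last place, then in the last two, then in all three.\<close>
  have 1: "jacobi_at (gen x) (gen y) d 0 0" if "x \<in> B" "y \<in> B" "d \<in> A i" for x y d i
    by (rule jacobi_at_dense[OF gen_mem[OF that(1)] gen_mem[OF that(2)] that(3) jacobi_at_gen[OF that(1,2)]])
  have 2: "jacobi_at (gen x) d e 0 i" if x: "x \<in> B" and d: "d \<in> A i" and e: "e \<in> A j" for x d e i j
    by (rule jacobi_at_dense[OF gen_mem[OF x] d e])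
      (rule jacobi_at_swap_right[OF gen_mem[OF x] gen_mem d 1[OF x _ d]])
  have "jacobi_at a b (gen x) m n" if x: "x \<in> B" for x
    by (rule jacobi_at_swap_right[OF a gen_mem[OF x] b jacobi_at_swap_left[OF gen_mem[OF x] a b 2[OF x a b]]])
  then show ?thesis using jacobi_at_dense[OF a b c] by (simp add: jacobi_at_def)
qed

section \<open>Values on few vectors\<close>

lemma dual_more:
  assumes "\<phi> \<in> Bdual"
  shows "\<phi> (bpart (x + y)) = \<phi> (bpart x) + \<phi> (bpart y)" "\<phi> (bpart (x - y)) = \<phi> (bpart x) - \<phi> (bpart y)"
    "\<phi> (bpart (- x)) = - \<phi> (bpart x)"
  using dual_bpart_linear(1)[OF assms, of x y] dual_bpart_linear(1)[OF assms, of x "- y"]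
    dual_bpart_linear(3)[OF assms, of x] dual_bpart_linear(3)[OF assms, of y]
  by simp_all

lemma wedge_2_1:
  assumes "r \<in> R 2" "r' \<in> R 1"
  shows "wedge r r' [x, y, z] = r [x, y] * r' [z] - r [x, z] * r' [y] + r [y, z] * r' [x]"
  using ext_eq_0[OF assms(1), of "[]"] ext_eq_0[OF assms(1), of "[_]"] ext_eq_0[OF assms(1), of "[_,_,_]"]
    ext_eq_0[OF assms(2), of "[]"] ext_eq_0[OF assms(2), of "[_,_]"] ext_eq_0[OF assms(2), of "[_,_,_]"]
  by (simp add: wedge_Cons contract_def grade_inv_def)

lemma wedge_1_2:
  assumes "r \<in> R 1" "r' \<in> R 2"
  shows "wedge r r' [x, y, z] = r [x] * r' [y, z] - r [y] * r' [x, z] + r [z] * r' [x, y]"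
  using ext_eq_0[OF assms(2), of "[]"] ext_eq_0[OF assms(2), of "[_]"] ext_eq_0[OF assms(2), of "[_,_,_]"]
    ext_eq_0[OF assms(1), of "[]"] ext_eq_0[OF assms(1), of "[_,_]"] ext_eq_0[OF assms(1), of "[_,_,_]"]
  by (simp add: wedge_Cons contract_def grade_inv_def)

lemma wedge_1_1': "r \<in> R 1 \<Longrightarrow> r' \<in> R 1 \<Longrightarrow> wedge r r' [x, y] = r [x] * r' [y] - r [y] * r' [x]"
  by (rule wedge_1_1) (simp_all add: ext_eq_0)

lemma dR_one_form:
  assumes \<xi>: "\<xi> \<in> R 1" and x: "x \<in> C" "y \<in> C"
  shows "dR \<xi> [x, y] = - \<xi> [s (lie x y)]"
proof -
  have "eventually (\<lambda>F. dR \<xi> [x, y] = dR0 \<xi> [x, y]) (finite_subsets_at_top (E \<times> E))"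
    using limitin_pointwiseD(2)[OF dR_generators[OF \<xi>], of "[x, y]"]
      limitin_pointwiseD(2)[OF dR0_generators[OF \<xi>], of "[x, y]"]
    by eventually_elim simp
  then have "dR \<xi> [x, y] = dR0 \<xi> [x, y]" by (simp add: finite_subsets_at_top_neq_bot)
  then show ?thesis using x by (simp add: dR0_one_form[OF \<xi>] d_one_def two_form_apply)
qed

lemma h_value:
  assumes \<phi>: "\<phi> \<in> Bdual" and x: "x \<in> C" "y \<in> C"
  shows "h (\<phi>, [x, y]) = \<phi> (bpart (lie x y))"
proof -
  have "eventually (\<lambda>F. h (\<phi>, [x, y]) = h0 (\<phi>, [x, y])) (finite_subsets_at_top (E \<times> E))"
    using limitin_pointwiseD(2)[OF h_limit, of "(\<phi>, [x, y])"] limitin_pointwiseD(2)[OF h0_limit, of "(\<phi>, [x, y])"]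
    by eventually_elim simp
  then have "h (\<phi>, [x, y]) = h0 (\<phi>, [x, y])" by (simp add: finite_subsets_at_top_neq_bot)
  then show ?thesis using x by (simp add: h0_def on_dual_apply[OF \<phi>] two_form_apply)
qed

lemma dA_gen_mem: "b \<in> B \<Longrightarrow> dA (gen b) \<in> A 1"
  using dA_mem[OF gen_mem] by simp

lemma dA_gen_value:
  assumes b: "b \<in> B" and \<phi>: "\<phi> \<in> Bdual" and x: "x \<in> C"
  shows "dA (gen b) (\<phi>, [x]) = \<phi> (bpart (lie x b))"
proof -
  have "eventually (\<lambda>F. dA (gen b) (\<phi>, [x]) = dA0 (gen b) (\<phi>, [x])) (finite_subsets_at_top E)"
    using limitin_pointwiseD(2)[OF dA_generators[OF b], of "(\<phi>, [x])"]
      limitin_pointwiseD(2)[OF dA0_generators[OF b], of "(\<phi>, [x])"]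
    by eventually_elim simp
  then have "dA (gen b) (\<phi>, [x]) = dA0 (gen b) (\<phi>, [x])" by (simp add: finite_subsets_at_top_neq_bot)
  also have "\<dots> = (\<Sum>j\<in>supp {x}. coord x j * (1 * \<phi> (bpart (lie j b))))"
    using dA0_unit[OF b \<phi>, of "[x]"] b by (simp add: coact_b_def eps_apply mult.commute)
  also have "\<dots> = 1 * \<phi> (bpart (lie x b))"
    by (rule linear_expand[OF bracket_B_linear(1)[OF \<phi>] x finite_supp order_refl supp_sub, symmetric]) simp
  finally show ?thesis by simp
qed

lemma R2_eq:
  assumes "cont_functional (R 2) g" "cont_functional (R 2) g'" "r \<in> R 2"
    and "\<And>\<xi> \<eta>. \<xi> \<in> R 1 \<Longrightarrow> \<eta> \<in> R 1 \<Longrightarrow> g (wedge \<xi> \<eta>) = g' (wedge \<xi> \<eta>)"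
  shows "g r = g' r"
  by (rule R_eq_on_products[OF assms(1,2) _ assms(3)]) (use assms(4) in simp_all)

lemma cont_functional_eval: "cont_functional S (\<lambda>u. u x)"
  by (rule cont_functional_apply[OF cont_linear_id])

lemma rho_two_form:
  assumes b: "b \<in> B" and \<omega>: "\<omega> \<in> R 2" and x: "x \<in> C" and y: "y \<in> C"
  shows "\<rho> b \<omega> [x, y] = - \<omega> [s (lie b x), y] - \<omega> [x, s (lie b y)]"
proof (rule R2_eq[OF cont_functional_apply[OF rho_cont_linear[OF b]] _ \<omega>, where g'="\<lambda>\<omega>. - \<omega> [s (lie b x), y] - \<omega> [x, s (lie b y)]"])
  show "cont_functional (R 2) (\<lambda>\<omega>. - \<omega> [s (lie b x), y] - \<omega> [x, s (lie b y)])"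
    by (intro cont_functional_diff cont_functional_minus cont_functional_eval)
  fix \<xi> \<eta> assume \<xi>: "\<xi> \<in> R 1" and \<eta>: "\<eta> \<in> R 1"
  show "\<rho> b (wedge \<xi> \<eta>) [x, y] = - wedge \<xi> \<eta> [s (lie b x), y] - wedge \<xi> \<eta> [x, s (lie b y)]"
    unfolding leibnizD[OF rho_leibniz[OF b] \<xi> \<eta>] plus_fun_apply fscale_apply
      wedge_1_1'[OF \<xi> \<eta>] wedge_1_1'[OF \<xi> rho_mem[OF b \<eta>]] wedge_1_1'[OF rho_mem[OF b \<xi>] \<eta>]
    by (simp add: \<rho>_coadjoint[OF b \<xi>] \<rho>_coadjoint[OF b \<eta>] x y ksign_eq algebra_simps)
qed

lemma dR_two_form:
  assumes \<omega>: "\<omega> \<in> R 2" and x: "x \<in> C" and y: "y \<in> C" and z: "z \<in> C"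
  shows "dR \<omega> [x, y, z] = - \<omega> [s (lie x y), z] + \<omega> [s (lie x z), y] - \<omega> [s (lie y z), x]"
proof (rule R2_eq[OF cont_functional_apply[OF dR_cont_linear] _ \<omega>,
      where g'="\<lambda>\<omega>. - \<omega> [s (lie x y), z] + \<omega> [s (lie x z), y] - \<omega> [s (lie y z), x]"])
  show "cont_functional (R 2) (\<lambda>\<omega>. - \<omega> [s (lie x y), z] + \<omega> [s (lie x z), y] - \<omega> [s (lie y z), x])"
    by (intro cont_functional_diff cont_functional_add cont_functional_minus cont_functional_eval)
  fix \<xi> \<eta> assume \<xi>: "\<xi> \<in> R 1" and \<eta>: "\<eta> \<in> R 1"
  have d: "dR \<xi> \<in> R 2" "dR \<eta> \<in> R 2" using dR_mem[OF \<xi>] dR_mem[OF \<eta>] by simp_all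
  show "dR (wedge \<xi> \<eta>) [x, y, z] = - wedge \<xi> \<eta> [s (lie x y), z] + wedge \<xi> \<eta> [s (lie x z), y] - wedge \<xi> \<eta> [s (lie y z), x]"
    unfolding leibnizD[OF dR_leibniz \<xi> \<eta>] plus_fun_apply fscale_apply
      wedge_1_1'[OF \<xi> \<eta>] wedge_1_2[OF \<xi> d(2)] wedge_2_1[OF d(1) \<eta>]
    by (simp add: dR_one_form[OF \<xi>] dR_one_form[OF \<eta>] x y z ksign_eq algebra_simps)
qed

lemma act_one_one:
  assumes a: "a \<in> A 1" and \<xi>: "\<xi> \<in> R 1" and x: "x \<in> C" and y: "y \<in> C"
  shows "act a \<xi> [x, y] = - a (coact_c \<xi> y, [x]) + a (coact_c \<xi> x, [y])"
proof (rule A_eq_on_tens[OF cont_functional_apply[OF act_left_cont_linear[OF \<xi>]] _ a, where h="\<lambda>a. - a (coact_c \<xi> y, [x]) + a (coact_c \<xi> x, [y])"])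
  show "cont_functional (A 1) (\<lambda>a. - a (coact_c \<xi> y, [x]) + a (coact_c \<xi> x, [y]))"
    by (intro cont_functional_add cont_functional_minus cont_functional_eval)
  fix r b assume r: "r \<in> R 1" and b: "b \<in> B"
  show "act (tens sc B r b) \<xi> [x, y] = - tens sc B r b (coact_c \<xi> y, [x]) + tens sc B r b (coact_c \<xi> x, [y])"
    unfolding act_tens[OF r b \<xi>] wedge_1_1'[OF r rho_mem[OF b \<xi>]]
    by (simp add: \<rho>_coadjoint[OF b \<xi>] x y tens_apply coact_c_mem[OF \<xi>], simp add: coact_c_def b)
qed

lemma act_two_one:
  assumes a: "a \<in> A 2" and \<xi>: "\<xi> \<in> R 1" and x: "x \<in> C" and y: "y \<in> C" and z: "z \<in> C"
  shows "act a \<xi> [x, y, z] = - a (coact_c \<xi> z, [x, y]) + a (coact_c \<xi> y, [x, z]) - a (coact_c \<xi> x, [y, z])"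
proof (rule A_eq_on_tens[OF cont_functional_apply[OF act_left_cont_linear[OF \<xi>]] _ a,
      where h="\<lambda>a. - a (coact_c \<xi> z, [x, y]) + a (coact_c \<xi> y, [x, z]) - a (coact_c \<xi> x, [y, z])"])
  show "cont_functional (A 2) (\<lambda>a. - a (coact_c \<xi> z, [x, y]) + a (coact_c \<xi> y, [x, z]) - a (coact_c \<xi> x, [y, z]))"
    by (intro cont_functional_diff cont_functional_add cont_functional_minus cont_functional_eval)
  fix r b assume r: "r \<in> R 2" and b: "b \<in> B"
  show "act (tens sc B r b) \<xi> [x, y, z] = - tens sc B r b (coact_c \<xi> z, [x, y])
      + tens sc B r b (coact_c \<xi> y, [x, z]) - tens sc B r b (coact_c \<xi> x, [y, z])"
    unfolding act_tens[OF r b \<xi>] wedge_2_1[OF r rho_mem[OF b \<xi>]]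
    by (simp add: \<rho>_coadjoint[OF b \<xi>] x y z tens_apply coact_c_mem[OF \<xi>], simp add: coact_c_def b)
qed

text \<open>Bracketing with \<open>1 \<otimes> b\<close> acts on the \<open>B\<close>-part by the adjoint action, whose transpose is
  \<open>coact_b \<phi> b\<close> up to sign, and on the form by \<open>\<rho> b\<close>.\<close>

lemma br_gen_slice:
  assumes a: "a \<in> A m" and b: "b \<in> B" and \<phi>: "\<phi> \<in> Bdual"
  shows "br a (gen b) (\<phi>, xs) = - a (coact_b \<phi> b, xs) - \<rho> b (slice a \<phi>) xs"
proof (rule A_eq_on_tens[OF cont_functional_apply[OF br_left_cont_linear[OF gen_mem[OF b]]] _ a,
      where h="\<lambda>a. - a (coact_b \<phi> b, xs) - \<rho> b (slice a \<phi>) xs"])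
  show "cont_functional (A m) (\<lambda>a. - a (coact_b \<phi> b, xs) - \<rho> b (slice a \<phi>) xs)"
    by (intro cont_functional_diff cont_functional_minus cont_functional_eval cont_functional_apply[OF cont_linear_comp[OF rho_cont_linear[OF b] cont_linear_slice]])
  fix r x assume r: "r \<in> R m" and x: "x \<in> B"
  have "br (tens sc B r x) (gen b) = tens sc B r (lie x b) - tens sc B (\<rho> b r) x"
    using br_tens[OF r x ext_one_mem b] leibniz_ext_one[OF rho_leibniz[OF x]]
    by (simp add: wedge_linear tens_form_simps ksign_eq)
  moreover have "coact_b \<phi> b x = - \<phi> (lie x b)"
    using x lie_B[OF b x] lie_antisym[of x b] linear_betwD(2)[OF dual_linear[OF \<phi>] lie_B[OF b x], of "-1"]
    by (simp add: coact_b_def s_B)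
  ultimately show "br (tens sc B r x) (gen b) (\<phi>, xs) = - tens sc B r x (coact_b \<phi> b, xs) - \<rho> b (slice (tens sc B r x) \<phi>) xs"
    unfolding slice_tens[OF \<phi>] rho_scale[OF b r]
    by (simp add: tens_apply \<phi> coact_b_mem[OF \<phi>])
qed

lemma dA_one:
  assumes a: "a \<in> A 1" and \<phi>: "\<phi> \<in> Bdual" and x: "x \<in> C" and y: "y \<in> C"
  shows "dA a (\<phi>, [x, y]) = - a (\<phi>, [s (lie x y)]) - a (coact_b \<phi> y, [x]) + a (coact_b \<phi> x, [y])"
proof (rule A_eq_on_tens[OF cont_functional_apply[OF dA_cont_linear] _ a,
      where h="\<lambda>a. - a (\<phi>, [s (lie x y)]) - a (coact_b \<phi> y, [x]) + a (coact_b \<phi> x, [y])"])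
  show "cont_functional (A 1) (\<lambda>a. - a (\<phi>, [s (lie x y)]) - a (coact_b \<phi> y, [x]) + a (coact_b \<phi> x, [y]))"
    by (intro cont_functional_diff cont_functional_add cont_functional_minus cont_functional_eval)
  fix r b assume r: "r \<in> R 1" and b: "b \<in> B"
  have "smul r (dA (gen b)) (\<phi>, [x, y]) = r [x] * dA (gen b) (\<phi>, [y]) - r [y] * dA (gen b) (\<phi>, [x])"
    using wedge_1_1'[OF r A_slice[OF dA_gen_mem[OF b] \<phi>], of x y] by (simp add: tens_smul_def)
  then show "dA (tens sc B r b) (\<phi>, [x, y]) = - tens sc B r b (\<phi>, [s (lie x y)])
      - tens sc B r b (coact_b \<phi> y, [x]) + tens sc B r b (coact_b \<phi> x, [y])"
    unfolding dA_tens[OF r b]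
    by (simp add: tens_apply \<phi> coact_b_mem[OF \<phi>] dR_one_form[OF r x y] dA_gen_value[OF b \<phi>] x y ksign_eq,
        simp add: coact_b_def b)
qed

lemma dA_two:
  assumes a: "a \<in> A 2" and \<phi>: "\<phi> \<in> Bdual" and x: "x \<in> C" and y: "y \<in> C" and z: "z \<in> C"
  shows "dA a (\<phi>, [x, y, z]) = dR (slice a \<phi>) [x, y, z]
    + a (coact_b \<phi> z, [x, y]) - a (coact_b \<phi> y, [x, z]) + a (coact_b \<phi> x, [y, z])"
proof (rule A_eq_on_tens[OF cont_functional_apply[OF dA_cont_linear] _ a,
      where h="\<lambda>a. dR (slice a \<phi>) [x, y, z] + a (coact_b \<phi> z, [x, y]) - a (coact_b \<phi> y, [x, z]) + a (coact_b \<phi> x, [y, z])"])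
  show "cont_functional (A 2) (\<lambda>a. dR (slice a \<phi>) [x, y, z] + a (coact_b \<phi> z, [x, y]) - a (coact_b \<phi> y, [x, z]) + a (coact_b \<phi> x, [y, z]))"
    by (intro cont_functional_diff cont_functional_add cont_functional_minus cont_functional_eval cont_functional_apply[OF cont_linear_comp[OF dR_cont_linear cont_linear_slice]])
  fix r b assume r: "r \<in> R 2" and b: "b \<in> B"
  have "smul r (dA (gen b)) (\<phi>, [x, y, z]) = r [x, y] * dA (gen b) (\<phi>, [z]) - r [x, z] * dA (gen b) (\<phi>, [y])
      + r [y, z] * dA (gen b) (\<phi>, [x])"
    using wedge_2_1[OF r A_slice[OF dA_gen_mem[OF b] \<phi>], of x y z] by (simp add: tens_smul_def)
  then show "dA (tens sc B r b) (\<phi>, [x, y, z]) = dR (slice (tens sc B r b) \<phi>) [x, y, z]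
    + tens sc B r b (coact_b \<phi> z, [x, y]) - tens sc B r b (coact_b \<phi> y, [x, z]) + tens sc B r b (coact_b \<phi> x, [y, z])"
    unfolding dA_tens[OF r b] slice_tens[OF \<phi>] dR_scale[OF r]
    by (simp add: tens_apply \<phi> coact_b_mem[OF \<phi>] dA_gen_value[OF b \<phi>] x y z ksign_eq,
        simp add: coact_b_def b)
qed

end

context split_cdg_data begin

section \<open>Compatibility of the differentials\<close>

text \<open>Both sides of \<open>[d\<^sub>R, \<rho>(b)] = d\<^sub>A(1 \<otimes> b)\<close> are superderivations of degree one. On one-forms, evaluated
  at \<open>x\<close> and \<open>y\<close>, this is the \<open>c\<close>-component of the Jacobi identity for \<open>b, x, y\<close>.\<close>

lemma dR_rho:
  assumes b: "b \<in> B" and r: "r \<in> R n"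
  shows "dR (\<rho> b r) = act (dA (gen b)) r + \<rho> b (dR r)"
proof -
  have cd: "cont_linear (R n) (R (n + 1)) dR" for n by (rule dR_cont_linear)
  have cr: "cont_linear (R n) (R (n + 0)) (\<rho> b)" for n using rho_cont_linear[OF b] by simp
  have "dR (\<rho> b r) - \<rho> b (dR r) = act (dA (gen b)) r"
  proof (rule leibniz_eqI[OF _ _ _ _ _ r, where k=1 and D="\<lambda>r. dR (\<rho> b r) - \<rho> b (dR r)" and D'="act (dA (gen b))"])
    show "leibniz 1 (\<lambda>r. dR (\<rho> b r) - \<rho> b (dR r))"
      using leibniz_commutator[OF dR_leibniz rho_leibniz[OF b] cd cr] by (simp add: ksign_eq)
    show "cont_linear (R n) (R (n + 1)) (\<lambda>r. dR (\<rho> b r) - \<rho> b (dR r))" for n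
      using cont_linear_commutator[OF cd cr, of n 1] by simp
    show "leibniz 1 (act (dA (gen b)))" by (rule act_leibniz[OF dA_gen_mem[OF b]])
    show "cont_linear (R n) (R (n + 1)) (act (dA (gen b)))" for n
      using act_right_cont_linear[OF dA_gen_mem[OF b], of n] by (simp add: add.commute)
    fix \<xi> assume \<xi>: "\<xi> \<in> R 1"
    have d: "dR \<xi> \<in> R 2" using dR_mem[OF \<xi>] by simp
    show "dR (\<rho> b \<xi>) - \<rho> b (dR \<xi>) = act (dA (gen b)) \<xi>"
    proof (rule two_form_eqI)
      show "dR (\<rho> b \<xi>) - \<rho> b (dR \<xi>) \<in> R 2"
        using ext_diff[OF _ rho_mem[OF b d]] dR_mem[OF rho_mem[OF b \<xi>]] by simp
      show "act (dA (gen b)) \<xi> \<in> R 2" using act_mem[OF dA_gen_mem[OF b] \<xi>] by simp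
      fix x y assume x: "x \<in> C" and y: "y \<in> C"
      have 1: "dR (\<rho> b \<xi>) [x, y] = \<xi> [s (lie b (lie x y))]"
        unfolding dR_one_form[OF rho_mem[OF b \<xi>] x y]
        by (simp add: \<rho>_coadjoint[OF b \<xi>] s_lie_B[OF b])
      have 2: "\<rho> b (dR \<xi>) [x, y] = \<xi> [s (lie (s (lie b x)) y)] + \<xi> [s (lie x (s (lie b y)))]"
        by (simp add: rho_two_form[OF b d x y] dR_one_form[OF \<xi>] x y)
      have 3: "act (dA (gen b)) \<xi> [x, y] = - \<xi> [s (lie (bpart (lie x b)) y)] + \<xi> [s (lie (bpart (lie y b)) x)]"
        by (simp add: act_one_one[OF dA_gen_mem[OF b] \<xi> x y] dA_gen_value[OF b coact_c_mem[OF \<xi>]] x y,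
            simp add: coact_c_def bpart_B)
      have 4: "bpart (lie x b) = - bpart (lie b x)" "lie (bpart (lie y b)) x = lie x (bpart (lie b y))"
        using lie_antisym[of x b] lie_antisym[of y b] lie_antisym[of "bpart (lie y b)" x]
        by (simp_all add: lie_simps s_minus)
      show "(dR (\<rho> b \<xi>) - \<rho> b (dR \<xi>)) [x, y] = act (dA (gen b)) \<xi> [x, y]"
        unfolding minus_apply 1 2 3 4 lie_jacobi[of b x y]
        by (simp only: lie_simps ext1_more[OF \<xi>]) (simp add: algebra_simps)
    qed
  qed
  then show ?thesis by (simp add: algebra_simps)
qed

lemma dA_smul:
  assumes r: "r \<in> R m" and a: "a \<in> A n"
  shows "dA (smul r a) = smul (dR r) a + fscale (ksign 1 m) (smul r (dA a))"
proof (rule A_eq_tens[OF _ _ a, where g="\<lambda>a. dA (smul r a)"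
      and g'="\<lambda>a. smul (dR r) a + fscale (ksign 1 m) (smul r (dA a))"])
  fix u b assume u: "u \<in> R n" and b: "b \<in> B"
  show "dA (smul r (tens sc B u b)) = smul (dR r) (tens sc B u b) + fscale (ksign 1 m) (smul r (dA (tens sc B u b)))"
    unfolding tens_smul_tens dA_tens[OF wedge_mem[OF r u] b] dA_tens[OF u b] leibnizD[OF dR_leibniz r u]
    by (cases "even m"; cases "even n")
      (simp_all add: tens_form_simps smul_simps smul_assoc tens_smul_tens ksign_eq)
qed (rule cont_linear_all | rule mem_intros r)+

lemma dR_act:
  assumes a: "a \<in> A m" and r: "r \<in> R n"
  shows "dR (act a r) = act (dA a) r + fscale (ksign 1 m) (act a (dR r))"
proof (rule A_eq_tens[OF _ _ a, where g="\<lambda>a. dR (act a r)"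
      and g'="\<lambda>a. act (dA a) r + fscale (ksign 1 m) (act a (dR r))"])
  fix u b assume u: "u \<in> R m" and b: "b \<in> B"
  have m1: "tens sc B (dR u) b \<in> A (m + 1)" "smul u (dA (gen b)) \<in> A (m + 1)"
    by (rule mem_intros u b dA_gen_mem)+
  have "act (dA (tens sc B u b)) r = wedge (dR u) (\<rho> b r) + fscale (ksign 1 m) (wedge u (act (dA (gen b)) r))"
    unfolding dA_tens[OF u b] act_add_left[OF r m1(1) A_scale[OF m1(2)]] act_scale_left[OF r m1(2)]
      act_tens[OF dR_mem[OF u] b r] act_smul[OF u dA_gen_mem[OF b] r] ..
  then show "dR (act (tens sc B u b) r) = act (dA (tens sc B u b)) r + fscale (ksign 1 m) (act (tens sc B u b) (dR r))"
    unfolding act_tens[OF u b r] act_tens[OF u b dR_mem[OF r]] leibnizD[OF dR_leibniz u rho_mem[OF b r]] dR_rho[OF b r]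
    by (simp add: wedge_linear form.scale_right_distrib)
qed (rule cont_linear_all | rule mem_intros r)+

text \<open>Twice the square of \<open>d\<^sub>R\<close> is its supercommutator with itself, hence a superderivation. On one-forms the
  identity is the \<open>c\<close>-component of the Jacobi identity for \<open>x, y, z\<close>: the part of \<open>[[x, y], z]\<close> with
  \<open>[x, y]\<close> projected to \<open>c\<close> comes from \<open>d\<^sub>R\<^sup>2\<close>, the part projected to \<open>B\<close> from the curvature.\<close>

lemma dR_dR:
  assumes r: "r \<in> R n"
  shows "dR (dR r) = act h r"
proof -
  have cd: "cont_linear (R n) (R (n + 1)) dR" for n by (rule dR_cont_linear)
  have h2: "fscale 2 h \<in> A 2" by (rule A_scale[OF h_mem])
  have sc2: "act (fscale 2 h) r = fscale 2 (act h r)" if "r \<in> R n" for r n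
    by (rule act_scale_left[OF that h_mem])
  have "fscale 2 (dR (dR r)) = act (fscale 2 h) r"
  proof (rule leibniz_eqI[OF _ _ _ _ _ r, where k=2 and D="\<lambda>r. fscale 2 (dR (dR r))" and D'="act (fscale 2 h)"])
    \<comment> \<open>The supercommutator of an odd operator with itself is twice its square.\<close>
    have dbl: "dR (dR r) - fscale (ksign 1 1) (dR (dR r)) = fscale 2 (dR (dR r))" for r
      by (simp add: ksign_eq fun_eq_iff)
    show "leibniz 2 (\<lambda>r. fscale 2 (dR (dR r)))"
      using leibniz_commutator[OF dR_leibniz dR_leibniz cd cd] unfolding dbl by simp
    show "cont_linear (R n) (R (n + 2)) (\<lambda>r. fscale 2 (dR (dR r)))" for n
      using cont_linear_commutator[OF cd cd, of n "ksign 1 1"] unfolding dbl by simp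
    show "leibniz 2 (act (fscale 2 h))" by (rule act_leibniz[OF h2])
    show "cont_linear (R n) (R (n + 2)) (act (fscale 2 h))" for n
      by (subst add.commute) (rule act_right_cont_linear[OF h2])
    fix \<xi> assume \<xi>: "\<xi> \<in> R 1"
    have d: "dR \<xi> \<in> R 2" using dR_mem[OF \<xi>] by simp
    have "dR (dR \<xi>) = act h \<xi>"
    proof (rule three_form_eqI)
      show "dR (dR \<xi>) \<in> R 3" using dR_mem[OF d] by simp
      show "act h \<xi> \<in> R 3" using act_mem[OF h_mem \<xi>] by simp
      fix x y z assume x: "x \<in> C" and y: "y \<in> C" and z: "z \<in> C"
      have 1: "dR (dR \<xi>) [x, y, z] = \<xi> [s (lie (s (lie x y)) z)] - \<xi> [s (lie (s (lie x z)) y)] + \<xi> [s (lie (s (lie y z)) x)]"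
        by (simp add: dR_two_form[OF d x y z] dR_one_form[OF \<xi>] x y z)
      have 2: "act h \<xi> [x, y, z] = - \<xi> [s (lie (bpart (lie x y)) z)] + \<xi> [s (lie (bpart (lie x z)) y)] - \<xi> [s (lie (bpart (lie y z)) x)]"
        by (simp add: act_two_one[OF h_mem \<xi> x y z] h_value[OF coact_c_mem[OF \<xi>]] x y z,
            simp add: coact_c_def bpart_B)
      have "\<xi> [s (lie (lie x y) z - lie (lie x z) y + lie (lie y z) x)] = 0"
        by (simp only: lie_cyclic_left s_zero ext1_linear(3)[OF \<xi>])
      then show "dR (dR \<xi>) [x, y, z] = act h \<xi> [x, y, z]"
        unfolding 1 2 by (simp only: lie_simps ext1_more[OF \<xi>]) (simp add: algebra_simps)
    qed
    then show "fscale 2 (dR (dR \<xi>)) = act (fscale 2 h) \<xi>" by (simp only: sc2[OF \<xi>])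
  qed
  then show ?thesis by (simp only: sc2[OF r] form.scale_cancel_left) simp
qed

lemma A_one_eqI:
  assumes f: "f \<in> A 1" and g: "g \<in> A 1" and eq: "\<And>\<phi> x. \<phi> \<in> Bdual \<Longrightarrow> x \<in> C \<Longrightarrow> f (\<phi>, [x]) = g (\<phi>, [x])"
  shows "f = g"
  by (rule A_eq_slices[OF f g one_form_eqI[OF A_slice[OF f] A_slice[OF g]]]) (simp_all add: eq)

lemma A_two_eqI:
  assumes f: "f \<in> A 2" and g: "g \<in> A 2"
    and eq: "\<And>\<phi> x y. \<phi> \<in> Bdual \<Longrightarrow> x \<in> C \<Longrightarrow> y \<in> C \<Longrightarrow> f (\<phi>, [x, y]) = g (\<phi>, [x, y])"
  shows "f = g"
  by (rule A_eq_slices[OF f g two_form_eqI[OF A_slice[OF f] A_slice[OF g]]]) (simp_all add: eq)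

lemma A_three_eqI:
  assumes f: "f \<in> A 3" and g: "g \<in> A 3"
    and eq: "\<And>\<phi> x y z. \<phi> \<in> Bdual \<Longrightarrow> x \<in> C \<Longrightarrow> y \<in> C \<Longrightarrow> z \<in> C \<Longrightarrow> f (\<phi>, [x, y, z]) = g (\<phi>, [x, y, z])"
  shows "f = g"
  by (rule A_eq_slices[OF f g three_form_eqI[OF A_slice[OF f] A_slice[OF g]]]) (simp_all add: eq)

lemma coact_b_apply: "b \<in> B \<Longrightarrow> coact_b \<phi> x b = \<phi> (bpart (lie x b))"
  by (simp add: coact_b_def)

text \<open>On \<open>r \<otimes> b\<close> the mixed terms of \<open>d\<^sub>A\<^sup>2\<close> cancel, and \<open>d\<^sub>R\<^sup>2(r)\<close> is the action of \<open>h\<close>. There remains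
  \<open>r = 1\<close>, which is the \<open>B\<close>-component of the Jacobi identity for \<open>b, x, y\<close>.\<close>

lemma dA_dA:
  assumes a: "a \<in> A m"
  shows "dA (dA a) = br h a"
proof (rule A_eq_tens[OF _ _ a, where g="\<lambda>a. dA (dA a)" and g'="\<lambda>a. br h a"])
  fix r b assume r: "r \<in> R m" and b: "b \<in> B"
  have base: "dA (dA (gen b)) = br h (gen b)"
  proof (rule A_two_eqI)
    show "dA (dA (gen b)) \<in> A 2" using dA_mem[OF dA_gen_mem[OF b]] by simp
    show "br h (gen b) \<in> A 2" using br_mem[OF h_mem gen_mem[OF b]] by simp
    fix \<phi> x y assume \<phi>: "\<phi> \<in> Bdual" and x: "x \<in> C" and y: "y \<in> C"
    have 1: "dA (dA (gen b)) (\<phi>, [x, y]) = - \<phi> (bpart (lie (s (lie x y)) b))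
        - \<phi> (bpart (lie y (bpart (lie x b)))) + \<phi> (bpart (lie x (bpart (lie y b))))"
      by (simp add: dA_one[OF dA_gen_mem[OF b] \<phi> x y] dA_gen_value[OF b \<phi>] dA_gen_value[OF b coact_b_mem[OF \<phi>]]
          coact_b_apply[OF bpart_B] x y)
    have 2: "br h (gen b) (\<phi>, [x, y]) = - \<phi> (bpart (lie b (bpart (lie x y))))
        + \<phi> (bpart (lie (s (lie b x)) y)) + \<phi> (bpart (lie x (s (lie b y))))"
      by (simp add: br_gen_slice[OF h_mem b \<phi>] rho_two_form[OF b A_slice[OF h_mem \<phi>] x y]
          h_value[OF \<phi>] h_value[OF coact_b_mem[OF \<phi>]] coact_b_apply[OF bpart_B] x y)
    have a1: "lie y (bpart (lie x b)) = lie (bpart (lie b x)) y" "bpart (lie y b) = - bpart (lie b y)"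
      "lie (s (lie x y)) b = - lie b (s (lie x y))"
      using lie_antisym[of x b] lie_antisym[of y b] lie_antisym[of y "bpart (lie x b)"] lie_antisym[of "s (lie x y)" b]
      by (simp_all add: lie_simps s_minus)
    have j: "lie b (lie x y) = lie (lie b x) y + lie x (lie b y)" by (rule lie_jacobi)
    show "dA (dA (gen b)) (\<phi>, [x, y]) = br h (gen b) (\<phi>, [x, y])"
      unfolding 1 2 a1 by (simp only: lie_simps dual_more[OF \<phi>] j) (simp add: algebra_simps)
  qed
  have X: "dA (gen b) \<in> A 1" by (rule dA_gen_mem[OF b])
  have m1: "tens sc B (dR r) b \<in> A (m + 1)" "smul r (dA (gen b)) \<in> A (m + 1)"
    by (rule mem_intros r b dA_gen_mem)+
  have 1: "dA (dA (tens sc B r b)) = tens sc B (dR (dR r)) b + fscale (ksign 1 (m + 1)) (smul (dR r) (dA (gen b)))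
      + fscale (ksign 1 m) (smul (dR r) (dA (gen b)) + fscale (ksign 1 m) (smul r (dA (dA (gen b)))))"
    unfolding dA_tens[OF r b] dA_add[OF m1(1) A_scale[OF m1(2)]] dA_scale[OF m1(2)]
      dA_tens[OF dR_mem[OF r] b] dA_smul[OF r X] ..
  have 2: "br h (tens sc B r b) = tens sc B (act h r) b + fscale (ksign 2 m) (smul r (br h (gen b)))"
    using br_smul[OF h_mem r gen_mem[OF b]] by (simp add: tens_smul_tens)
  show "dA (dA (tens sc B r b)) = br h (tens sc B r b)"
    unfolding 1 2 dR_dR[OF r] base by (cases "even m") (simp_all add: ksign_eq)
qed (rule cont_linear_all | rule mem_intros)+

text \<open>This is the \<open>B\<close>-component of the Jacobi identity for \<open>x, y, z\<close>: the \<open>c\<close>-parts of the inner brackets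
  come from \<open>d\<^sub>R\<close>, the \<open>B\<close>-parts from the remaining terms of \<open>d\<^sub>A\<close>.\<close>

lemma dA_h: "dA h = 0"
proof (rule A_three_eqI)
  show "dA h \<in> A 3" using dA_mem[OF h_mem] by simp
  show "0 \<in> A 3" by (rule A_zero)
  fix \<phi> x y z assume \<phi>: "\<phi> \<in> Bdual" and x: "x \<in> C" and y: "y \<in> C" and z: "z \<in> C"
  have 1: "dA h (\<phi>, [x, y, z]) = - \<phi> (bpart (lie (s (lie x y)) z)) + \<phi> (bpart (lie (s (lie x z)) y))
      - \<phi> (bpart (lie (s (lie y z)) x)) + \<phi> (bpart (lie z (bpart (lie x y))))
      - \<phi> (bpart (lie y (bpart (lie x z)))) + \<phi> (bpart (lie x (bpart (lie y z))))"
    by (simp add: dA_two[OF h_mem \<phi> x y z] dR_two_form[OF A_slice[OF h_mem \<phi>] x y z]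
        h_value[OF \<phi>] h_value[OF coact_b_mem[OF \<phi>]] coact_b_apply[OF bpart_B] x y z)
  have a1: "lie z (bpart (lie x y)) = - lie (bpart (lie x y)) z" "lie y (bpart (lie x z)) = - lie (bpart (lie x z)) y"
    "lie x (bpart (lie y z)) = - lie (bpart (lie y z)) x"
    by (rule lie_antisym)+
  have "\<phi> (bpart (lie (lie x y) z - lie (lie x z) y + lie (lie y z) x)) = 0"
    by (simp only: lie_cyclic_left dual_bpart_linear(4)[OF \<phi>])
  then show "dA h (\<phi>, [x, y, z]) = 0 (\<phi>, [x, y, z])"
    unfolding 1 a1 by (simp only: lie_simps dual_more[OF \<phi>]) (simp add: algebra_simps)
qed

definition leibniz_at :: "_ \<Rightarrow> _ \<Rightarrow> int \<Rightarrow> bool" where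
  "leibniz_at a b m \<longleftrightarrow> dA (br a b) = br (dA a) b + fscale (ksign 1 m) (br a (dA b))"

text \<open>The terms in which \<open>r\<close> is differentiated match by the compatibility of \<open>d\<^sub>R\<close> with the action, so the
  Leibniz rule is linear over \<open>R\<close> in its last argument.\<close>

lemma leibniz_at_smul:
  assumes a: "a \<in> A m" and b: "b \<in> A n" and r: "r \<in> R l" and J: "leibniz_at a b m"
  shows "leibniz_at a (smul r b) m"
proof -
  note ab = br_mem[OF a b] and da = dA_mem[OF a] and db = dA_mem[OF b] and dr = dR_mem[OF r] and ar = act_mem[OF a r]
  have m1: "smul (act a r) b \<in> A (m + l + n)" "smul r (br a b) \<in> A (m + l + n)"
    "smul (dR r) b \<in> A (l + n + 1)" "smul r (dA b) \<in> A (l + n + 1)"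
    using smul_mem[OF ar b] smul_mem[OF r ab] smul_mem[OF dr b] smul_mem[OF r db] by (simp_all add: ac_simps)
  have 1: "dA (br a (smul r b)) = smul (act (dA a) r + fscale (ksign 1 m) (act a (dR r))) b
      + fscale (ksign 1 (m + l)) (smul (act a r) (dA b))
      + fscale (ksign m l) (smul (dR r) (br a b) + fscale (ksign 1 l) (smul r (dA (br a b))))"
    unfolding br_smul[OF a r b] dA_add[OF m1(1) A_scale[OF m1(2)]] dA_scale[OF m1(2)]
      dA_smul[OF ar b] dA_smul[OF r ab] dR_act[OF a r] ..
  have 2: "br (dA a) (smul r b) = smul (act (dA a) r) b + fscale (ksign (m + 1) l) (smul r (br (dA a) b))"
    by (rule br_smul[OF da r b])
  have 3: "br a (dA (smul r b)) = smul (act a (dR r)) b + fscale (ksign m (l + 1)) (smul (dR r) (br a b))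
      + fscale (ksign 1 l) (smul (act a r) (dA b) + fscale (ksign m l) (smul r (br a (dA b))))"
    unfolding dA_smul[OF r b] br_add_right[OF a m1(3) A_scale[OF m1(4)]] br_scale_right[OF a m1(4)]
      br_smul[OF a dr b] br_smul[OF a r db] ..
  show ?thesis unfolding leibniz_at_def 1 2 3 J[unfolded leibniz_at_def]
    by (cases "even m"; cases "even l") (simp_all add: ksign_eq smul_simps algebra_simps)
qed

lemma leibniz_at_swap:
  assumes a: "a \<in> A m" and b: "b \<in> A n" and J: "leibniz_at a b m"
  shows "leibniz_at b a n"
proof -
  note da = dA_mem[OF a] and db = dA_mem[OF b]
  have 1: "dA (br b a) = - fscale (ksign n m) (dA (br a b))"
    unfolding br_antisym[OF b a] using dA_scale[OF br_mem[OF a b], of "- ksign n m"] by (simp add: form.scale_minus_left)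
  note 2 = br_antisym[OF db a] and 3 = br_antisym[OF b da]
  show ?thesis unfolding leibniz_at_def 1 2 3 J[unfolded leibniz_at_def]
    by (cases "even m"; cases "even n") (simp_all add: ksign_eq)
qed

lemma leibniz_at_dense:
  assumes a: "a \<in> A m" and b: "b \<in> A n" and J: "\<And>x. x \<in> B \<Longrightarrow> leibniz_at a (gen x) m"
  shows "leibniz_at a b m"
  unfolding leibniz_at_def
proof (rule A_eq_tens[OF _ _ b, where g="\<lambda>b. dA (br a b)" and g'="\<lambda>b. br (dA a) b + fscale (ksign 1 m) (br a (dA b))"])
  fix r x assume "r \<in> R n" "x \<in> B"
  then show "dA (br a (tens sc B r x)) = br (dA a) (tens sc B r x) + fscale (ksign 1 m) (br a (dA (tens sc B r x)))"
    using leibniz_at_smul[OF a gen_mem _ J, of x r n] by (simp add: leibniz_at_def tens_smul_tens)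
qed (rule cont_linear_all | rule mem_intros a)+

text \<open>The \<open>B\<close>-component of the Jacobi identity for \<open>x, b, b'\<close>, read off at \<open>x\<close>.\<close>

lemma leibniz_at_gen:
  assumes b: "b \<in> B" and b': "b' \<in> B"
  shows "leibniz_at (gen b) (gen b') 0"
proof -
  have m1: "br (dA (gen b)) (gen b') \<in> A 1" "br (dA (gen b')) (gen b) \<in> A 1"
    using br_mem[OF dA_gen_mem[OF b] gen_mem[OF b']] br_mem[OF dA_gen_mem[OF b'] gen_mem[OF b]] by simp_all
  have sw: "br (gen b) (dA (gen b')) = - br (dA (gen b')) (gen b)"
    using br_antisym[OF gen_mem[OF b] dA_gen_mem[OF b']] by (simp add: ksign_eq)
  have "dA (gen (lie b b')) = br (dA (gen b)) (gen b') - br (dA (gen b')) (gen b)"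
  proof (rule A_one_eqI[OF dA_gen_mem[OF lie_B[OF b b']] A_diff[OF m1]])
    fix \<phi> x assume \<phi>: "\<phi> \<in> Bdual" and x: "x \<in> C"
    have v: "br (dA (gen b)) (gen b') (\<phi>, [x]) = - \<phi> (bpart (lie b' (bpart (lie x b)))) + \<phi> (bpart (lie (s (lie b' x)) b))"
      if b: "b \<in> B" and b': "b' \<in> B" for b b'
      by (simp add: br_gen_slice[OF dA_gen_mem[OF b] b' \<phi>] \<rho>_coadjoint[OF b' A_slice[OF dA_gen_mem[OF b] \<phi>] x]
          dA_gen_value[OF b \<phi>] dA_gen_value[OF b coact_b_mem[OF \<phi>]] coact_b_apply[OF bpart_B] x)
    have sgn: "lie (s (lie b' x)) b = lie b (s (lie x b'))" for b b'
      using lie_antisym[of "s (lie b' x)" b] lie_antisym[of b' x] by (simp add: s_minus lie_simps)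
    have j: "lie x (lie b b') = - lie b' (lie x b) + lie b (lie x b')"
      using lie_jacobi[of x b b'] lie_antisym[of "lie x b" b'] by simp
    show "dA (gen (lie b b')) (\<phi>, [x]) = (br (dA (gen b)) (gen b') - br (dA (gen b')) (gen b)) (\<phi>, [x])"
      unfolding minus_apply v[OF b b'] v[OF b' b] dA_gen_value[OF lie_B[OF b b'] \<phi> x] sgn j
      by (simp only: lie_simps dual_more[OF \<phi>]) (simp add: algebra_simps)
  qed
  then show ?thesis by (simp add: leibniz_at_def br_gen_gen[OF b b'] sw ksign_eq)
qed

text \<open>The last argument is spread from \<open>1 \<otimes> x\<close> to all elements, the two arguments are exchanged, and the
  other one is spread in the same way.\<close>

lemma dA_br:
  assumes a: "a \<in> A m" and b: "b \<in> A n"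
  shows "dA (br a b) = br (dA a) b + fscale (ksign 1 m) (br a (dA b))"
proof -
  have 1: "leibniz_at (gen x) d 0" if "x \<in> B" "d \<in> A i" for x d i
    by (rule leibniz_at_dense[OF gen_mem[OF that(1)] that(2) leibniz_at_gen[OF that(1)]])
  have "leibniz_at a (gen x) m" if "x \<in> B" for x
    by (rule leibniz_at_swap[OF gen_mem[OF that] a 1[OF that a]])
  then show ?thesis using leibniz_at_dense[OF a b] by (simp add: leibniz_at_def)
qed

section \<open>The CDG Lie algebroid\<close>

lemma wedge_bilinear: "graded_bilinear fscale R fscale R fscale R wedge"
  by (rule graded_bilinearI) (simp_all only: wedge_linear wedge_mem)

lemma smul_bilinear: "graded_bilinear fscale R fscale A fscale A smul"
  by (rule graded_bilinearI) (simp_all only: smul_simps smul_mem)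

lemma act_superderivation:
  assumes a: "a \<in> A m"
  shows "superderivation fscale R wedge m (act a)"
  unfolding superderivation_def graded_linear_def
proof (intro conjI allI ballI)
  show "linear_betw fscale (Defs.total fscale R) fscale (act a)"
    using act_bilinear total_mem[of a A m, OF a] unfolding graded_bilinear_def by blast
  show "act a ` R n \<subseteq> R (n + m)" for n
  proof (rule image_subsetI)
    fix r assume "r \<in> R n"
    from act_mem[OF a this] show "act a r \<in> R (n + m)" by (subst add.commute)
  qed
qed (rule leibnizD[OF act_leibniz[OF a]])

theorem cdg: "cdg_lie_algebroid fscale R wedge ext_one fscale A br smul act dA dR h"
proof (intro cdg_lie_algebroid.intro graded_super_lie_algebroid.intro
    graded_supercomm_algebra.intro graded_lie_superalgebra.intro
    cdg_lie_algebroid_axioms.intro graded_super_lie_algebroid_axioms.intro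
    graded_supercomm_algebra_axioms.intro graded_lie_superalgebra_axioms.intro)
  show "graded_space fscale R"
    by (rule graded_spaceI[OF subspace_ext, where deg=length]) (use ext_support in blast)
  show "graded_space fscale A"
  proof (rule graded_spaceI[OF subspace_A, where deg="\<lambda>p. length (snd p)"])
    fix n v p assume v: "v \<in> A n" and nz: "v p \<noteq> 0"
    then have "slice v (fst p) (snd p) \<noteq> 0" by simp
    then show "int (length (snd p)) = n" using ext_support[OF A_slice'[OF v]] by blast
  qed
  show "wedge x y = fscale (ksign m n) (wedge y x)" if "x \<in> R m" "y \<in> R n" for x y m n
    by (rule wedge_supercomm[OF ext_homogeneous[OF that(1)] ext_homogeneous[OF that(2)]])
  show "superderivation fscale A br 1 dA"
    unfolding superderivation_def using dA_linear dA_br by blast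
qed (rule wedge_bilinear ext_one_mem wedge_one_left wedge_assoc smul_bilinear smul_one smul_assoc
    act_bilinear br_bilinear dR_derivation h_mem dA_h br_antisym br_jacobi act_superderivation act_br
    act_smul br_smul dA_smul dR_act dA_dA dR_dR; assumption)+

end

theorem proposition4p2p3:
  fixes sc :: "complex \<Rightarrow> 'g \<Rightarrow> 'g::{ab_group_add,uniform_topological_group_add,t2_space}"
    and lie :: "'g \<Rightarrow> 'g \<Rightarrow> 'g" and B :: "'g set" and s :: "'g \<Rightarrow> 'g" and E :: "'g set"
  assumes "tate_lie_algebra sc lie"
    and "lie_subalgebra sc lie B"
    and "c_lattice sc B"
    and "linear_section sc B s"
    and "basis_of sc (range s) E"
  shows "(\<exists>\<rho> act br dA dR h.
      c_lattice_cdg_data sc lie B s (ext_dual sc (range s)) (compl_tensor sc B (range s))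
        \<rho> act br E dA dR h) \<and>
    (\<forall>\<rho> act br dA dR h.
      c_lattice_cdg_data sc lie B s (ext_dual sc (range s)) (compl_tensor sc B (range s))
        \<rho> act br E dA dR h \<longrightarrow>
      cdg_lie_algebroid fscale (ext_dual sc (range s)) wedge ext_one
        fscale (compl_tensor sc B (range s)) br tens_smul act dA dR h)"
proof -
  interpret split_tate_lie_algebra sc lie B s E
    by (rule split_tate_lie_algebra.intro[OF assms])
  show ?thesis
  proof (intro conjI allI impI)
    show "\<exists>\<rho> act br dA dR h. c_lattice_cdg_data sc lie B s R A \<rho> act br E dA dR h"
      using cdg_data_exists by blast
    fix \<rho> act br dA dR h
    assume data: "c_lattice_cdg_data sc lie B s R A \<rho> act br E dA dR h"
    show "cdg_lie_algebroid fscale R wedge ext_one fscale A br tens_smul act dA dR h"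
      by (rule split_cdg_data.cdg[OF split_cdg_data.intro[OF split_tate_lie_algebra_axioms data]])
  qed
qed

end
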